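(* Let $\mathbf n=(n_1,\dots,n_r)$ with $r\ge1$ and $n_i\ge1$ for all $i$, and let $R:=\{i\in[r]: n_i\ge2\}$. If $0\le k\le\sum_{i\in R}\big\lfloor\frac{n_i-2}{2}\big\rfloor$, then $\delta_{pr}(k,\mathbf n)\ge 2k+|R|+1$.
   Context: $\Delta_m$ denotes the $m$-dimensional simplex; for $\mathbf n=(n_1,\dots,n_r)$, $\Delta_{\mathbf n}:=\Delta_{n_1}\times\dots\times\Delta_{n_r}$. The $k$-skeleton of a polytope is the poset of its faces of dimension at most $k$; two $k$-skeleta are combinatorially equivalent if these posets are isomorphic. A convex polytope is $(k,\mathbf n)$-PSN if its $k$-skeleton is combinatorially equivalent to that of $\Delta_{\mathbf n}$, and $(k,\mathbf n)$-PPSN if in addition it is the image under a linear projection of a polytope combinatorially equivalent to $\Delta_{\mathbf n}$. $\delta_{pr}(k,\mathbf n)$ is the smallest dimension of a $(k,\mathbf n)$-PPSN polytope. *)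

theory Defs
  imports "HOL-Analysis.Analysis"
begin

text \<open>Faces of a polytope of dimension at most k (the k-skeleton), including the empty face.\<close>
definition skeleton :: "int \<Rightarrow> 'a::euclidean_space set \<Rightarrow> 'a set set" where
  "skeleton k P = {F. F face_of P \<and> aff_dim F \<le> k}"

definition poset_iso :: "'a set set \<Rightarrow> 'b set set \<Rightarrow> bool" where
  "poset_iso A B \<longleftrightarrow> (\<exists>f. bij_betw f A B \<and> (\<forall>F\<in>A. \<forall>G\<in>A. F \<subseteq> G \<longleftrightarrow> f F \<subseteq> f G))"

definition skel_equiv :: "nat \<Rightarrow> 'a::euclidean_space set \<Rightarrow> 'b::euclidean_space set \<Rightarrow> bool" where
  "skel_equiv k P Q \<longleftrightarrow> poset_iso (skeleton (int k) P) (skeleton (int k) Q)"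

definition comb_equiv :: "'a::euclidean_space set \<Rightarrow> 'b::euclidean_space set \<Rightarrow> bool" where
  "comb_equiv P Q \<longleftrightarrow> poset_iso {F. F face_of P} {F. F face_of Q}"

text \<open>D is (an affine realization of) the product of simplices
  Delta_{n_1} x ... x Delta_{n_r}, written as the Minkowski sum of simplices
  conv{a i 0, ..., a i n_i} whose edge directions a i j - a i 0 (all i, j >= 1)
  are jointly linearly independent.\<close>
definition prod_simplices :: "nat list \<Rightarrow> 'a::euclidean_space set \<Rightarrow> bool" where
  "prod_simplices ns D \<longleftrightarrow>
     (\<exists>a :: nat \<Rightarrow> nat \<Rightarrow> 'a.
        inj_on (\<lambda>(i,j). a i j - a i 0) {(i,j). i < length ns \<and> 1 \<le> j \<and> j \<le> ns!i} \<and>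
        independent ((\<lambda>(i,j). a i j - a i 0) ` {(i,j). i < length ns \<and> 1 \<le> j \<and> j \<le> ns!i}) \<and>
        D = {(\<Sum>i<length ns. y i) | y. \<forall>i<length ns. y i \<in> convex hull (a i ` {0..ns!i})})"

end

theory Submission
  imports Defs
begin

text \<open>
  Suppose \<open>aff_dim P\<close> is too small. Let \<open>W\<close> be the kernel of the projection inside the direction space of \<open>Q\<close>.
  The projection preserves every face of \<open>Q\<close> of dimension at most \<open>k\<close>, since the graphs of the skeleta
  determine the dimensions of the faces. Hence no nonzero vector of \<open>W\<close> can have nonpositive inner product with the
  normals of all facets containing such a face. On the other hand, write \<open>k\<close> as a sum of
  \<open>k i \<le> (n i - 2) div 2\<close>. The dimension of \<open>W\<close> suffices to find a nonzero vector which has positive inner product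
  with at most \<open>k i + 1\<close> of the facet normals belonging to the \<open>i\<close>-th factor, for every \<open>i\<close>; the remaining facets contain
  a common face of dimension at most \<open>k\<close>.

  The vector comes from a discrete ham sandwich theorem, which takes the place of the Borsuk-Ulam theorem: given
  \<open>DIM('a) - 1\<close> color classes of vectors, each of odd size, some linear hyperplane bisects all of them. For
  vectors in general position, the number of bisecting hyperplanes spanned by one vector of each color is odd: its parity
  does not change when one vector crosses a hyperplane spanned by the others, and there is a configuration
  with exactly one such hyperplane. The general case follows by compactness.
\<close>

section \<open>Hyperplanes and general position\<close>

text \<open>The bound comes from a count of colors. A factor with \<open>n i \<ge> 2\<close> has
  \<open>n i + 1\<close> facet normals; \<open>2 * k i + 3\<close> of them share one color and every
  other one is a color of its own, so the factor uses \<open>n i - (2 * k i + 1)\<close> colors.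
  Half of \<open>2 * k i + 3\<close>, rounded down, is the permitted \<open>k i + 1\<close>, and
  \<open>k i \<le> (n i - 2) div 2\<close> says exactly that such a class fits. A segment factor
  uses one color. In total this makes \<open>2 * k + card R\<close> colors fewer than the dimension
  of \<open>Q\<close>, and if \<open>aff_dim P \<le> 2 * k + card R\<close> then \<open>W\<close>
  has at least that dimension. The other obstacle is that the isomorphism between the skeleta of
  \<open>P\<close> and of the product is arbitrary: it need not be induced by the projection, and a
  face of \<open>P\<close> could a priori have a preimage of larger dimension. A count of vertices
  and edges excludes this.\<close>

lemma orthogonal_span_zero:
  fixes B :: "'a::euclidean_space set"
  assumes "\<And>x. x \<in> B \<Longrightarrow> \<phi> \<bullet> x = 0" "y \<in> span B"
  shows "\<phi> \<bullet> y = 0"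
  using orthogonal_to_span[of y B \<phi>] assms by (auto simp: orthogonal_def)

lemma independent_span_UNIV:
  fixes B :: "'a::euclidean_space set"
  assumes "independent B" "card B = DIM('a)"
  shows "span B = UNIV"
proof -
  have "finite B" using assms(1) by (simp add: independent_imp_finite)
  have "UNIV \<subseteq> span B"
    by (rule card_ge_dim_independent) (use assms in \<open>auto simp: dim_UNIV\<close>)
  then show ?thesis by auto
qed

lemma hyperplane_normal_exists:
  fixes B :: "'a::euclidean_space set"
  assumes "finite B" "card B < DIM('a)"
  obtains n where "n \<noteq> 0" "\<And>x. x \<in> B \<Longrightarrow> n \<bullet> x = 0"
proof -
  have "dim B < DIM('a)" using dim_le_card'[OF assms(1)] assms(2) by linarith
  then obtain n where "n \<noteq> 0" "span B \<subseteq> {x. n \<bullet> x = 0}"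
    using lowdim_subset_hyperplane by blast
  then show ?thesis using span_superset[of B] that by blast
qed

text \<open>\<open>insert n B\<close> is a basis, and \<open>\<phi>\<close> minus its component
  along \<open>n\<close> is orthogonal to all of it.\<close>

lemma hyperplane_normal_unique:
  fixes B :: "'a::euclidean_space set"
  assumes "independent B" "card B + 1 = DIM('a)"
    and "n \<noteq> 0" "\<And>x. x \<in> B \<Longrightarrow> n \<bullet> x = 0"
    and "\<And>x. x \<in> B \<Longrightarrow> \<phi> \<bullet> x = 0"
  obtains k where "\<phi> = k *\<^sub>R n"
proof -
  have fin: "finite B" using assms(1) by (simp add: independent_imp_finite)
  have nin: "n \<notin> span B"
    using orthogonal_span_zero[of B n n] assms(3,4) by auto
  have ind: "independent (insert n B)" using assms(1) nin by (simp add: independent_insert)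
  have "n \<notin> B" using nin span_base by blast
  then have sp: "span (insert n B) = UNIV"
    by (intro independent_span_UNIV ind) (use assms(2) fin in simp)
  define \<psi> where "\<psi> = \<phi> - ((\<phi> \<bullet> n) / (n \<bullet> n)) *\<^sub>R n"
  have "\<psi> \<bullet> x = 0" if "x \<in> insert n B" for x
    using that assms(3,4,5) by (auto simp: \<psi>_def inner_diff_left)
  then have "\<psi> \<bullet> \<psi> = 0" using orthogonal_span_zero[of "insert n B" \<psi> \<psi>] sp by auto
  then have "\<phi> = ((\<phi> \<bullet> n) / (n \<bullet> n)) *\<^sub>R n" by (simp add: \<psi>_def)
  then show ?thesis using that by blast
qed

text \<open>General position of an indexed family. Injectivity is demanded separately because the
  image of \<open>S\<close> under \<open>u\<close> forgets repetitions.\<close>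

definition generic :: "'x set \<Rightarrow> ('x \<Rightarrow> 'a::euclidean_space) \<Rightarrow> bool" where
  "generic X u \<longleftrightarrow>
     (\<forall>S\<subseteq>X. finite S \<and> card S \<le> DIM('a) \<longrightarrow> inj_on u S \<and> independent (u ` S))"

lemma generic_subset: "generic X u \<Longrightarrow> Y \<subseteq> X \<Longrightarrow> generic Y u"
  unfolding generic_def by blast

lemma generic_cong:
  assumes "\<And>x. x \<in> X \<Longrightarrow> u x = w x"
  shows "generic X u \<longleftrightarrow> generic X w"
proof -
  have "inj_on u S \<longleftrightarrow> inj_on w S" "u ` S = w ` S" if "S \<subseteq> X" for S
    using that assms by (auto intro!: inj_on_cong image_cong)
  then show ?thesis unfolding generic_def by (simp cong: conj_cong)
qed

lemma generic_independent:
  fixes u :: "'x \<Rightarrow> 'a::euclidean_space"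
  assumes "generic X u" "S \<subseteq> X" "finite S" "card S \<le> DIM('a)"
  shows "independent (u ` S)" "card (u ` S) = card S"
  using assms card_image[of u S] unfolding generic_def by simp_all

text \<open>Together with \<open>z\<close> the vectors spanning the hyperplane form a basis, and no
  nonzero vector is orthogonal to a basis.\<close>

lemma generic_normal_nonzero:
  fixes u :: "'x \<Rightarrow> 'a::euclidean_space"
  assumes "generic X u" "S \<subseteq> X" "finite S" "card S + 1 = DIM('a)"
    and "n \<noteq> 0" "\<And>x. x \<in> S \<Longrightarrow> n \<bullet> u x = 0" "z \<in> X" "z \<notin> S"
  shows "n \<bullet> u z \<noteq> 0"
proof
  assume "n \<bullet> u z = 0"
  have "independent (u ` insert z S)" "card (u ` insert z S) = card (insert z S)"
    by (rule generic_independent[OF assms(1)]; use assms in simp)+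
  then have "span (u ` insert z S) = UNIV"
    using independent_span_UNIV[of "u ` insert z S"] assms by simp
  then have "n \<bullet> n = 0"
    using orthogonal_span_zero[of "u ` insert z S" n n] assms(6) \<open>n \<bullet> u z = 0\<close> by auto
  then show False using assms by simp
qed

text \<open>Only index sets containing \<open>x\<close> are at stake; their other members number
  fewer than \<open>DIM('a)\<close>, so it suffices that \<open>w\<close> avoids the spans of so few
  vectors.\<close>

lemma generic_upd:
  fixes u :: "'x \<Rightarrow> 'a::euclidean_space"
  assumes "generic (X - {x}) u" "finite X" "x \<in> X"
    and "\<And>B. B \<subseteq> u ` (X - {x}) \<Longrightarrow> card B < DIM('a) \<Longrightarrow> w \<notin> span B"
  shows "generic X (u(x := w))"
  unfolding generic_def
proof (intro allI impI)
  fix S assume S: "S \<subseteq> X" "finite S \<and> card S \<le> DIM('a)"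
  let ?S = "S - {x}"
  have eq: "u(x := w) ` ?S = u ` ?S" by auto
  have "card ?S \<le> DIM('a)" using S by (meson card_Diff1_le le_trans)
  then have ind: "inj_on u ?S" "independent (u ` ?S)"
    using assms(1) S unfolding generic_def by (meson Diff_mono finite_Diff subset_refl)+
  show "inj_on (u(x := w)) S \<and> independent (u(x := w) ` S)"
  proof (cases "x \<in> S")
    case False
    then have SS: "?S = S" by auto
    have "(u(x := w)) y = u y" if "y \<in> S" for y using that False by auto
    then have "inj_on (u(x := w)) S \<longleftrightarrow> inj_on u S"
      by (rule inj_on_cong)
    then have "inj_on (u(x := w)) S" using ind(1) unfolding SS by (rule iffD2)
    moreover have "independent (u(x := w) ` S)" using ind(2) eq unfolding SS by (rule ssubst[rotated])
    ultimately show ?thesis by (rule conjI)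
  next
    case True
    have "card ?S < DIM('a)" using S True by (metis Suc_le_lessD card.remove)
    then have "card (u ` ?S) < DIM('a)" using card_image[OF ind(1)] by simp
    then have n: "w \<notin> span (u ` ?S)" using assms(4)[of "u ` ?S"] S(1) by blast
    have im: "u(x := w) ` S = insert w (u ` ?S)" using True by auto
    have "w \<notin> u ` ?S" using n span_base[of w "u ` ?S"] by metis
    then have "inj_on (u(x := w)) ?S" "(u(x := w)) x \<notin> (u(x := w)) ` ?S"
      using inj_on_fun_updI[OF ind(1)] eq by simp_all
    then have "inj_on (u(x := w)) (insert x ?S)" unfolding inj_on_insert by simp
    then have "inj_on (u(x := w)) S" using insert_Diff[OF True] by simp
    then show ?thesis using n ind im by (simp add: independent_insert)
  qed
qed

text \<open>Proper subspaces are null sets, so finitely many of them cannot cover a ball.\<close>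

lemma avoid_small_spans:
  fixes v :: "'a::euclidean_space"
  assumes "finite Z" "\<delta> > 0"
  obtains w where "dist w v < \<delta>" "\<And>B. B \<subseteq> Z \<Longrightarrow> card B < DIM('a) \<Longrightarrow> w \<notin> span B"
proof -
  let ?U = "\<Union>(span ` {B. B \<subseteq> Z \<and> card B < DIM('a)})"
  have "finite {B. B \<subseteq> Z \<and> card B < DIM('a)}" using assms(1) by simp
  moreover have "negligible (span B)" if "B \<subseteq> Z" "card B < DIM('a)" for B
  proof (rule negligible_lowdim)
    have "finite B" using that assms finite_subset by blast
    then show "dim (span B) < DIM('a)" using dim_le_card'[of B] that(2) by (simp add: dim_span)
  qed
  ultimately have "negligible ?U" by (intro negligible_Union) auto
  moreover have "\<not> negligible (ball v \<delta>)"
    using assms(2) by (simp add: open_not_negligible)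
  ultimately have "\<not> ball v \<delta> \<subseteq> ?U" using negligible_subset by blast
  then obtain w where "w \<in> ball v \<delta>" "w \<notin> ?U" by blast
  then show ?thesis using that[of w] by (auto simp: dist_commute)
qed

lemma generic_perturbation:
  fixes u :: "'x \<Rightarrow> 'a::euclidean_space"
  assumes "finite X" "\<delta> > 0"
  obtains w where "generic X w" "\<And>x. dist (w x) (u x) < \<delta>"
proof -
  have "\<exists>w. generic X w \<and> (\<forall>x. dist (w x) (u x) < \<delta>)"
    using assms(1)
  proof (induction X rule: finite_induct)
    case empty
    show ?case by (rule exI[of _ u]) (use assms(2) in \<open>auto simp: generic_def independent_empty\<close>)
  next
    case (insert x X)
    then obtain w where w: "generic X w" "\<forall>x. dist (w x) (u x) < \<delta>" by blast
    obtain z where z: "dist z (u x) < \<delta>"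
        "\<And>B. B \<subseteq> w ` X \<Longrightarrow> card B < DIM('a) \<Longrightarrow> z \<notin> span B"
      using avoid_small_spans[of "w ` X" \<delta> "u x"] insert assms(2) by auto
    have X: "insert x X - {x} = X" using insert by auto
    have "generic (insert x X) (w(x := z))"
      by (rule generic_upd) (use insert w z X in auto)
    moreover have "dist ((w(x := z)) y) (u y) < \<delta>" for y using w z by simp
    ultimately show ?case by blast
  qed
  then show ?thesis using that by blast
qed

text \<open>\<open>J\<close> projects to the plane orthogonal to \<open>R\<close> and then maps every vector to one orthogonal to it, like a
  rotation by a right angle.\<close>

lemma rotation_of_orthogonal_plane:
  fixes R :: "'a::euclidean_space set"
  assumes "independent R" "card R + 2 = DIM('a)"
  obtains J :: "'a \<Rightarrow> 'a" where
    "\<And>v y. J v \<bullet> y = - (J y \<bullet> v)" "\<And>v r. r \<in> R \<Longrightarrow> J v \<bullet> r = 0"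
    "\<And>v. v \<notin> span R \<Longrightarrow> J v \<noteq> 0"
proof -
  have fin: "finite R" using assms(1) by (simp add: independent_imp_finite)
  obtain e1 where e1: "e1 \<noteq> 0" "\<And>x. x \<in> R \<Longrightarrow> e1 \<bullet> x = 0"
    using hyperplane_normal_exists[OF fin] assms(2) by auto
  have "card (insert e1 R) < DIM('a)"
    using assms(2) card_insert_le_m1[of "Suc (card R)" R e1] by (simp add: card_insert_if fin)
  then obtain e2 where e2: "e2 \<noteq> 0" "\<And>x. x \<in> insert e1 R \<Longrightarrow> e2 \<bullet> x = 0"
    using hyperplane_normal_exists[of "insert e1 R"] fin by (metis finite_insert)
  define J where "J v = (v \<bullet> e1) *\<^sub>R e2 - (v \<bullet> e2) *\<^sub>R e1" for v
  have e12: "e2 \<bullet> e1 = 0" "e1 \<bullet> e2 = 0" using e2 by (auto simp: inner_commute)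
  have "J v \<bullet> y = - (J y \<bullet> v)" for v y
    by (simp add: J_def inner_diff_left inner_commute algebra_simps)
  moreover have "J v \<bullet> r = 0" if "r \<in> R" for v r
    using that e1 e2 by (simp add: J_def inner_diff_left)
  moreover have "J v \<noteq> 0" if "v \<notin> span R" for v
  proof
    assume J0: "J v = 0"
    have "J v \<bullet> e2 = (v \<bullet> e1) * (e2 \<bullet> e2)" "J v \<bullet> e1 = - (v \<bullet> e2) * (e1 \<bullet> e1)"
      using e12 by (simp_all add: J_def inner_diff_left)
    then have v: "v \<bullet> e1 = 0" "v \<bullet> e2 = 0" using J0 e1 e2 by auto
    \<comment> \<open>Both \<open>e1\<close> and \<open>e2\<close> are now normals of the hyperplane
      spanned by \<open>v\<close> and \<open>R\<close>, hence proportional, although they are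
      nonzero and orthogonal to each other.\<close>
    have "v \<notin> R" using that span_base by blast
    then have *: "independent (insert v R)" "card (insert v R) + 1 = DIM('a)"
      using that assms fin by (auto simp: independent_insert)
    obtain k where "e2 = k *\<^sub>R e1"
    proof (rule hyperplane_normal_unique[OF * e1(1)])
      show "e1 \<bullet> x = 0" "e2 \<bullet> x = 0" if "x \<in> insert v R" for x
        using that e1(2) e2(2) v by (auto simp: inner_commute[of v])
    qed blast
    then have "e2 \<bullet> e2 = 0" using e12 by simp
    then show False using e2 by simp
  qed
  ultimately show ?thesis using that by blast
qed

section \<open>Cuts of colored vectors and their parity\<close>

text \<open>Points on the hyperplane contribute \<open>sgn 0 = 0\<close>, so this says that each
  color has equally many points strictly on either side.\<close>

definition balanced :: "('x \<Rightarrow> 'i) \<Rightarrow> 'i set \<Rightarrow> 'x set \<Rightarrow> ('x \<Rightarrow> 'a::euclidean_space) \<Rightarrow> 'a \<Rightarrow> bool" where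
  "balanced c I X u \<phi> \<longleftrightarrow> (\<forall>i\<in>I. (\<Sum>x\<in>{x\<in>X. c x = i}. sgn (\<phi> \<bullet> u x)) = 0)"

text \<open>A cut is recorded by its rainbow set \<open>T\<close>, one point of each color, and not
  by a normal, which is determined only up to scaling. This makes the cuts a finite set whose parity
  can be followed.\<close>

definition cuts :: "('x \<Rightarrow> 'i) \<Rightarrow> 'i set \<Rightarrow> 'x set \<Rightarrow> ('x \<Rightarrow> 'a::euclidean_space) \<Rightarrow> 'x set set" where
  "cuts c I X u = {T. T \<subseteq> X \<and> bij_betw c T I \<and>
     (\<exists>\<phi>. \<phi> \<noteq> 0 \<and> (\<forall>x\<in>T. \<phi> \<bullet> u x = 0) \<and> balanced c I X u \<phi>)}"

lemma balanced_cong_sgn: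
  assumes "\<And>x. x \<in> X \<Longrightarrow> sgn (\<phi> \<bullet> u x) = sgn (\<psi> \<bullet> w x)"
  shows "balanced c I X u \<phi> \<longleftrightarrow> balanced c I X w \<psi>"
  unfolding balanced_def using assms by (intro ball_cong refl arg_cong2[where f="(=)"] sum.cong) auto

lemma balanced_scaleR:
  assumes "k \<noteq> 0"
  shows "balanced c I X u (k *\<^sub>R \<phi>) \<longleftrightarrow> balanced c I X u \<phi>"
  using assms by (simp add: balanced_def sgn_mult sum_distrib_left[symmetric] sgn_eq_0_iff)

lemma finite_cuts: "finite X \<Longrightarrow> finite (cuts c I X u)"
  by (rule finite_subset[of _ "Pow X"]) (auto simp: cuts_def)

text \<open>The normal of the spanned hyperplane is unique up to a nonzero factor, and balance is
  insensitive to that factor; hence any one normal decides.\<close>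

lemma cuts_iff_balanced:
  fixes u :: "'x \<Rightarrow> 'a::euclidean_space"
  assumes "T \<subseteq> X" "bij_betw c T I"
    and "independent (u ` T)" "card (u ` T) + 1 = DIM('a)"
    and "\<phi> \<noteq> 0" "\<And>x. x \<in> T \<Longrightarrow> \<phi> \<bullet> u x = 0"
  shows "T \<in> cuts c I X u \<longleftrightarrow> balanced c I X u \<phi>"
proof
  assume "T \<in> cuts c I X u"
  then obtain \<psi> where \<psi>: "\<psi> \<noteq> 0" "\<forall>x\<in>T. \<psi> \<bullet> u x = 0" "balanced c I X u \<psi>"
    unfolding cuts_def by blast
  obtain k where "\<psi> = k *\<^sub>R \<phi>"
  proof (rule hyperplane_normal_unique[OF assms(3,4,5)])
    show "\<phi> \<bullet> x = 0" "\<psi> \<bullet> x = 0" if "x \<in> u ` T" for x using that assms(6) \<psi>(2) by auto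
  qed blast
  then show "balanced c I X u \<phi>" using \<psi> balanced_scaleR[of k c I X u \<phi>] by auto
qed (use assms in \<open>auto simp: cuts_def\<close>)

lemma sgn_convex_combination:
  fixes a b t :: real
  assumes "sgn a = sgn b" "0 \<le> t" "t \<le> 1"
  shows "sgn ((1 - t) * a + t * b) = sgn a"
proof -
  consider "a = 0" "b = 0" | "a > 0" "b > 0" | "a < 0" "b < 0"
    using assms(1) by (auto simp: sgn_if split: if_splits)
  then show ?thesis
  proof cases
    case 2
    then have "(1 - t) * a + t * b > 0" using assms(2,3)
      by (cases "t = 0") (auto intro: add_nonneg_pos)
    then show ?thesis using 2 by simp
  next
    case 3
    then have "(1 - t) * a + t * b < 0" using assms(2,3)
      by (cases "t = 0") (auto intro!: add_nonpos_neg simp: mult_nonneg_nonpos mult_pos_neg)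
    then show ?thesis using 3 by simp
  qed simp
qed

lemma sgn_opposite_zero:
  fixes a b :: real
  assumes "a * b < 0"
  obtains t where "0 < t" "t < 1" "(1 - t) * a + t * b = 0"
proof
  have ab: "a - b \<noteq> 0" using assms by (metis mult_less_0_iff not_less_iff_gr_or_eq eq_iff_diff_eq_0)
  have c: "a > 0 \<and> b < 0 \<or> a < 0 \<and> b > 0" using assms by (auto simp: mult_less_0_iff)
  then show "0 < a / (a - b)" "a / (a - b) < 1" by (auto simp: divide_simps)
  show "(1 - a / (a - b)) * a + a / (a - b) * b = 0" using ab by (simp add: field_simps)
qed

section \<open>Cuts under the motion of a single vector\<close>

locale moving_vector =
  fixes X :: "'x set" and I :: "'i set" and c :: "'x \<Rightarrow> 'i" and u :: "'x \<Rightarrow> 'a::euclidean_space"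
    and x0 :: 'x and \<nu> :: "'x set \<Rightarrow> 'a"
  assumes finX: "finite X" and finI: "finite I" and cI: "c ` X \<subseteq> I" and cardI: "card I + 1 = DIM('a)"
    and odd_class: "\<And>i. i \<in> I \<Longrightarrow> odd (card {x \<in> X. c x = i})"
    and x0: "x0 \<in> X" and gen: "generic (X - {x0}) u" and large: "DIM('a) \<le> card X"
    and \<nu>_nz: "\<And>S. S \<subseteq> X - {x0} \<Longrightarrow> card S + 1 = DIM('a) \<Longrightarrow> \<nu> S \<noteq> 0"
    and \<nu>_orth: "\<And>S x. S \<subseteq> X - {x0} \<Longrightarrow> card S + 1 = DIM('a) \<Longrightarrow> x \<in> S \<Longrightarrow> \<nu> S \<bullet> u x = 0"
begin

text \<open>A wall is the hyperplane spanned by \<open>DIM('a) - 1\<close> fixed vectors, named by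
  their indices. The configuration degenerates only when the moving vector lies on a wall.\<close>

definition walls :: "'x set set" where
  "walls = {S. S \<subseteq> X - {x0} \<and> card S + 1 = DIM('a)}"

definition off_walls :: "'a \<Rightarrow> bool" where
  "off_walls v \<longleftrightarrow> (\<forall>S\<in>walls. \<nu> S \<bullet> v \<noteq> 0)"

definition separating :: "'a \<Rightarrow> 'a \<Rightarrow> 'x set set" where
  "separating v w = {S \<in> walls. (\<nu> S \<bullet> v) * (\<nu> S \<bullet> w) < 0}"

abbreviation cfg :: "'a \<Rightarrow> 'x \<Rightarrow> 'a" where "cfg v \<equiv> u(x0 := v)"

abbreviation cutset :: "'a \<Rightarrow> 'x set set" where "cutset v \<equiv> cuts c I X (cfg v)"

lemma finite_walls: "finite walls"
  by (rule finite_subset[of _ "Pow X"]) (auto simp: walls_def finX)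

lemma finite_separating: "finite (separating v w)"
  using finite_walls by (simp add: separating_def)

lemma wallD:
  assumes "S \<in> walls"
  shows "S \<subseteq> X - {x0}" "S \<subseteq> X" "x0 \<notin> S" "finite S" "card S + 1 = DIM('a)" "independent (u ` S)"
    "card (u ` S) + 1 = DIM('a)" "\<nu> S \<noteq> 0" "\<And>x. x \<in> S \<Longrightarrow> \<nu> S \<bullet> u x = 0"
proof -
  show *: "S \<subseteq> X - {x0}" "card S + 1 = DIM('a)" using assms by (auto simp: walls_def)
  then show f: "finite S" "S \<subseteq> X" "x0 \<notin> S" using finX finite_subset by auto
  show "independent (u ` S)" "card (u ` S) + 1 = DIM('a)"
    using generic_independent[OF gen *(1) f(1)] *(2) by auto
  show "\<nu> S \<noteq> 0" "\<And>x. x \<in> S \<Longrightarrow> \<nu> S \<bullet> u x = 0" using \<nu>_nz \<nu>_orth * by auto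
qed

lemma wall_normal_unique:
  assumes "S \<in> walls" "\<And>x. x \<in> S \<Longrightarrow> \<phi> \<bullet> u x = 0"
  obtains k where "\<phi> = k *\<^sub>R \<nu> S"
proof -
  show ?thesis
    by (rule hyperplane_normal_unique[of "u ` S" "\<nu> S" \<phi>]) (use wallD[OF assms(1)] assms(2) that in auto)
qed

lemma wall_normal_nonzero:
  assumes "S \<in> walls" "z \<in> X - {x0}" "z \<notin> S"
  shows "\<nu> S \<bullet> u z \<noteq> 0"
  by (rule generic_normal_nonzero[OF gen]) (use wallD[OF assms(1)] assms in auto)

lemma sgn_same_side:
  assumes "S \<in> walls" "S \<notin> separating v w" "off_walls v" "off_walls w"
    and "\<And>x. x \<in> S \<Longrightarrow> \<phi> \<bullet> u x = 0"
  shows "sgn (\<phi> \<bullet> v) = sgn (\<phi> \<bullet> w)"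
proof -
  obtain k where k: "\<phi> = k *\<^sub>R \<nu> S" using wall_normal_unique assms(1,5) by blast
  have "\<nu> S \<bullet> v \<noteq> 0" "\<nu> S \<bullet> w \<noteq> 0" using assms unfolding off_walls_def by auto
  moreover have "\<not> (\<nu> S \<bullet> v) * (\<nu> S \<bullet> w) < 0" using assms(1,2) unfolding separating_def by auto
  ultimately have "sgn (\<nu> S \<bullet> v) = sgn (\<nu> S \<bullet> w)" by (auto simp: mult_less_0_iff sgn_if)
  then show ?thesis by (simp add: k sgn_mult)
qed

lemma sgn_opposite_sides:
  assumes "S \<in> separating v w" "\<And>x. x \<in> S \<Longrightarrow> \<phi> \<bullet> u x = 0"
  shows "sgn (\<phi> \<bullet> v) = - sgn (\<phi> \<bullet> w)"
proof -
  have "S \<in> walls" using assms(1) by (simp add: separating_def)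
  then obtain k where k: "\<phi> = k *\<^sub>R \<nu> S" using wall_normal_unique assms(2) by blast
  have "(\<nu> S \<bullet> v) * (\<nu> S \<bullet> w) < 0" using assms(1) unfolding separating_def by auto
  then have "sgn (\<nu> S \<bullet> v) = - sgn (\<nu> S \<bullet> w)" by (auto simp: mult_less_0_iff sgn_if)
  then show ?thesis by (simp add: k sgn_mult)
qed

lemma transversal_card:
  assumes "bij_betw c T I"
  shows "card T + 1 = DIM('a)"
  using bij_betw_same_card[OF assms] cardI by simp

lemma transversal_wall:
  assumes "bij_betw c T I" "T \<subseteq> X" "x0 \<notin> T"
  shows "T \<in> walls"
  using assms transversal_card by (auto simp: walls_def)

lemma transversal_insert_wall:
  assumes "bij_betw c T I" "T \<subseteq> X" "x0 \<in> T" "z \<in> X - T"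
  shows "insert z (T - {x0}) \<in> walls"
proof -
  have "finite T" using assms finX finite_subset by blast
  then have "card (insert z (T - {x0})) = card T" using assms card_Suc_Diff1[of T x0] by simp
  then show ?thesis using assms transversal_card by (auto simp: walls_def)
qed

text \<open>A transversal that avoids \<open>x0\<close> is itself a wall, so its normal does not
  depend on \<open>v\<close>.\<close>

lemma cutset_iff_static:
  assumes "bij_betw c T I" "T \<subseteq> X" "x0 \<notin> T"
  shows "T \<in> cutset v \<longleftrightarrow> balanced c I X (cfg v) (\<nu> T)"
proof -
  note w = wallD[OF transversal_wall[OF assms]]
  have "cfg v x = u x" if "x \<in> T" for x using that assms(3) by auto
  then have "cfg v ` T = u ` T" by auto
  then show ?thesis using w assms by (intro cuts_iff_balanced) auto
qed

text \<open>\<open>J v\<close> is the normal of the hyperplane spanned by the transversal \<open>T\<close> when the moving vector is \<open>v\<close>;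
  which side of it contains \<open>u z\<close> is decided by the side of the wall \<open>insert z (T - {x0})\<close> containing \<open>v\<close>.\<close>

lemma moving_normal:
  assumes "bij_betw c T I" "T \<subseteq> X" "x0 \<in> T"
  obtains J :: "'a \<Rightarrow> 'a" where
    "\<And>v y. J v \<bullet> y = - (J y \<bullet> v)" "\<And>v x. x \<in> T - {x0} \<Longrightarrow> J v \<bullet> u x = 0"
    "\<And>z. z \<in> X - T \<Longrightarrow> J (u z) \<noteq> 0"
    "\<And>v. off_walls v \<Longrightarrow> T \<in> cutset v \<longleftrightarrow> balanced c I X (cfg v) (J v)"
proof -
  let ?R = "T - {x0}"
  have fT: "finite T" using assms finX finite_subset by blast
  have cT: "card T + 1 = DIM('a)" using transversal_card assms by blast
  have cR: "card ?R + 2 = DIM('a)" using cT card.remove[OF fT assms(3)] by simp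
  have ind: "independent (u ` ?R)" "card (u ` ?R) = card ?R"
    using generic_independent[OF gen, of ?R] fT cR assms by auto
  obtain J where J: "\<And>v y. J v \<bullet> y = - (J y \<bullet> v)" "\<And>v r. r \<in> u ` ?R \<Longrightarrow> J v \<bullet> r = 0"
    "\<And>v. v \<notin> span (u ` ?R) \<Longrightarrow> J v \<noteq> 0"
    using rotation_of_orthogonal_plane[OF ind(1)] ind(2) cR by metis
  have nz: "J (u z) \<noteq> 0" if z: "z \<in> X - T" for z
  proof (rule J(3))
    note w = wallD[OF transversal_insert_wall[OF assms z]]
    have "u z \<notin> u ` ?R" 
    proof
      assume "u z \<in> u ` ?R"
      then have "u ` insert z ?R = u ` ?R" by auto
      then show False using w(7) ind(2) cR by simp
    qed
    then show "u z \<notin> span (u ` ?R)"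
      using w(6) by (simp add: independent_insert)
  qed
  have "T \<in> cutset v \<longleftrightarrow> balanced c I X (cfg v) (J v)" if v: "off_walls v" for v
  proof (rule cuts_iff_balanced[OF assms(2,1)])
    have "card T < card X" using cT large by simp
    then obtain z where z: "z \<in> X - T" using assms(2) by (metis DiffI psubset_imp_ex_mem psubsetI less_irrefl DiffE)
    \<comment> \<open>The spare point \<open>z\<close> shows that \<open>v\<close> is outside the
      span of \<open>?R\<close>: \<open>J (u z)\<close> is orthogonal to that span and is a normal
      of the wall \<open>?S\<close>, which \<open>v\<close> avoids.\<close>
    let ?S = "insert z ?R"
    have S: "?S \<in> walls" by (rule transversal_insert_wall[OF assms z])
    have "J (u z) \<bullet> u x = 0" if "x \<in> ?S" for x
      using that J(1)[of "u z" "u z"] J(2)[of "u x" "u z"] by auto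
    then obtain k where k: "J (u z) = k *\<^sub>R \<nu> ?S" using wall_normal_unique[OF S] by blast
    have "J (u z) \<bullet> v \<noteq> 0" using k nz[OF z] v S by (auto simp: off_walls_def)
    then have vn: "v \<notin> span (u ` ?R)" using orthogonal_span_zero[of "u ` ?R" "J (u z)" v] J(2) by blast
    then show "J v \<noteq> 0" by (rule J(3))
    have "cfg v x = u x" if "x \<in> ?R" for x using that by auto
    then have im: "cfg v ` T = insert v (u ` ?R)"
      using insert_Diff[OF assms(3)] by (metis fun_upd_same image_cong image_insert)
    have "v \<notin> u ` ?R" using vn span_base[of v "u ` ?R"] by metis
    then show "independent (cfg v ` T)" "card (cfg v ` T) + 1 = DIM('a)"
      unfolding im using vn ind cR fT by (auto simp: independent_insert)
    show "J v \<bullet> cfg v x = 0" if "x \<in> T" for x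
      using that J(1)[of v v] J(2)[of "u x" v] by auto
  qed
  then show ?thesis using that J nz by blast
qed

text \<open>The walls that influence \<open>T\<close> are \<open>T\<close> itself if
  \<open>x0 \<notin> T\<close>, and the sets \<open>insert z (T - {x0})\<close> otherwise. Each such
  wall \<open>S\<close> satisfies \<open>T \<subseteq> insert x0 S\<close>; if none of them is
  crossed, every point stays on its side of the hyperplane of \<open>T\<close>.\<close>

lemma cutset_unaffected:
  assumes "off_walls v" "off_walls w"
    and T: "bij_betw c T I" "T \<subseteq> X"
    and "\<And>S. S \<in> separating v w \<Longrightarrow> \<not> T \<subseteq> insert x0 S"
  shows "T \<in> cutset v \<longleftrightarrow> T \<in> cutset w"
proof (cases "x0 \<in> T")
  case False
  have "T \<in> walls" using transversal_wall T False by blast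
  moreover have "T \<notin> separating v w" using assms(5)[of T] by blast
  ultimately have "sgn (\<nu> T \<bullet> v) = sgn (\<nu> T \<bullet> w)"
    using sgn_same_side assms wallD(9) by blast
  then show ?thesis unfolding cutset_iff_static[OF T False]
    by (intro balanced_cong_sgn) auto
next
  case True
  obtain J where J: "\<And>v y. J v \<bullet> y = - (J y \<bullet> v)" "\<And>v x. x \<in> T - {x0} \<Longrightarrow> J v \<bullet> u x = 0"
    "\<And>v. off_walls v \<Longrightarrow> T \<in> cutset v \<longleftrightarrow> balanced c I X (cfg v) (J v)"
    using moving_normal[OF T True] by metis
  have "sgn (J v \<bullet> cfg v z) = sgn (J w \<bullet> cfg w z)" if z: "z \<in> X" for z
  proof -
    consider "z = x0" | "z \<in> T - {x0}" | "z \<in> X - T" using z by blast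
    then show ?thesis
    proof cases
      case 1
      have "J v \<bullet> v = 0" "J w \<bullet> w = 0" using J(1)[of v v] J(1)[of w w] by auto
      then show ?thesis using 1 by simp
    next
      case 2
      then show ?thesis using J(2) by auto
    next
      case 3
      let ?S = "insert z (T - {x0})"
      have S: "?S \<in> walls" by (rule transversal_insert_wall[OF T True 3])
      have "?S \<notin> separating v w" using assms(5)[of ?S] by blast
      moreover have "J (u z) \<bullet> u x = 0" if "x \<in> ?S" for x
        using that J(1)[of "u z" "u z"] J(2)[of x "u z"] by auto
      ultimately have "sgn (J (u z) \<bullet> v) = sgn (J (u z) \<bullet> w)"
        using sgn_same_side[OF S] assms by blast
      moreover have "z \<noteq> x0" using 3 True by auto
      ultimately show ?thesis using J(1)[of v "u z"] J(1)[of w "u z"] by (simp add: sgn_minus)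
    qed
  qed
  then have "balanced c I X (cfg v) (J v) \<longleftrightarrow> balanced c I X (cfg w) (J w)"
    by (rule balanced_cong_sgn)
  then show ?thesis using J(3) assms by blast
qed

lemma cutset_eq_if_not_separated:
  assumes "off_walls v" "off_walls w" "separating v w = {}"
  shows "cutset v = cutset w"
proof -
  have "T \<in> cutset v \<longleftrightarrow> T \<in> cutset w" if "bij_betw c T I" "T \<subseteq> X" for T
    using cutset_unaffected[OF assms(1,2) that] assms(3) by blast
  then show ?thesis unfolding cuts_def by blast
qed

text \<open>When \<open>S\<close> is the only wall crossed, the hyperplane of the transversal can be
  oriented before and after the crossing so that it sees all points outside
  \<open>insert x0 S\<close> as \<open>\<nu> S\<close> does. The only change is that the omitted
  point \<open>x\<close> switches sides.\<close>

lemma crossing_normals: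
  assumes vw: "off_walls v" "off_walls w" and sep: "separating v w = {S}"
    and x: "x \<in> insert x0 S" and T: "bij_betw c (insert x0 S - {x}) I"
    and far: "\<not> X \<subseteq> insert x0 S"
  obtains \<phi> \<psi> where
    "insert x0 S - {x} \<in> cutset v \<longleftrightarrow> balanced c I X (cfg v) \<phi>"
    "insert x0 S - {x} \<in> cutset w \<longleftrightarrow> balanced c I X (cfg w) \<psi>"
    "\<And>z. z \<in> insert x0 S - {x} \<Longrightarrow> \<phi> \<bullet> cfg v z = 0"
    "\<And>z. z \<in> insert x0 S - {x} \<Longrightarrow> \<psi> \<bullet> cfg w z = 0"
    "\<And>z. z \<in> X - insert x0 S \<Longrightarrow> sgn (\<phi> \<bullet> cfg v z) = sgn (\<nu> S \<bullet> u z)"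
    "\<And>z. z \<in> X - insert x0 S \<Longrightarrow> sgn (\<psi> \<bullet> cfg w z) = sgn (\<nu> S \<bullet> u z)"
    "\<phi> \<bullet> cfg v x \<noteq> 0" "sgn (\<psi> \<bullet> cfg w x) = - sgn (\<phi> \<bullet> cfg v x)"
proof -
  have S: "S \<in> walls" "S \<in> separating v w" using sep by (auto simp: separating_def)
  note SD = wallD[OF S(1)]
  have nv: "\<nu> S \<bullet> v \<noteq> 0" "\<nu> S \<bullet> w \<noteq> 0" using vw S by (auto simp: off_walls_def)
  let ?T = "insert x0 S - {x}"
  have TX: "?T \<subseteq> X" using SD x0 by auto
  show ?thesis
  proof (cases "x = x0")
    case True
    then have TS: "?T = S" using SD by auto
    have "sgn (\<nu> S \<bullet> w) = - sgn (\<nu> S \<bullet> v)"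
      using sgn_opposite_sides[OF S(2), of "\<nu> S"] SD(9) by simp
    then show ?thesis
      using cutset_iff_static[of S] T TS SD nv True by (intro that[of "\<nu> S" "\<nu> S"]) auto
  next
    case False
    then have xS: "x \<in> S" "x0 \<in> ?T" using x by auto
    obtain J where J: "\<And>v y. J v \<bullet> y = - (J y \<bullet> v)" "\<And>v z. z \<in> ?T - {x0} \<Longrightarrow> J v \<bullet> u z = 0"
      "\<And>z. z \<in> X - ?T \<Longrightarrow> J (u z) \<noteq> 0"
      "\<And>v. off_walls v \<Longrightarrow> ?T \<in> cutset v \<longleftrightarrow> balanced c I X (cfg v) (J v)"
      using moving_normal[OF T TX xS(2)] by metis
    have JJ: "J y \<bullet> y = 0" for y using J(1)[of y y] by simp
    have Jx: "J (u x) \<bullet> u z = 0" if "z \<in> S" for z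
      using that J(2)[of z "u x"] JJ[of "u x"] SD(3) by (cases "z = x") auto
    obtain t where t: "0 < t" "t < 1" "(1 - t) * (\<nu> S \<bullet> v) + t * (\<nu> S \<bullet> w) = 0"
      using sgn_opposite_zero S(2) by (metis (mono_tags, lifting) mem_Collect_eq separating_def)
    \<comment> \<open>\<open>m\<close> is the point where the segment from \<open>v\<close> to
      \<open>w\<close> meets the wall. There all of \<open>insert x0 S\<close> lies in one
      hyperplane, so \<open>J m\<close> is a multiple of \<open>\<nu> S\<close>; this supplies the
      common reference for \<open>J v\<close> and \<open>J w\<close>.\<close>
    define m where "m = (1 - t) *\<^sub>R v + t *\<^sub>R w"
    have "\<nu> S \<bullet> m = 0" using t by (simp add: m_def inner_add_right)
    moreover obtain k' where k': "J (u x) = k' *\<^sub>R \<nu> S" using wall_normal_unique[OF S(1) Jx] by blast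
    ultimately have "J m \<bullet> u x = 0" using J(1)[of m "u x"] by simp
    then have "J m \<bullet> u z = 0" if "z \<in> S" for z
      using that J(2)[of z m] SD(3) by (cases "z = x") auto
    then obtain k where k: "J m = k *\<^sub>R \<nu> S" using wall_normal_unique[OF S(1)] by blast
    \<comment> \<open>The wall through \<open>z\<close> and \<open>?T - {x0}\<close> is not crossed,
      so \<open>J v\<close> and \<open>J w\<close> give \<open>z\<close> the same sign. The value of
      \<open>J m\<close> at \<open>u z\<close> is a convex combination of theirs and inherits
      it.\<close>
    have side: "sgn (J v \<bullet> u z) = sgn k * sgn (\<nu> S \<bullet> u z)" "sgn (J w \<bullet> u z) = sgn k * sgn (\<nu> S \<bullet> u z)"
      "J v \<bullet> u z \<noteq> 0"
      if z: "z \<in> X - insert x0 S" for z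
    proof -
      let ?S = "insert z (?T - {x0})"
      have zT: "z \<in> X - ?T" using z by auto
      have W: "?S \<in> walls" by (rule transversal_insert_wall[OF T TX xS(2) zT])
      have "z \<notin> S" using z by auto
      then have "?S \<notin> separating v w" using sep by (metis insertI1 singletonD)
      moreover have Jz: "J (u z) \<bullet> u y = 0" if "y \<in> ?S" for y
        using that JJ[of "u z"] J(2)[of y "u z"] by auto
      ultimately have "sgn (J (u z) \<bullet> v) = sgn (J (u z) \<bullet> w)"
        using sgn_same_side[OF W] vw by blast
      then have eq: "sgn (J v \<bullet> u z) = sgn (J w \<bullet> u z)"
        using J(1)[of v "u z"] J(1)[of w "u z"] by (simp add: sgn_minus)
      have "J m \<bullet> u z = (1 - t) * (J v \<bullet> u z) + t * (J w \<bullet> u z)"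
        using J(1)[of m "u z"] J(1)[of v "u z"] J(1)[of w "u z"]
        by (simp add: m_def inner_add_right algebra_simps)
      then have "sgn (J m \<bullet> u z) = sgn (J v \<bullet> u z)"
        using sgn_convex_combination[OF eq, of t] t by simp
      then show "sgn (J v \<bullet> u z) = sgn k * sgn (\<nu> S \<bullet> u z)"
        "sgn (J w \<bullet> u z) = sgn k * sgn (\<nu> S \<bullet> u z)"
        using k eq by (simp_all add: sgn_mult)
      obtain l where l: "J (u z) = l *\<^sub>R \<nu> ?S" using wall_normal_unique[OF W Jz] by blast
      have "\<nu> ?S \<bullet> v \<noteq> 0" using vw W by (auto simp: off_walls_def)
      then show "J v \<bullet> u z \<noteq> 0" using l J(3)[OF zT] J(1)[of v "u z"] by auto
    qed
    obtain z where z: "z \<in> X - insert x0 S" using far by blast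
    have "k \<noteq> 0" using side[OF z] by (auto simp: sgn_eq_0_iff)
    then have k2: "sgn k * (sgn k * b) = b" "sgn (sgn k) = sgn k" "sgn k \<noteq> 0" for b :: real
      by (auto simp: sgn_if)
    have x': "x \<in> X - ?T" using xS SD by auto
    have Jxv: "J (u x) \<bullet> v \<noteq> 0" using k' J(3)[OF x'] nv by auto
    have Jxo: "sgn (J (u x) \<bullet> v) = - sgn (J (u x) \<bullet> w)" using sgn_opposite_sides[OF S(2) Jx] .
    show ?thesis
    \<comment> \<open>The factor \<open>sgn k\<close> orients both normals consistently with
      \<open>\<nu> S\<close>.\<close>
    proof (rule that[of "sgn k *\<^sub>R J v" "sgn k *\<^sub>R J w"])
      show "?T \<in> cutset v \<longleftrightarrow> balanced c I X (cfg v) (sgn k *\<^sub>R J v)"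
        "?T \<in> cutset w \<longleftrightarrow> balanced c I X (cfg w) (sgn k *\<^sub>R J w)"
        unfolding balanced_scaleR[OF k2(3)] using J(4) vw by auto
      show "(sgn k *\<^sub>R J v) \<bullet> cfg v z = 0" "(sgn k *\<^sub>R J w) \<bullet> cfg w z = 0" if "z \<in> ?T" for z
        using that J(2) JJ by auto
      show "sgn ((sgn k *\<^sub>R J v) \<bullet> cfg v z) = sgn (\<nu> S \<bullet> u z)"
        "sgn ((sgn k *\<^sub>R J w) \<bullet> cfg w z) = sgn (\<nu> S \<bullet> u z)" if "z \<in> X - insert x0 S" for z
        using that side[OF that] k2 by (auto simp: sgn_mult)
      show "(sgn k *\<^sub>R J v) \<bullet> cfg v x \<noteq> 0"
        using False Jxv k2(3) J(1)[of v "u x"] by simp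
      show "sgn ((sgn k *\<^sub>R J w) \<bullet> cfg w x) = - sgn ((sgn k *\<^sub>R J v) \<bullet> cfg v x)"
        using False Jxo J(1)[of v "u x"] J(1)[of w "u x"] by (simp add: sgn_mult sgn_minus)
    qed
  qed
qed

text \<open>The points of the transversal lie on its hyperplane and contribute nothing, those
  outside \<open>insert x0 S\<close> contribute \<open>\<Sigma>\<close> on both sides of the wall,
  and the omitted point \<open>x\<close> contributes \<open>s\<close> before and \<open>- s\<close>
  after the crossing.\<close>

lemma crossing_cut_condition:
  fixes S :: "'x set"
  defines "\<Sigma> \<equiv> \<lambda>j. \<Sum>z\<in>{z \<in> X - insert x0 S. c z = j}. sgn (\<nu> S \<bullet> u z)"
  assumes vw: "off_walls v" "off_walls w" and sep: "separating v w = {S}"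
    and x: "x \<in> insert x0 S" and T: "bij_betw c (insert x0 S - {x}) I"
    and far: "\<not> X \<subseteq> insert x0 S"
  obtains s where "\<bar>s\<bar> = (1::real)"
    "insert x0 S - {x} \<in> cutset v \<longleftrightarrow> (\<forall>j\<in>I - {c x}. \<Sigma> j = 0) \<and> \<Sigma> (c x) + s = 0"
    "insert x0 S - {x} \<in> cutset w \<longleftrightarrow> (\<forall>j\<in>I - {c x}. \<Sigma> j = 0) \<and> \<Sigma> (c x) - s = 0"
proof -
  have S: "S \<in> walls" using sep by (auto simp: separating_def)
  note SD = wallD[OF S]
  have xX: "x \<in> X" using x SD(2) x0 by auto
  then have cxI: "c x \<in> I" using cI by blast
  have sums: "(\<Sum>z\<in>{z \<in> X. c z = j}. sgn (\<phi> \<bullet> cfg y z)) = \<Sigma> j + (if j = c x then sgn (\<phi> \<bullet> cfg y x) else 0)"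
    if 0: "\<And>z. z \<in> insert x0 S - {x} \<Longrightarrow> \<phi> \<bullet> cfg y z = 0"
      and far: "\<And>z. z \<in> X - insert x0 S \<Longrightarrow> sgn (\<phi> \<bullet> cfg y z) = sgn (\<nu> S \<bullet> u z)" for \<phi> y j
  proof -
    let ?f = "\<lambda>z. sgn (\<phi> \<bullet> cfg y z)"
    have split: "{z \<in> X. c z = j} = {z \<in> X - insert x0 S. c z = j} \<union> {z \<in> insert x0 S. c z = j}"
      using SD(2) x0 by auto
    have "sum ?f {z \<in> X. c z = j} = sum ?f {z \<in> X - insert x0 S. c z = j} + sum ?f {z \<in> insert x0 S. c z = j}"
      unfolding split by (rule sum.union_disjoint) (use finX SD(4) in auto)
    also have "sum ?f {z \<in> X - insert x0 S. c z = j} = \<Sigma> j"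
      unfolding \<Sigma>_def using far by (intro sum.cong) auto
    also have "sum ?f {z \<in> insert x0 S. c z = j}
        = (\<Sum>z\<in>{z \<in> insert x0 S. c z = j}. if z = x then ?f x else 0)"
      using 0 by (intro sum.cong) auto
    also have "\<dots> = (if j = c x then ?f x else 0)"
      using SD(4) x by (subst sum.delta) auto
    finally show ?thesis .
  qed
  have bal: "balanced c I X (cfg y) \<phi> \<longleftrightarrow>
      (\<forall>j\<in>I - {c x}. \<Sigma> j = 0) \<and> \<Sigma> (c x) + sgn (\<phi> \<bullet> cfg y x) = 0"
    if "\<And>z. z \<in> insert x0 S - {x} \<Longrightarrow> \<phi> \<bullet> cfg y z = 0"
      and "\<And>z. z \<in> X - insert x0 S \<Longrightarrow> sgn (\<phi> \<bullet> cfg y z) = sgn (\<nu> S \<bullet> u z)" for \<phi> y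
  proof -
    have "balanced c I X (cfg y) \<phi> \<longleftrightarrow>
        (\<forall>j\<in>I. \<Sigma> j + (if j = c x then sgn (\<phi> \<bullet> cfg y x) else 0) = 0)"
      unfolding balanced_def by (intro ball_cong refl arg_cong2[where f="(=)"] sums that)
    also have "\<dots> \<longleftrightarrow> (\<forall>j\<in>I - {c x}. \<Sigma> j = 0) \<and> \<Sigma> (c x) + sgn (\<phi> \<bullet> cfg y x) = 0"
      using cxI by (auto simp del: fun_upd_apply)
    finally show ?thesis .
  qed
  from crossing_normals[OF assms(2-)] obtain \<phi> \<psi> where n:
    "insert x0 S - {x} \<in> cutset v \<longleftrightarrow> balanced c I X (cfg v) \<phi>"
    "insert x0 S - {x} \<in> cutset w \<longleftrightarrow> balanced c I X (cfg w) \<psi>"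
    "\<And>z. z \<in> insert x0 S - {x} \<Longrightarrow> \<phi> \<bullet> cfg v z = 0"
    "\<And>z. z \<in> insert x0 S - {x} \<Longrightarrow> \<psi> \<bullet> cfg w z = 0"
    "\<And>z. z \<in> X - insert x0 S \<Longrightarrow> sgn (\<phi> \<bullet> cfg v z) = sgn (\<nu> S \<bullet> u z)"
    "\<And>z. z \<in> X - insert x0 S \<Longrightarrow> sgn (\<psi> \<bullet> cfg w z) = sgn (\<nu> S \<bullet> u z)"
    "\<phi> \<bullet> cfg v x \<noteq> 0" "sgn (\<psi> \<bullet> cfg w x) = - sgn (\<phi> \<bullet> cfg v x)" by blast
  show ?thesis
  proof (rule that[of "sgn (\<phi> \<bullet> cfg v x)"])
    show "\<bar>sgn (\<phi> \<bullet> cfg v x)\<bar> = 1" using n(7) by (simp add: abs_sgn_eq)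
    show "insert x0 S - {x} \<in> cutset v \<longleftrightarrow>
       (\<forall>j\<in>I - {c x}. \<Sigma> j = 0) \<and> \<Sigma> (c x) + sgn (\<phi> \<bullet> cfg v x) = 0"
      unfolding n(1) by (rule bal[OF n(3,5)])
    show "insert x0 S - {x} \<in> cutset w \<longleftrightarrow>
       (\<forall>j\<in>I - {c x}. \<Sigma> j = 0) \<and> \<Sigma> (c x) - sgn (\<phi> \<bullet> cfg v x) = 0"
      unfolding n(2) using bal[OF n(4,6)] n(8) by simp
  qed
qed

text \<open>Only transversals inside \<open>insert x0 S\<close> can change. This set has one point
  more than there are colors, so if it contains a transversal at all, exactly one color occurs twice
  and there are exactly two transversals. They change their status together.\<close>

lemma parity_single_crossing:
  assumes vw: "off_walls v" "off_walls w" and sep: "separating v w = {S}"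
  shows "even (card (cutset v)) \<longleftrightarrow> even (card (cutset w))"
proof -
  let ?E = "insert x0 S"
  have S: "S \<in> walls" using sep by (auto simp: separating_def)
  note SD = wallD[OF S]
  have EX: "?E \<subseteq> X" "finite ?E" "card ?E = DIM('a)" using SD x0 by auto
  have unaff: "T \<in> cutset v \<longleftrightarrow> T \<in> cutset w" if "bij_betw c T I" "T \<subseteq> X" "\<not> T \<subseteq> ?E" for T
    using cutset_unaffected[OF vw that(1,2)] sep that(3) by blast
  show ?thesis
  proof (cases "\<exists>T\<subseteq>?E. bij_betw c T I")
    case False
    then have "cutset v = cutset w" using unaff unfolding cuts_def by blast
    then show ?thesis by simp
  next
    case True
    then obtain T where T: "T \<subseteq> ?E" "bij_betw c T I" by blast
    have cT: "card T + 1 = card ?E" using transversal_card[OF T(2)] EX by simp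
    then obtain x where x: "x \<in> ?E" "x \<notin> T" using T(1) by (metis add_right_imp_eq less_add_one psubset_eq less_irrefl subsetI subset_antisym)
    have "insert x T \<subseteq> ?E" "card (insert x T) = card ?E"
      using x T(1) cT finite_subset[OF T(1) EX(2)] by auto
    then have ins: "insert x T = ?E" using card_subset_eq EX(2) by blast
    then have Tx: "T = ?E - {x}" using x by auto
    have cx: "c x \<in> I" using x EX cI by blast
    then obtain y where y: "y \<in> T" "c y = c x" using T(2) by (metis bij_betw_imp_surj_on imageE)
    have yE: "y \<in> ?E" "y \<noteq> x" using y x T by auto
    have inj: "inj_on c T" using T(2) by (simp add: bij_betw_def)
    have Ty: "bij_betw c (?E - {y}) I"
    proof -
      have "?E - {y} = insert x (T - {y})" using ins x y by auto
      moreover have "c ` insert x (T - {y}) = c ` T"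
        using insert_Diff[OF y(1)] y(2) by (metis image_insert)
      moreover have "inj_on c (insert x (T - {y}))"
        using inj y unfolding inj_on_insert by (auto simp: inj_on_def)
      ultimately show ?thesis using T(2) by (simp add: bij_betw_def)
    qed
    \<comment> \<open>A transversal inside \<open>?E\<close> omits a single point, which must be one
      of the two points of the doubled color.\<close>
    have only: "T' = ?E - {x} \<or> T' = ?E - {y}" if T': "T' \<subseteq> ?E" "bij_betw c T' I" for T'
    proof -
      have "card T' + 1 = card ?E" using transversal_card[OF T'(2)] EX by simp
      then obtain z where z: "z \<in> ?E" "z \<notin> T'" using T'(1) by (metis add_right_imp_eq less_add_one psubset_eq less_irrefl subsetI subset_antisym)
      have "insert z T' \<subseteq> ?E" "card (insert z T') = card ?E"
        using z T'(1) \<open>card T' + 1 = card ?E\<close> finite_subset[OF T'(1) EX(2)] by auto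
      then have "insert z T' = ?E" using card_subset_eq EX(2) by blast
      then have Tz: "T' = ?E - {z}" using z by auto
      have "\<not> (x \<in> T' \<and> y \<in> T')"
        using inj_onD[OF bij_betw_imp_inj_on[OF T'(2)], of x y] y(2) yE(2) by auto
      then have "z = x \<or> z = y" using Tz x(1) yE by blast
      then show ?thesis using Tz by blast
    qed
    \<comment> \<open>Otherwise the doubled color would consist of \<open>x\<close> and
      \<open>y\<close> only, but its class is odd.\<close>
    have far: "\<not> X \<subseteq> ?E"
    proof
      assume "X \<subseteq> ?E"
      then have X: "X = insert x T" using EX(1) ins by simp
      have "z = y" if "z \<in> T" "c z = c x" for z
        using inj_onD[OF inj _ that(1) y(1)] that(2) y(2) by simp
      then have "{z \<in> X. c z = c x} = {x, y}" unfolding X using y by blast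
      then show False using odd_class[OF cx] yE(2) by simp
    qed
    define \<Sigma> where "\<Sigma> j = (\<Sum>z\<in>{z \<in> X - insert x0 S. c z = j}. sgn (\<nu> S \<bullet> u z))" for j
    have Txb: "bij_betw c (?E - {x}) I" using T(2) Tx by simp
    from crossing_cut_condition[OF vw sep x(1) Txb far, folded \<Sigma>_def]
    obtain s where s: "\<bar>s\<bar> = (1::real)"
      "?E - {x} \<in> cutset v \<longleftrightarrow> (\<forall>j\<in>I - {c x}. \<Sigma> j = 0) \<and> \<Sigma> (c x) + s = 0"
      "?E - {x} \<in> cutset w \<longleftrightarrow> (\<forall>j\<in>I - {c x}. \<Sigma> j = 0) \<and> \<Sigma> (c x) - s = 0"
      by blast
    from crossing_cut_condition[OF vw sep yE(1) Ty far, folded \<Sigma>_def, unfolded y(2)]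
    obtain r where r: "\<bar>r\<bar> = (1::real)"
      "?E - {y} \<in> cutset v \<longleftrightarrow> (\<forall>j\<in>I - {c x}. \<Sigma> j = 0) \<and> \<Sigma> (c x) + r = 0"
      "?E - {y} \<in> cutset w \<longleftrightarrow> (\<forall>j\<in>I - {c x}. \<Sigma> j = 0) \<and> \<Sigma> (c x) - r = 0"
      by blast
    let ?A = "?E - {x}" and ?B = "?E - {y}"
    have AB: "?A \<noteq> ?B" using x(1) yE by blast
    \<comment> \<open>Since \<open>s\<close> and \<open>r\<close> have absolute value 1, there are
      two cases: if \<open>\<Sigma>\<close> is zero off the doubled color and of absolute value 1 on
      it, each transversal is a cut on exactly one side of the wall; otherwise neither is a cut on
      any side.\<close>
    have "?A \<in> cutset v \<longleftrightarrow> \<not> ?A \<in> cutset w" "?B \<in> cutset v \<longleftrightarrow> \<not> ?B \<in> cutset w"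
      if "(\<forall>j\<in>I - {c x}. \<Sigma> j = 0)" "\<bar>\<Sigma> (c x)\<bar> = 1"
      using s r that by auto
    moreover have "?A \<notin> cutset v" "?A \<notin> cutset w" "?B \<notin> cutset v" "?B \<notin> cutset w"
      if "\<not> ((\<forall>j\<in>I - {c x}. \<Sigma> j = 0) \<and> \<bar>\<Sigma> (c x)\<bar> = 1)"
      using s r that by auto
    ultimately have ev: "even (card (cutset v \<inter> {?A, ?B})) \<longleftrightarrow> even (card (cutset w \<inter> {?A, ?B}))"
      using AB
      by (cases "?A \<in> cutset v"; cases "?B \<in> cutset v"; cases "?A \<in> cutset w"; cases "?B \<in> cutset w")
        (auto simp: Int_insert_right)
    have "T' \<in> cutset v \<longleftrightarrow> T' \<in> cutset w" if "T' \<notin> {?A, ?B}" for T'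
    proof (cases "T' \<subseteq> X \<and> bij_betw c T' I")
      case True
      then have "\<not> T' \<subseteq> ?E" using only[of T'] that by blast
      then show ?thesis using unaff True by simp
    qed (auto simp: cuts_def)
    then have "cutset v - {?A, ?B} = cutset w - {?A, ?B}" by blast
    moreover have "card (cutset y) = card (cutset y - {?A, ?B}) + card (cutset y \<inter> {?A, ?B})" for y
      using finite_cuts[OF finX] by (subst card_Un_disjoint[symmetric]) (auto intro: arg_cong[where f=card])
    ultimately show ?thesis using ev by simp
  qed
qed

text \<open>The segment from \<open>v\<close> to \<open>w\<close> may meet several walls at once. If
  two walls separate the points, \<open>w\<close> is shifted slightly inside its chamber so that
  they are met at different parameters; a point between these two crossings splits the separating
  walls into two smaller sets.\<close>

lemma parity_off_walls:
  assumes "off_walls v" "off_walls w"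
  shows "even (card (cutset v)) \<longleftrightarrow> even (card (cutset w))"
  using assms
proof (induction "card (separating v w)" arbitrary: v w rule: less_induct)
  case less
  show ?case
  proof (cases "\<exists>S1\<in>separating v w. \<exists>S2\<in>separating v w. S1 \<noteq> S2")
    case False
    then have "separating v w = {} \<or> (\<exists>S. separating v w = {S})" by blast
    then show ?thesis
      using cutset_eq_if_not_separated parity_single_crossing less.prems by metis
  next
    case True
    then obtain S1 S2 where S: "S1 \<in> separating v w" "S2 \<in> separating v w" "S1 \<noteq> S2" by blast
    then have W: "S1 \<in> walls" "S2 \<in> walls" by (auto simp: separating_def)
    let ?n1 = "\<nu> S1" and ?n2 = "\<nu> S2"
    \<comment> \<open>\<open>?cr w = 0\<close> means that the segment from \<open>v\<close> to
      \<open>w\<close> meets \<open>S1\<close> and \<open>S2\<close> at the same parameter.\<close>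
    let ?cr = "\<lambda>w. (?n1 \<bullet> v) * (?n2 \<bullet> w) - (?n2 \<bullet> v) * (?n1 \<bullet> w)"
    have "\<exists>w'. off_walls w' \<and> separating w w' = {} \<and> separating v w' = separating v w \<and> ?cr w' \<noteq> 0"
    proof (cases "?cr w = 0")
      case False
      have "\<not> a * a < 0" for a :: real by (simp add: not_less)
      then show ?thesis using less.prems False by (intro exI[of _ w]) (auto simp: separating_def)
    next
      case True
      \<comment> \<open>\<open>?cr\<close> is the inner product with \<open>a\<close>, so a step
        along \<open>a\<close> makes it nonzero. That \<open>a\<close> itself is nonzero is seen at
        a vector \<open>u z\<close> that lies on the wall \<open>S2\<close> but not on
        \<open>S1\<close>.\<close>
      define a where "a = (?n1 \<bullet> v) *\<^sub>R ?n2 - (?n2 \<bullet> v) *\<^sub>R ?n1"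
      have "card S2 = card S1" using wallD(5)[OF W(1)] wallD(5)[OF W(2)] by simp
      then obtain z where z: "z \<in> S2" "z \<notin> S1" using S(3) wallD(4)[OF W(1)] wallD(4)[OF W(2)]
        by (metis card_subset_eq subsetI)
      have "?n1 \<bullet> u z \<noteq> 0" using wall_normal_nonzero[OF W(1)] z wallD(1)[OF W(2)] by blast
      moreover have "?n2 \<bullet> u z = 0" using wallD(9)[OF W(2) z(1)] .
      moreover have "?n2 \<bullet> v \<noteq> 0" using less.prems W by (auto simp: off_walls_def)
      ultimately have "a \<bullet> u z \<noteq> 0" by (simp add: a_def inner_diff_left)
      then have "a \<bullet> a \<noteq> 0" by auto
      then have cra: "?cr a \<noteq> 0" by (simp add: a_def inner_diff_left algebra_simps)
      have "\<forall>\<^sub>F e in at_right (0::real). \<forall>S\<in>walls. (\<nu> S \<bullet> w) * (\<nu> S \<bullet> (w + e *\<^sub>R a)) > 0"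
      proof (rule eventually_ball_finite[OF finite_walls], rule ballI)
        fix S assume "S \<in> walls"
        then have "\<nu> S \<bullet> w \<noteq> 0" using less.prems by (auto simp: off_walls_def)
        then have "(\<nu> S \<bullet> w) * (\<nu> S \<bullet> (w + 0 *\<^sub>R a)) > 0"
          by (simp) (metis not_real_square_gt_zero)
        moreover have "((\<lambda>e. (\<nu> S \<bullet> w) * (\<nu> S \<bullet> (w + e *\<^sub>R a))) \<longlongrightarrow> (\<nu> S \<bullet> w) * (\<nu> S \<bullet> (w + 0 *\<^sub>R a))) (at_right 0)"
          by (intro tendsto_intros)
        ultimately show "\<forall>\<^sub>F e in at_right (0::real). (\<nu> S \<bullet> w) * (\<nu> S \<bullet> (w + e *\<^sub>R a)) > 0"
          by (rule order_tendstoD(1)[rotated])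
      qed
      then have "\<forall>\<^sub>F e in at_right (0::real). e > 0 \<and> (\<forall>S\<in>walls. (\<nu> S \<bullet> w) * (\<nu> S \<bullet> (w + e *\<^sub>R a)) > 0)"
        using eventually_at_right_less by (rule eventually_conj[rotated])
      then obtain e where e: "e > 0" "\<forall>S\<in>walls. (\<nu> S \<bullet> w) * (\<nu> S \<bullet> (w + e *\<^sub>R a)) > 0"
        using eventually_happens[of _ "at_right (0::real)"] trivial_limit_at_right_real by blast
      let ?w = "w + e *\<^sub>R a"
      have "?cr ?w = ?cr w + e * ?cr a" by (simp add: inner_add_right algebra_simps)
      then have "?cr ?w \<noteq> 0" using True cra e(1) by simp
      moreover have "off_walls ?w" using e(2) by (force simp: off_walls_def)
      moreover have "separating w ?w = {}" using e(2) by (force simp: separating_def)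
      moreover have "separating v ?w = separating v w"
        using e(2) unfolding separating_def by (auto simp: mult_less_0_iff zero_less_mult_iff; fastforce)
      ultimately show ?thesis by blast
    qed
    then obtain w' where w': "off_walls w'" "separating w w' = {}" "separating v w' = separating v w"
      "?cr w' \<noteq> 0" by blast
    have same: "cutset w = cutset w'" using cutset_eq_if_not_separated less.prems w' by blast
    \<comment> \<open>The parameter at which the segment from \<open>v\<close> to \<open>w'\<close>
      meets the wall \<open>S\<close>.\<close>
    define \<tau> where "\<tau> S = (\<nu> S \<bullet> v) / (\<nu> S \<bullet> v - \<nu> S \<bullet> w')" for S
    let ?z = "\<lambda>t. (1 - t) *\<^sub>R v + t *\<^sub>R w'"
    have lin: "\<nu> S \<bullet> ?z t = (1 - t) * (\<nu> S \<bullet> v) + t * (\<nu> S \<bullet> w')" for S t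
      by (simp add: inner_add_right)
    have opp: "(\<nu> S \<bullet> v) * (\<nu> S \<bullet> w') < 0" if "S \<in> {S1, S2}" for S
      using that S w'(3) by (auto simp: separating_def)
    have diff: "\<nu> S \<bullet> v - \<nu> S \<bullet> w' \<noteq> 0" if "S \<in> {S1, S2}" for S
      using opp[OF that] by (metis eq_iff_diff_eq_0 mult_less_0_iff not_less_iff_gr_or_eq)
    have "\<tau> S1 \<noteq> \<tau> S2"
    proof
      assume "\<tau> S1 = \<tau> S2"
      then have "(?n1 \<bullet> v) * (?n2 \<bullet> v - ?n2 \<bullet> w') = (?n2 \<bullet> v) * (?n1 \<bullet> v - ?n1 \<bullet> w')"
        using diff[of S1] diff[of S2] by (simp add: \<tau>_def frac_eq_eq)
      then show False using w'(4) by (simp add: algebra_simps)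
    qed
    moreover have \<tau>01: "0 < \<tau> S" "\<tau> S < 1" if "S \<in> {S1, S2}" for S
      using opp[OF that] by (auto simp: \<tau>_def mult_less_0_iff divide_simps)
    moreover have side: "(\<nu> S \<bullet> v) * (\<nu> S \<bullet> ?z t) = (\<nu> S \<bullet> v) * (\<nu> S \<bullet> v - \<nu> S \<bullet> w') * (\<tau> S - t)"
      if "S \<in> {S1, S2}" for S t
      using diff[OF that] unfolding lin by (simp add: \<tau>_def field_simps)
    have pos: "(\<nu> S \<bullet> v) * (\<nu> S \<bullet> v - \<nu> S \<bullet> w') > 0" if "S \<in> {S1, S2}" for S
      using opp[OF that] by (auto simp: mult_less_0_iff zero_less_mult_iff)
    let ?bad = "(\<lambda>S. (\<nu> S \<bullet> v) / (\<nu> S \<bullet> v - \<nu> S \<bullet> w')) ` walls"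
    obtain Sa Sb where ab: "{Sa, Sb} = {S1, S2}" "\<tau> Sa < \<tau> Sb"
      using \<open>\<tau> S1 \<noteq> \<tau> S2\<close> by (metis insert_commute linorder_neqE_linordered_idom)
    \<comment> \<open>Finitely many parameters lie on walls, so one between the two crossings avoids
      them all.\<close>
    have "infinite ({\<tau> Sa<..<\<tau> Sb} - ?bad)"
      using ab(2) finite_walls by (intro Diff_infinite_finite) (auto simp: infinite_Ioo)
    then have "{\<tau> Sa<..<\<tau> Sb} - ?bad \<noteq> {}" using infinite_imp_nonempty by blast
    then obtain t where "t \<in> {\<tau> Sa<..<\<tau> Sb} - ?bad" by (meson ex_in_conv)
    then have t: "\<tau> Sa < t" "t < \<tau> Sb" "t \<notin> ?bad" unfolding Diff_iff greaterThanLessThan_iff by blast+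
    have Sa: "Sa \<in> {S1, S2}" "Sb \<in> {S1, S2}" using ab(1) by auto
    have t01: "0 < t" "t < 1" using t \<tau>01(1)[OF Sa(1)] \<tau>01(2)[OF Sa(2)] by linarith+
    let ?m = "?z t"
    have offm: "off_walls ?m"
      unfolding off_walls_def
    proof (rule ballI, rule notI)
      fix S assume S: "S \<in> walls" "\<nu> S \<bullet> ?m = 0"
      have nz: "\<nu> S \<bullet> v \<noteq> 0" "\<nu> S \<bullet> w' \<noteq> 0" using S less.prems w'(1) by (auto simp: off_walls_def)
      have eq: "t * (\<nu> S \<bullet> v - \<nu> S \<bullet> w') = \<nu> S \<bullet> v" using S(2) unfolding lin by (simp add: algebra_simps)
      then have "\<nu> S \<bullet> v - \<nu> S \<bullet> w' \<noteq> 0" using nz by (metis mult_zero_right)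
      then have "t = (\<nu> S \<bullet> v) / (\<nu> S \<bullet> v - \<nu> S \<bullet> w')" using eq by (simp add: eq_divide_eq)
      then show False using t(3) S(1) by blast
    qed
    \<comment> \<open>Each normal is affine along the segment and changes sign at most once, so no
      wall separates in both halves.\<close>
    have between: "separating v ?m \<subseteq> separating v w" "separating ?m w' \<subseteq> separating v w"
      "separating v ?m \<inter> separating ?m w' = {}"
    proof -
      have *: "S \<in> separating v w'" if "S \<in> separating v ?m \<or> S \<in> separating ?m w'" for S
      proof (rule ccontr)
        assume no: "S \<notin> separating v w'"
        have W: "S \<in> walls" using that by (auto simp: separating_def)
        then have "\<nu> S \<bullet> v \<noteq> 0" "\<nu> S \<bullet> w' \<noteq> 0" "\<not> (\<nu> S \<bullet> v) * (\<nu> S \<bullet> w') < 0"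
          using less.prems w'(1) no by (auto simp: off_walls_def separating_def)
        then have eq: "sgn (\<nu> S \<bullet> v) = sgn (\<nu> S \<bullet> w')" by (auto simp: mult_less_0_iff sgn_if)
        then have "sgn (\<nu> S \<bullet> ?m) = sgn (\<nu> S \<bullet> v)"
          unfolding lin using sgn_convex_combination[OF eq, of t] t01 by simp
        then have "sgn ((\<nu> S \<bullet> v) * (\<nu> S \<bullet> ?m)) \<ge> 0" "sgn ((\<nu> S \<bullet> ?m) * (\<nu> S \<bullet> w')) \<ge> 0"
          using eq by (simp_all add: sgn_mult)
        then show False using that by (auto simp: separating_def)
      qed
      then show "separating v ?m \<subseteq> separating v w" "separating ?m w' \<subseteq> separating v w" using w'(3) by auto
      show "separating v ?m \<inter> separating ?m w' = {}"
      proof (rule ccontr)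
        assume "separating v ?m \<inter> separating ?m w' \<noteq> {}"
        then obtain S where S: "S \<in> separating v ?m" "S \<in> separating ?m w'" by blast
        then have "(\<nu> S \<bullet> v) * (\<nu> S \<bullet> w') < 0" using *[of S] by (auto simp: separating_def)
        then show False using S by (auto simp: separating_def mult_less_0_iff)
      qed
    qed
    have "(\<nu> Sa \<bullet> v) * (\<nu> Sa \<bullet> ?m) < 0"
      unfolding side[OF Sa(1)] using pos[OF Sa(1)] t by (intro mult_pos_neg) auto
    then have inSa: "Sa \<in> separating v ?m" using Sa W by (auto simp: separating_def)
    have "(\<nu> Sb \<bullet> v) * (\<nu> Sb \<bullet> ?m) > 0"
      unfolding side[OF Sa(2)] by (rule mult_pos_pos) (use pos[OF Sa(2)] t in simp_all)
    then have ninSb: "Sb \<notin> separating v ?m" by (auto simp: separating_def)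
    have Sab: "Sa \<in> separating v w" "Sb \<in> separating v w" using Sa S by auto
    have "separating v ?m \<subset> separating v w" using between(1) ninSb Sab by blast
    then have "card (separating v ?m) < card (separating v w)" by (rule psubset_card_mono[OF finite_separating])
    then have e1: "even (card (cutset v)) \<longleftrightarrow> even (card (cutset ?m))" by (rule less.hyps) (use less.prems offm in auto)
    have "separating ?m w' \<subset> separating v w" using between(2,3) inSa Sab by blast
    then have "card (separating ?m w') < card (separating v w)" by (rule psubset_card_mono[OF finite_separating])
    then have "even (card (cutset ?m)) \<longleftrightarrow> even (card (cutset w'))" by (rule less.hyps) (use w' offm in auto)
    then show ?thesis using e1 same by simp
  qed
qed

end

section \<open>Parity of the number of cuts over all generic configurations\<close>

lemma cuts_cong:
  assumes "\<And>x. x \<in> X \<Longrightarrow> u x = w x"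
  shows "cuts c I X u = cuts c I X w"
proof -
  have "balanced c I X u \<phi> \<longleftrightarrow> balanced c I X w \<phi>" for \<phi>
    by (rule balanced_cong_sgn) (simp add: assms)
  moreover have "(\<forall>x\<in>T. \<phi> \<bullet> u x = 0) \<longleftrightarrow> (\<forall>x\<in>T. \<phi> \<bullet> w x = 0)" if "T \<subseteq> X" for T \<phi>
    using that assms by (metis subsetD)
  ultimately show ?thesis unfolding cuts_def by (intro Collect_cong) (simp cong: conj_cong)
qed

text \<open>The type token \<open>V\<close> pins down the ambient space, since the locale fixes
  colors and points but no configuration of vectors.\<close>

locale colored_points =
  fixes X :: "'x set" and I :: "'i set" and c :: "'x \<Rightarrow> 'i" and V :: "'a::euclidean_space itself"
  assumes finX: "finite X" and finI: "finite I" and cI: "c ` X \<subseteq> I" and cardI: "card I + 1 = DIM('a)"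
    and odd_class: "\<And>i. i \<in> I \<Longrightarrow> odd (card {x \<in> X. c x = i})"
    and large: "DIM('a) \<le> card X"
begin

lemma parity_generic_upd:
  fixes u :: "'x \<Rightarrow> 'a"
  assumes "x0 \<in> X" "generic X (u(x0 := v))" "generic X (u(x0 := w))"
  shows "even (card (cuts c I X (u(x0 := v)))) \<longleftrightarrow> even (card (cuts c I X (u(x0 := w))))"
proof -
  have "generic (X - {x0}) (u(x0 := v))" by (rule generic_subset[OF assms(2)]) auto
  then have gen: "generic (X - {x0}) u" by (rule generic_cong[THEN iffD1, rotated]) auto
  have "\<exists>n. S \<subseteq> X - {x0} \<and> card S + 1 = DIM('a) \<longrightarrow> n \<noteq> 0 \<and> (\<forall>x\<in>S. n \<bullet> u x = 0)" for S
  proof (cases "S \<subseteq> X - {x0} \<and> card S + 1 = DIM('a)")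
    case True
    then have "finite S" using finX finite_subset by blast
    then have "card (u ` S) < DIM('a)" using card_image_le[of S u] True by simp
    then obtain n where "n \<noteq> 0" "\<And>y. y \<in> u ` S \<Longrightarrow> n \<bullet> y = 0"
      using hyperplane_normal_exists[of "u ` S"] \<open>finite S\<close> by blast
    then show ?thesis by blast
  qed blast
  then obtain \<nu> where \<nu>: "\<And>S. S \<subseteq> X - {x0} \<and> card S + 1 = DIM('a) \<longrightarrow> \<nu> S \<noteq> 0 \<and> (\<forall>x\<in>S. \<nu> S \<bullet> u x = 0)"
    by metis
  interpret moving_vector X I c u x0 \<nu>
    by unfold_locales (use finX finI cI cardI odd_class large assms(1) gen \<nu> in auto)
  have "off_walls y" if y: "generic X (u(x0 := y))" for y
    unfolding off_walls_def
  proof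
    fix S assume S: "S \<in> walls"
    have "\<nu> S \<bullet> (u(x0 := y)) x0 \<noteq> 0"
    proof (rule generic_normal_nonzero[OF y])
      show "\<nu> S \<bullet> (u(x0 := y)) x = 0" if "x \<in> S" for x
        using that wallD(3,9)[OF S] by auto
    qed (use wallD[OF S] assms(1) in auto)
    then show "\<nu> S \<bullet> y \<noteq> 0" by simp
  qed
  then show ?thesis using parity_off_walls assms by blast
qed

text \<open>Replacing the vectors of \<open>u\<close> by those of \<open>w\<close> one after the
  other could leave general position. Instead both families are changed: at each index they receive
  a common new vector avoiding the small spans of both, until they agree on
  \<open>X\<close>.\<close>

lemma parity_generic:
  fixes u w :: "'x \<Rightarrow> 'a"
  assumes "generic X u" "generic X w"
  shows "even (card (cuts c I X u)) \<longleftrightarrow> even (card (cuts c I X w))"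
proof -
  let ?ev = "\<lambda>u :: 'x \<Rightarrow> 'a. even (card (cuts c I X u))"
  have "\<exists>a b. generic X a \<and> generic X b \<and> (\<forall>x\<in>Y. a x = b x) \<and> ?ev a = ?ev u \<and> ?ev b = ?ev w"
    if "finite Y" "Y \<subseteq> X" for Y
    using that
  proof (induction Y rule: finite_induct)
    case empty
    then show ?case using assms by blast
  next
    case (insert y Y)
    then obtain a b where ab: "generic X a" "generic X b" "\<forall>x\<in>Y. a x = b x" "?ev a = ?ev u" "?ev b = ?ev w"
      by blast
    have yX: "y \<in> X" using insert by auto
    have "finite (a ` X \<union> b ` X)" using finX by auto
    from avoid_small_spans[OF this zero_less_one] obtain z where z:
      "\<And>B. B \<subseteq> a ` X \<union> b ` X \<Longrightarrow> card B < DIM('a) \<Longrightarrow> z \<notin> span B" by metis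
    have a': "generic X (a(y := z))"
      by (rule generic_upd[OF generic_subset[OF ab(1)] finX yX]) (auto, rule z[THEN notE], auto)
    have b': "generic X (b(y := z))"
      by (rule generic_upd[OF generic_subset[OF ab(2)] finX yX]) (auto, rule z[THEN notE], auto)
    have ev: "?ev (a(y := z)) = ?ev u" "?ev (b(y := z)) = ?ev w"
      using parity_generic_upd[OF yX a', of "a y"] parity_generic_upd[OF yX b', of "b y"] ab by simp_all
    have "\<forall>x\<in>insert y Y. (a(y := z)) x = (b(y := z)) x" using ab(3) by simp
    from conjI[OF a' conjI[OF b' conjI[OF this conjI[OF ev]]]] show ?case by (intro exI)
  qed
  from this[OF finX subset_refl] obtain a b where
    "\<forall>x\<in>X. a x = b x" "?ev a = ?ev u" "?ev b = ?ev w" by blast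
  moreover from this have "cuts c I X a = cuts c I X b" by (intro cuts_cong) auto
  ultimately show ?thesis by simp
qed

end

section \<open>A configuration with exactly one cut\<close>

lemma sum_sgn_diff:
  assumes "\<tau> < m"
  shows "(\<Sum>k<m. sgn (real k - real \<tau>)) = real m - 1 - 2 * real \<tau>"
  using assms
proof (induction m)
  case (Suc m)
  show ?case
  proof (cases "\<tau> = m")
    case True
    have "(\<Sum>k<m. sgn (real k - real m)) = (\<Sum>k<m. -1)" by (intro sum.cong) auto
    then show ?thesis using True by simp
  next
    case False
    then show ?thesis using Suc by simp
  qed
qed simp

lemma sgn_perturb:
  fixes a d :: real
  assumes "\<bar>d\<bar> < \<bar>a\<bar>"
  shows "sgn (a + d) = sgn a"
  using assms by (auto simp: sgn_if abs_if split: if_splits)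

context colored_points begin

text \<open>The points of each color are placed on a line parallel to \<open>b\<^sub>0\<close> through a basis vector of that color,
  so that (up to a small perturbation) the only cut consists of the medians of these lines.\<close>

lemma ex_generic_single_cut: "\<exists>u :: 'x \<Rightarrow> 'a. generic X u \<and> odd (card (cuts c I X u))"
proof -
  obtain b0 :: 'a where b0: "b0 \<in> Basis" using nonempty_Basis by blast
  have "card (Basis - {b0}) = card I" using cardI b0 by simp
  then obtain e where e: "bij_betw e I (Basis - {b0})"
    using finite_same_card_bij[OF finI, of "Basis - {b0}"] by auto
  define Xi where "Xi i = {x \<in> X. c x = i}" for i
  have finXi: "finite (Xi i)" for i using finX by (simp add: Xi_def)
  have "\<forall>i. \<exists>h. bij_betw h (Xi i) {..<card (Xi i)}"
    using ex_bij_betw_finite_nat[OF finXi] by (simp add: atLeast0LessThan)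
  then obtain h where h: "\<And>i. bij_betw (h i) (Xi i) {..<card (Xi i)}" by metis
  define t where "t x = h (c x) x" for x
  have t: "bij_betw t (Xi i) {..<card (Xi i)}" for i
    using h[of i] by (rule bij_betw_cong[THEN iffD1, rotated]) (simp add: t_def Xi_def)
  have t_le: "t x \<le> card X" if "x \<in> X" for x
  proof -
    have "x \<in> Xi (c x)" using that by (simp add: Xi_def)
    then have "t x < card (Xi (c x))" using t[of "c x"] by (auto simp: bij_betw_def)
    also have "\<dots> \<le> card X" using finX by (intro card_mono) (auto simp: Xi_def)
    finally show ?thesis by simp
  qed
  define q where "q = real (card I)"
  define M where "M = real (card X)"
  have q0: "q \<ge> 0" by (simp add: q_def)
  have M1: "M \<ge> 1" using large DIM_positive[where 'a='a] unfolding M_def by linarith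
  \<comment> \<open>Small enough that a perturbation by less than \<open>\<delta>\<close> changes
    \<open>\<phi> \<bullet> u0 z\<close> by at most a fifth of
    \<open>\<bar>\<phi> \<bullet> b0\<bar>\<close>, whereas distinct points of one color differ by
    at least \<open>\<bar>\<phi> \<bullet> b0\<bar>\<close>.\<close>
  define \<delta> where "\<delta> = 1 / (6 * (1 + q * M))"
  have pos: "1 + q * M > 0" using q0 M1 by (simp add: add_pos_nonneg)
  then have \<delta>0: "\<delta> > 0" by (simp add: \<delta>_def)
  have q\<delta>: "q * \<delta> \<le> 1 / 6"
  proof -
    have "q \<le> 1 + q * M" using mult_left_mono[OF M1 q0] by simp
    then show ?thesis using pos by (simp add: \<delta>_def divide_simps)
  qed
  define u0 where "u0 x = e (c x) + real (t x) *\<^sub>R b0" for x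
  obtain w where w: "generic X w" "\<And>x. dist (w x) (u0 x) < \<delta>"
    using generic_perturbation[OF finX \<delta>0] by blast
  have key: "sgn (\<phi> \<bullet> w y) = sgn (\<phi> \<bullet> b0) * sgn (real (t y) - real (t x)) \<and> \<phi> \<bullet> b0 \<noteq> 0"
    if T: "T \<subseteq> X" "bij_betw c T I" and \<phi>: "\<phi> \<noteq> 0" "\<forall>x\<in>T. \<phi> \<bullet> w x = 0"
      and xy: "x \<in> T" "y \<in> X" "c y = c x" for T \<phi> x y
  proof -
    let ?N = "norm \<phi>" and ?f = "\<bar>\<phi> \<bullet> b0\<bar>"
    define err where "err z = \<phi> \<bullet> (w z - u0 z)" for z
    have err: "\<bar>err z\<bar> \<le> \<delta> * ?N" for z
    proof -
      have "\<bar>err z\<bar> \<le> ?N * norm (w z - u0 z)" unfolding err_def by (rule Cauchy_Schwarz_ineq2)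
      also have "\<dots> \<le> ?N * \<delta>" using w(2)[of z] by (intro mult_left_mono) (auto simp: dist_norm)
      finally show ?thesis by (simp add: mult.commute)
    qed
    have wz: "\<phi> \<bullet> w z = \<phi> \<bullet> e (c z) + real (t z) * (\<phi> \<bullet> b0) + err z" for z
      by (simp add: err_def u0_def inner_diff_right inner_add_right)
    \<comment> \<open>The transversal contains a point of color \<open>i\<close> on the hyperplane,
      and its equation bounds \<open>\<phi> \<bullet> e i\<close> by the component along
      \<open>b0\<close>.\<close>
    have ei: "\<bar>\<phi> \<bullet> e i\<bar> \<le> M * ?f + \<delta> * ?N" if "i \<in> I" for i
    proof -
      obtain z where z: "z \<in> T" "c z = i" using T(2) \<open>i \<in> I\<close> by (auto simp: bij_betw_def)
      have "\<phi> \<bullet> e i = - (real (t z) * (\<phi> \<bullet> b0)) - err z" using wz[of z] \<phi>(2) z by auto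
      then have "\<bar>\<phi> \<bullet> e i\<bar> \<le> real (t z) * ?f + \<delta> * ?N" 
        using err[of z] abs_mult[of "real (t z)" "\<phi> \<bullet> b0"] by linarith
      moreover have "real (t z) * ?f \<le> M * ?f"
        using t_le[of z] z T by (intro mult_right_mono) (auto simp: M_def)
      ultimately show ?thesis by linarith
    qed
    \<comment> \<open>All components of \<open>\<phi>\<close> are controlled by the one along
      \<open>b0\<close>, up to a multiple of \<open>?N\<close> that is at most \<open>?N / 6\<close>
      and can be absorbed on the left.\<close>
    have "?N \<le> (\<Sum>b\<in>Basis. \<bar>\<phi> \<bullet> b\<bar>)" by (rule norm_le_l1)
    also have "\<dots> = ?f + (\<Sum>b\<in>Basis - {b0}. \<bar>\<phi> \<bullet> b\<bar>)" using b0 by (simp add: sum.remove)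
    also have "(\<Sum>b\<in>Basis - {b0}. \<bar>\<phi> \<bullet> b\<bar>) = (\<Sum>i\<in>I. \<bar>\<phi> \<bullet> e i\<bar>)"
      by (rule sum.reindex_bij_betw[OF e, symmetric])
    also have "(\<Sum>i\<in>I. \<bar>\<phi> \<bullet> e i\<bar>) \<le> (\<Sum>i\<in>I. M * ?f + \<delta> * ?N)" by (intro sum_mono ei)
    also have "\<dots> = q * M * ?f + (q * \<delta>) * ?N" by (simp add: q_def algebra_simps)
    also have "(q * \<delta>) * ?N \<le> 1 / 6 * ?N" using q\<delta> by (intro mult_right_mono) auto
    finally have N: "5 / 6 * ?N \<le> (1 + q * M) * ?f" by (simp add: algebra_simps)
    have "?f \<noteq> 0"
    proof
      assume "?f = 0"
      then have "?N \<le> 0" using N by simp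
      then show False using \<phi>(1) by simp
    qed
    have "\<delta> * (5 / 6 * ?N) \<le> \<delta> * ((1 + q * M) * ?f)" using N \<delta>0 by (intro mult_left_mono) auto
    also have "\<dots> = ?f / 6" using pos by (simp add: \<delta>_def field_simps)
    finally have \<delta>N: "\<delta> * ?N \<le> ?f / 5" by simp
    have "\<phi> \<bullet> w y = (real (t y) - real (t x)) * (\<phi> \<bullet> b0) + (err y - err x)"
      using wz[of y] wz[of x] \<phi>(2) xy by (simp add: algebra_simps)
    moreover have "sgn ((real (t y) - real (t x)) * (\<phi> \<bullet> b0) + (err y - err x))
        = sgn ((real (t y) - real (t x)) * (\<phi> \<bullet> b0))" if "t y \<noteq> t x"
    proof (rule sgn_perturb)
      have "\<bar>err y - err x\<bar> \<le> 2 / 5 * ?f" using err[of x] err[of y] \<delta>N by linarith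
      also have "\<dots> < 1 * ?f" using \<open>?f \<noteq> 0\<close> by simp
      also have "\<dots> \<le> \<bar>real (t y) - real (t x)\<bar> * ?f"
        using that by (intro mult_right_mono) linarith+
      finally show "\<bar>err y - err x\<bar> < \<bar>(real (t y) - real (t x)) * (\<phi> \<bullet> b0)\<bar>" by (simp add: abs_mult)
    qed
    moreover have "\<phi> \<bullet> w y = 0" if "t y = t x"
    proof -
      have "y \<in> Xi (c x)" "x \<in> Xi (c x)" using xy T by (auto simp: Xi_def)
      then have "y = x" using that t[of "c x"] by (auto simp: bij_betw_def dest: inj_onD)
      then show ?thesis using \<phi>(2) xy by simp
    qed
    ultimately show ?thesis using \<open>?f \<noteq> 0\<close> by (cases "t y = t x") (simp_all add: sgn_mult mult.commute)
  qed
  \<comment> \<open>Within a color the sign depends only on the position \<open>t\<close> on the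
    line, so the sum vanishes exactly if \<open>x\<close> is the median. The median exists because
    the class is odd.\<close>
  have class_sum: "(\<Sum>y\<in>Xi (c x). sgn (\<phi> \<bullet> w y)) = sgn (\<phi> \<bullet> b0) * (real (card (Xi (c x))) - 1 - 2 * real (t x))
      \<and> \<phi> \<bullet> b0 \<noteq> 0"
    if T: "T \<subseteq> X" "bij_betw c T I" and \<phi>: "\<phi> \<noteq> 0" "\<forall>x\<in>T. \<phi> \<bullet> w x = 0" and x: "x \<in> T" for T \<phi> x
  proof -
    have xX: "x \<in> Xi (c x)" using x T by (auto simp: Xi_def)
    have "(\<Sum>y\<in>Xi (c x). sgn (\<phi> \<bullet> w y)) = (\<Sum>y\<in>Xi (c x). sgn (\<phi> \<bullet> b0) * sgn (real (t y) - real (t x)))"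
      by (intro sum.cong refl) (use key[OF T \<phi> x] in \<open>auto simp: Xi_def\<close>)
    also have "\<dots> = sgn (\<phi> \<bullet> b0) * (\<Sum>y\<in>Xi (c x). sgn (real (t y) - real (t x)))"
      by (simp add: sum_distrib_left)
    also have "(\<Sum>y\<in>Xi (c x). sgn (real (t y) - real (t x))) = (\<Sum>k<card (Xi (c x)). sgn (real k - real (t x)))"
      by (rule sum.reindex_bij_betw[OF t])
    also have "\<dots> = real (card (Xi (c x))) - 1 - 2 * real (t x)"
      using t[of "c x"] xX by (intro sum_sgn_diff) (auto simp: bij_betw_def)
    finally show ?thesis using key[OF T \<phi> x, of x] x T by auto
  qed
  have cut_iff: "T \<in> cuts c I X w \<longleftrightarrow> (\<forall>x\<in>T. 2 * t x + 1 = card (Xi (c x)))"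
    if T: "T \<subseteq> X" "bij_betw c T I" for T
  proof -
    have fT: "finite T" using T finX finite_subset by blast
    have cT: "card T + 1 = DIM('a)" using bij_betw_same_card[OF T(2)] cardI by simp
    have "card (w ` T) < DIM('a)" using card_image_le[OF fT, of w] cT by simp
    then obtain \<phi> where \<phi>: "\<phi> \<noteq> 0" "\<forall>x\<in>T. \<phi> \<bullet> w x = 0"
      using hyperplane_normal_exists[of "w ` T"] fT by (metis finite_imageI imageI)
    have "independent (w ` T)" "card (w ` T) = card T"
      using generic_independent[OF w(1) T(1) fT] cT by auto
    then have "T \<in> cuts c I X w \<longleftrightarrow> balanced c I X w \<phi>"
      using \<phi> cT T by (intro cuts_iff_balanced) auto
    also have "\<dots> \<longleftrightarrow> (\<forall>i\<in>c ` T. (\<Sum>x\<in>Xi i. sgn (\<phi> \<bullet> w x)) = 0)"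
      using T(2) by (simp add: balanced_def Xi_def bij_betw_def)
    also have "\<dots> \<longleftrightarrow> (\<forall>x\<in>T. 2 * t x + 1 = card (Xi (c x)))"
    proof -
      have "(\<Sum>y\<in>Xi (c x). sgn (\<phi> \<bullet> w y)) = 0 \<longleftrightarrow> 2 * t x + 1 = card (Xi (c x))" if "x \<in> T" for x
        using class_sum[OF T \<phi> that] by (auto simp: sgn_eq_0_iff)
      then show ?thesis by simp
    qed
    finally show ?thesis .
  qed
  let ?T = "{x \<in> X. 2 * t x + 1 = card (Xi (c x))}"
  have bT: "bij_betw c ?T I"
    unfolding bij_betw_def
  proof
    show "inj_on c ?T"
    proof (rule inj_onI)
      fix x y assume xy: "x \<in> ?T" "y \<in> ?T" "c x = c y"
      then have "t x = t y" "x \<in> Xi (c x)" "y \<in> Xi (c x)" by (auto simp: Xi_def)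
      then show "x = y" using t[of "c x"] by (auto simp: bij_betw_def dest: inj_onD)
    qed
    show "c ` ?T = I"
    proof
      show "c ` ?T \<subseteq> I" using cI by auto
      show "I \<subseteq> c ` ?T"
      proof
        fix i assume i: "i \<in> I"
        then have o: "odd (card (Xi i))" using odd_class by (simp add: Xi_def)
        then have "card (Xi i) div 2 \<in> t ` Xi i" using t[of i] by (auto simp: bij_betw_def elim!: oddE)
        then obtain x where x: "x \<in> Xi i" "t x = card (Xi i) div 2" by auto
        then have "x \<in> ?T" "c x = i" using o by (auto simp: Xi_def)
        then show "i \<in> c ` ?T" by blast
      qed
    qed
  qed
  have "cuts c I X w = {?T}"
  proof -
    have "?T \<in> cuts c I X w" using cut_iff[of ?T] bT by auto
    moreover have "T = ?T" if "T \<in> cuts c I X w" for T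
    proof -
      have T: "T \<subseteq> X" "bij_betw c T I" using that by (auto simp: cuts_def)
      then have "T \<subseteq> ?T" using cut_iff[OF T] that by auto
      moreover have "card T = card ?T" using bij_betw_same_card[OF T(2)] bij_betw_same_card[OF bT] by simp
      ultimately show ?thesis using finX by (intro card_subset_eq) auto
    qed
    ultimately show ?thesis by blast
  qed
  then show ?thesis using w(1) by (intro exI[of _ w]) simp
qed

lemma ex_balanced_generic:
  fixes u :: "'x \<Rightarrow> 'a"
  assumes "generic X u"
  obtains \<phi> where "\<phi> \<noteq> 0" "balanced c I X u \<phi>"
proof -
  have "odd (card (cuts c I X u))" using ex_generic_single_cut parity_generic assms by blast
  then have "cuts c I X u \<noteq> {}" by auto
  then show ?thesis using that unfolding cuts_def by blast
qed

end

section \<open>From balanced hyperplanes to the discrete ham sandwich theorem\<close>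

lemma balanced_card_eq:
  assumes "balanced c I X u \<phi>" "finite X" "i \<in> I"
  shows "card {x \<in> X. c x = i \<and> \<phi> \<bullet> u x > 0} = card {x \<in> X. c x = i \<and> \<phi> \<bullet> u x < 0}"
proof -
  let ?X = "{x \<in> X. c x = i}"
  have fin: "finite ?X" using assms(2) by simp
  have "0 = (\<Sum>x\<in>?X. sgn (\<phi> \<bullet> u x))" using assms by (simp add: balanced_def)
  also have "\<dots> = (\<Sum>x\<in>?X. (if \<phi> \<bullet> u x > 0 then 1 else 0) - (if \<phi> \<bullet> u x < 0 then 1 else 0))"
    by (intro sum.cong) (auto simp: sgn_if)
  also have "\<dots> = real (card {x \<in> ?X. \<phi> \<bullet> u x > 0}) - real (card {x \<in> ?X. \<phi> \<bullet> u x < 0})"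
    using fin by (simp add: sum_subtractf sum.If_cases Int_def)
  finally show ?thesis by (simp add: conj_assoc)
qed

lemma balanced_card_le:
  assumes "balanced c I X u \<phi>" "finite X" "i \<in> I"
  shows "2 * card {x \<in> X. c x = i \<and> \<phi> \<bullet> u x > 0} \<le> card {x \<in> X. c x = i}"
    "2 * card {x \<in> X. c x = i \<and> \<phi> \<bullet> u x < 0} \<le> card {x \<in> X. c x = i}"
proof -
  let ?P = "{x \<in> X. c x = i \<and> \<phi> \<bullet> u x > 0}" and ?N = "{x \<in> X. c x = i \<and> \<phi> \<bullet> u x < 0}"
  have "card ?P + card ?N = card (?P \<union> ?N)"
    using assms(2) by (intro card_Un_disjoint[symmetric]) auto
  also have "\<dots> \<le> card {x \<in> X. c x = i}" using assms(2) by (intro card_mono) auto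
  finally show "2 * card ?P \<le> card {x \<in> X. c x = i}" "2 * card ?N \<le> card {x \<in> X. c x = i}"
    using balanced_card_eq[OF assms] by simp_all
qed

text \<open>Unit normals for ever smaller generic perturbations have a limit \<open>\<phi>\<close>.
  Exact balance may be lost because points can end up on the limit hyperplane, but a point strictly
  on one side of it was already there for late perturbations, so the bounds by half the class
  survive.\<close>

theorem discrete_ham_sandwich:
  fixes u :: "'x \<Rightarrow> 'a::euclidean_space"
  assumes finX: "finite X" and finI: "finite I" and cI: "c ` X \<subseteq> I" and cardI: "card I + 1 = DIM('a)"
    and odd_class: "\<And>i. i \<in> I \<Longrightarrow> odd (card {x \<in> X. c x = i})"
  obtains \<phi> where "\<phi> \<noteq> 0"
    "\<And>i. i \<in> I \<Longrightarrow> 2 * card {x \<in> X. c x = i \<and> \<phi> \<bullet> u x > 0} \<le> card {x \<in> X. c x = i}"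
    "\<And>i. i \<in> I \<Longrightarrow> 2 * card {x \<in> X. c x = i \<and> \<phi> \<bullet> u x < 0} \<le> card {x \<in> X. c x = i}"
proof (cases "DIM('a) \<le> card X")
  case False
  \<comment> \<open>With too few vectors, a hyperplane contains all of them and both sides are
    empty.\<close>
  then have "card (u ` X) < DIM('a)" using card_image_le[OF finX, of u] by simp
  then obtain \<phi> where "\<phi> \<noteq> 0" and "\<And>y. y \<in> u ` X \<Longrightarrow> \<phi> \<bullet> y = 0"
    using hyperplane_normal_exists[of "u ` X"] finX by blast
  then show ?thesis using that[of \<phi>] by (auto cong: conj_cong)
next
  case True
  interpret colored_points X I c "TYPE('a)"
    by unfold_locales (use assms True in auto)
  have "\<exists>\<phi> w. norm \<phi> = 1 \<and> balanced c I X w \<phi> \<and> (\<forall>x. dist (w x) (u x) < inverse (real (Suc n)))" for n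
  proof -
    obtain w where w: "generic X w" "\<And>x. dist (w x) (u x) < inverse (real (Suc n))"
      using generic_perturbation[OF finX, of "inverse (real (Suc n))" u] by auto
    obtain \<phi> where \<phi>: "\<phi> \<noteq> 0" "balanced c I X w \<phi>" using ex_balanced_generic[OF w(1)] by blast
    have "norm ((1 / norm \<phi>) *\<^sub>R \<phi>) = 1" using \<phi>(1) by simp
    moreover have "balanced c I X w ((1 / norm \<phi>) *\<^sub>R \<phi>)"
      using balanced_scaleR[of "1 / norm \<phi>" c I X w \<phi>] \<phi> by simp
    ultimately show ?thesis using w(2) by blast
  qed
  then obtain \<Phi> W where \<Phi>: "\<And>n. norm (\<Phi> n) = 1" "\<And>n. balanced c I X (W n) (\<Phi> n)"
    "\<And>n x. dist (W n x) (u x) < inverse (real (Suc n))" by metis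
  have "compact (sphere (0::'a) 1)" by simp
  moreover have "\<forall>n. \<Phi> n \<in> sphere 0 1" using \<Phi>(1) by simp
  ultimately obtain \<phi> r where r: "\<phi> \<in> sphere 0 1" "strict_mono r" "(\<Phi> \<circ> r) \<longlonglongrightarrow> \<phi>"
    unfolding compact_def by blast
  have W: "(\<lambda>n. W n x) \<longlonglongrightarrow> u x" for x
    unfolding tendsto_dist_iff[of _ "u x"]
    by (rule tendsto_sandwich[OF _ _ tendsto_const LIMSEQ_inverse_real_of_nat])
       (use \<Phi>(3) in \<open>auto intro!: always_eventually less_imp_le\<close>)
  have lim: "(\<lambda>n. \<Phi> (r n) \<bullet> W (r n) x) \<longlonglongrightarrow> \<phi> \<bullet> u x" for x
    using r(3) LIMSEQ_subseq_LIMSEQ[OF W r(2), of x] by (auto intro!: tendsto_inner simp: o_def)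
  have "\<forall>\<^sub>F n in sequentially. \<forall>x\<in>X. (\<phi> \<bullet> u x > 0 \<longrightarrow> \<Phi> (r n) \<bullet> W (r n) x > 0) \<and>
     (\<phi> \<bullet> u x < 0 \<longrightarrow> \<Phi> (r n) \<bullet> W (r n) x < 0)"
  proof (rule eventually_ball_finite[OF finX], rule ballI)
    fix x
    show "\<forall>\<^sub>F n in sequentially. (\<phi> \<bullet> u x > 0 \<longrightarrow> \<Phi> (r n) \<bullet> W (r n) x > 0) \<and>
       (\<phi> \<bullet> u x < 0 \<longrightarrow> \<Phi> (r n) \<bullet> W (r n) x < 0)"
      using order_tendstoD(1)[OF lim[of x], of 0] order_tendstoD(2)[OF lim[of x], of 0]
      by (cases "\<phi> \<bullet> u x" "0::real" rule: linorder_cases) auto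
  qed
  from eventually_happens'[OF sequentially_bot this]
  obtain n where n: "\<forall>x\<in>X. (\<phi> \<bullet> u x > 0 \<longrightarrow> \<Phi> (r n) \<bullet> W (r n) x > 0) \<and>
     (\<phi> \<bullet> u x < 0 \<longrightarrow> \<Phi> (r n) \<bullet> W (r n) x < 0)"
    by (rule exE)
  show ?thesis
  proof (rule that)
    show "\<phi> \<noteq> 0" using r(1) by auto
    fix i assume i: "i \<in> I"
    have "card {x \<in> X. c x = i \<and> \<phi> \<bullet> u x > 0} \<le> card {x \<in> X. c x = i \<and> \<Phi> (r n) \<bullet> W (r n) x > 0}"
      "card {x \<in> X. c x = i \<and> \<phi> \<bullet> u x < 0} \<le> card {x \<in> X. c x = i \<and> \<Phi> (r n) \<bullet> W (r n) x < 0}"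
      using finX n by (auto intro!: card_mono)
    then show "2 * card {x \<in> X. c x = i \<and> \<phi> \<bullet> u x > 0} \<le> card {x \<in> X. c x = i}"
      "2 * card {x \<in> X. c x = i \<and> \<phi> \<bullet> u x < 0} \<le> card {x \<in> X. c x = i}"
      using balanced_card_le[OF \<Phi>(2)[of "r n"] finX i] by linarith+
  qed
qed

text \<open>The vectors \<open>v k\<close>, each forming a color class of its own, force the normal into \<open>W\<close>.
  One color is dropped: its majority is fixed afterwards by the choice of sign.\<close>

lemma ham_sandwich_in_subspace:
  fixes u :: "'x \<Rightarrow> 'a::euclidean_space"
  assumes W: "subspace W" "card I \<le> dim W" "dim W \<noteq> 0"
    and finX: "finite X" and finI: "finite I" and cI: "c ` X \<subseteq> I"
    and odd_class: "\<And>i. i \<in> I \<Longrightarrow> odd (card {x \<in> X. c x = i})"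
  obtains \<phi> where "\<phi> \<in> W" "\<phi> \<noteq> 0"
    "\<And>i. i \<in> I \<Longrightarrow> 2 * card {x \<in> X. c x = i \<and> \<phi> \<bullet> u x > 0} \<le> card {x \<in> X. c x = i}"
proof (cases "I = {}")
  case True
  have "W \<noteq> {0}" using W(3) by (auto simp: dim_eq_0)
  then obtain \<phi> where "\<phi> \<in> W" "\<phi> \<noteq> 0" using subspace_0[OF W(1)] by blast
  then show ?thesis using True that by blast
next
  case False
  then obtain i0 where i0: "i0 \<in> I" by blast
  have dW: "dim (W\<^sup>\<bottom>) + dim W = DIM('a)"
    using dim_subspace_orthogonal_to_vectors[OF W(1) subspace_UNIV] 
    by (simp add: orthogonal_comp_def orthogonal_commute)
  obtain B where B: "B \<subseteq> W\<^sup>\<bottom>" "independent B" "W\<^sup>\<bottom> \<subseteq> span B" "card B = dim (W\<^sup>\<bottom>)"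
    using basis_exists by blast
  have finB: "finite B" using B(2) by (simp add: independent_imp_finite)
  obtain h where h: "bij_betw h {..<card B} B"
    using ex_bij_betw_nat_finite[OF finB] by (auto simp: atLeast0LessThan)
  define m where "m = DIM('a) - card I"
  have m: "card B \<le> m" "m + card I = DIM('a)" using dW W(2) B(4) by (auto simp: m_def)
  \<comment> \<open>A basis of the orthogonal complement of \<open>W\<close>, padded with zero
    vectors: together with the colors other than \<open>i0\<close>, exactly \<open>m\<close>
    singleton colors make \<open>DIM('a) - 1\<close>.\<close>
  define v where "v k = (if k < card B then h k else 0)" for k
  define X' where "X' = {x \<in> X. c x \<noteq> i0} <+> {..<m}"
  define I' where "I' = (I - {i0}) <+> {..<m}"
  have clsL: "{x \<in> X'. map_sum c id x = Inl i \<and> P x} = Inl ` {x \<in> X. c x = i \<and> P (Inl x)}"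
    if "i \<noteq> i0" for i P
    using that by (auto simp: X'_def)
  have clsL1: "{x \<in> X'. map_sum c id x = Inl i} = Inl ` {x \<in> X. c x = i}" if "i \<noteq> i0" for i
    using clsL[OF that, of "\<lambda>_. True"] by simp
  have clsR: "{x \<in> X'. map_sum c id x = Inr k \<and> P x} = (if P (Inr k) then {Inr k} else {})"
    if "k < m" for k P
    using that by (auto simp: X'_def)
  have clsR1: "{x \<in> X'. map_sum c id x = Inr k} = {Inr k}" if "k < m" for k
    using clsR[OF that, of "\<lambda>_. True"] by simp
  have odd': "odd (card {x \<in> X'. map_sum c id x = j})" if "j \<in> I'" for j
  proof (cases j)
    case (Inl i)
    then have "i \<in> I" "i \<noteq> i0" using that by (auto simp: I'_def)
    then show ?thesis using odd_class[of i] clsL1[of i] by (simp add: Inl card_image)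
  next
    case (Inr k)
    then have "k < m" using that by (auto simp: I'_def)
    then show ?thesis using clsR1[of k] by (simp add: Inr)
  qed
  have "card I' + 1 = DIM('a)"
    using i0 finI m(2) card_Suc_Diff1[OF finI i0] by (simp add: I'_def card_Plus)
  moreover have "finite X'" "finite I'" "map_sum c id ` X' \<subseteq> I'"
    using finX finI cI by (auto simp: X'_def I'_def)
  ultimately obtain \<phi> where \<phi>: "\<phi> \<noteq> 0"
    "\<And>j. j \<in> I' \<Longrightarrow> 2 * card {x \<in> X'. map_sum c id x = j \<and> \<phi> \<bullet> case_sum u v x > 0} \<le> card {x \<in> X'. map_sum c id x = j}"
    "\<And>j. j \<in> I' \<Longrightarrow> 2 * card {x \<in> X'. map_sum c id x = j \<and> \<phi> \<bullet> case_sum u v x < 0} \<le> card {x \<in> X'. map_sum c id x = j}"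
    using discrete_ham_sandwich[of X' I' "map_sum c id" "case_sum u v"] odd' by blast
  \<comment> \<open>At most half of a class of size one, that is none of it, lies strictly on either
    side.\<close>
  have "\<phi> \<bullet> v k = 0" if "k < m" for k
  proof -
    have "Inr k \<in> I'" using that by (auto simp: I'_def)
    from \<phi>(2)[OF this] \<phi>(3)[OF this] have "\<not> \<phi> \<bullet> v k > 0" "\<not> \<phi> \<bullet> v k < 0"
      unfolding clsR[OF that] clsR1[OF that] by (auto split: if_splits)
    then show ?thesis by simp
  qed
  then have "\<phi> \<bullet> b = 0" if "b \<in> B" for b
    using that h m(1) unfolding bij_betw_def by (metis imageE lessThan_iff order_less_le_trans v_def)
  then have "\<phi> \<bullet> b = 0" if "b \<in> W\<^sup>\<bottom>" for b
    using orthogonal_span_zero[of B \<phi> b] that B(3) by blast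
  then have "\<phi> \<in> W\<^sup>\<bottom>\<^sup>\<bottom>" by (simp add: orthogonal_comp_def orthogonal_def inner_commute)
  then have \<phi>W: "\<phi> \<in> W" using orthogonal_comp_self[OF W(1)] by simp
  have main: "2 * card {x \<in> X. c x = i \<and> \<phi> \<bullet> u x > 0} \<le> card {x \<in> X. c x = i}"
    "2 * card {x \<in> X. c x = i \<and> \<phi> \<bullet> u x < 0} \<le> card {x \<in> X. c x = i}" if "i \<in> I" "i \<noteq> i0" for i
    using \<phi>(2,3)[of "Inl i"] that unfolding clsL[OF that(2)] clsL1[OF that(2)]
    by (auto simp: I'_def card_image)
  \<comment> \<open>The color \<open>i0\<close> need not be bisected, but at least one of its two
    sides holds at most half. All other colors are bounded on both sides, so \<open>\<phi>\<close>
    may be replaced by \<open>- \<phi>\<close>.\<close>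
  let ?p = "card {x \<in> X. c x = i0 \<and> \<phi> \<bullet> u x > 0}" and ?n = "card {x \<in> X. c x = i0 \<and> \<phi> \<bullet> u x < 0}"
  have "?p + ?n = card ({x \<in> X. c x = i0 \<and> \<phi> \<bullet> u x > 0} \<union> {x \<in> X. c x = i0 \<and> \<phi> \<bullet> u x < 0})"
    using finX by (intro card_Un_disjoint[symmetric]) auto
  also have "\<dots> \<le> card {x \<in> X. c x = i0}" using finX by (intro card_mono) auto
  finally consider "2 * ?p \<le> card {x \<in> X. c x = i0}" | "2 * ?n \<le> card {x \<in> X. c x = i0}" by linarith
  then show ?thesis
  proof cases
    case 1
    show ?thesis
    proof (rule that[OF \<phi>W \<phi>(1)])
      show "2 * card {x \<in> X. c x = i \<and> \<phi> \<bullet> u x > 0} \<le> card {x \<in> X. c x = i}" if "i \<in> I" for i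
        using 1 main(1)[OF that] by (cases "i = i0") simp_all
    qed
  next
    case 2
    have "- \<phi> \<in> W" "- \<phi> \<noteq> 0" using \<phi>W W(1) \<phi>(1) by (simp_all add: subspace_neg)
    then show ?thesis
    proof (rule that)
      show "2 * card {x \<in> X. c x = i \<and> - \<phi> \<bullet> u x > 0} \<le> card {x \<in> X. c x = i}" if "i \<in> I" for i
        using 2 main(2)[OF that] by (cases "i = i0") simp_all
    qed
  qed
qed

section \<open>Faces of products of simplices\<close>

text \<open>Below a vertex comes the empty face, of dimension -1, so that descending chains lose one
  dimension at every step down to the empty face.\<close>

lemma proper_subface:
  fixes P :: "'a::euclidean_space set"
  assumes "polytope P" "F face_of P" "F \<noteq> {}"
  obtains G where "G face_of F" "G \<subset> F" "aff_dim G = aff_dim F - 1"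
proof (cases "aff_dim F = 0")
  case True
  then show ?thesis using that[of "{}"] assms(3) by auto
next
  case False
  have "polytope F" using assms face_of_polytope_polytope by blast
  moreover have "aff_dim F > 0" using False assms(3) aff_dim_geq[of F] aff_dim_negative_iff[of F] by linarith
  ultimately obtain G where G: "G facet_of F" using polytope_facet_exists by blast
  then have "G face_of F" "aff_dim G = aff_dim F - 1" by (auto simp: facet_of_def)
  moreover from this have "G \<subset> F" using face_of_imp_subset by fastforce
  ultimately show ?thesis using that by blast
qed

lemma face_psubset_aff_dim:
  fixes P :: "'a::euclidean_space set"
  assumes "F face_of P" "G face_of P" "F \<subset> G"
  shows "aff_dim F < aff_dim G"
proof (rule face_of_aff_dim_lt)
  show "convex G" using assms(2) by (rule face_of_imp_convex)
  show "F face_of G" using assms face_of_face[OF assms(2)] by blast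
  show "F \<noteq> G" using assms(3) by blast
qed

text \<open>A chain of faces below \<open>F\<close> that grows by one dimension per step is mapped
  to a strict chain, whose dimensions grow by at least one per step. Closure of \<open>A\<close>
  under subfaces keeps the chain inside \<open>A\<close>.\<close>

lemma aff_dim_le_strict_mono_image:
  fixes P :: "'a::euclidean_space set" and Q :: "'b::euclidean_space set"
  assumes P: "polytope P" and A: "A \<subseteq> {F. F face_of P}" "\<And>F G. F \<in> A \<Longrightarrow> G face_of F \<Longrightarrow> G \<in> A"
    and f: "\<And>F. F \<in> A \<Longrightarrow> f F face_of Q" "\<And>F G. F \<in> A \<Longrightarrow> G \<in> A \<Longrightarrow> F \<subset> G \<Longrightarrow> f F \<subset> f G"
    and F: "F \<in> A"
  shows "aff_dim F \<le> aff_dim (f F)"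
  using F
proof (induction "nat (aff_dim F + 1)" arbitrary: F rule: less_induct)
  case less
  show ?case
  proof (cases "F = {}")
    case True
    then show ?thesis using aff_dim_geq[of "f F"] by simp
  next
    case False
    have "F face_of P" using less.prems A by blast
    then obtain G where G: "G face_of F" "G \<subset> F" "aff_dim G = aff_dim F - 1"
      using proper_subface[OF P _ False] by blast
    have GA: "G \<in> A" using A(2)[OF less.prems G(1)] .
    have "aff_dim F \<ge> 0" using False aff_dim_geq[of F] aff_dim_negative_iff[of F] by linarith
    then have "aff_dim G \<le> aff_dim (f G)" using less.hyps[OF _ GA] G(3) by simp
    also have "\<dots> < aff_dim (f F)"
      using face_psubset_aff_dim[OF f(1)[OF GA] f(1)[OF less.prems] f(2)[OF GA less.prems G(2)]] .
    finally show ?thesis using G(3) by simp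
  qed
qed

lemma poset_iso_aff_dim:
  fixes P :: "'a::euclidean_space set" and Q :: "'b::euclidean_space set"
  assumes P: "polytope P" and A: "A \<subseteq> {F. F face_of P}" "\<And>F G. F \<in> A \<Longrightarrow> G face_of F \<Longrightarrow> G \<in> A"
    and Q: "polytope Q" and B: "B \<subseteq> {F. F face_of Q}" "\<And>F G. F \<in> B \<Longrightarrow> G face_of F \<Longrightarrow> G \<in> B"
    and f: "bij_betw f A B" "\<And>F G. F \<in> A \<Longrightarrow> G \<in> A \<Longrightarrow> F \<subseteq> G \<longleftrightarrow> f F \<subseteq> f G"
    and F: "F \<in> A"
  shows "aff_dim (f F) = aff_dim F"
proof (rule antisym)
  let ?g = "inv_into A f"
  have fB: "f F \<in> B" if "F \<in> A" for F using that f(1) by (auto simp: bij_betw_def)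
  have gA: "?g F \<in> A" "f (?g F) = F" if "F \<in> B" for F
    using that f(1) by (auto simp: bij_betw_def inv_into_into f_inv_into_f)
  have gf: "?g (f F) = F" if "F \<in> A" for F using that f(1) by (auto simp: bij_betw_def)
  show "aff_dim F \<le> aff_dim (f F)"
  proof (rule aff_dim_le_strict_mono_image[OF P A(1)])
    show "f F face_of Q" if "F \<in> A" for F using fB[OF that] B(1) by blast
    show "f F \<subset> f G" if "F \<in> A" "G \<in> A" "F \<subset> G" for F G
      using that f(2)[of F G] f(2)[of G F] by auto
  qed (use A(2) F in auto)
  have "aff_dim (f F) \<le> aff_dim (?g (f F))"
  proof (rule aff_dim_le_strict_mono_image[OF Q B(1)])
    show "?g F face_of P" if "F \<in> B" for F using gA[OF that] A(1) by blast
    have iff: "?g F \<subseteq> ?g G \<longleftrightarrow> F \<subseteq> G" if "F \<in> B" "G \<in> B" for F G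
      using f(2)[OF gA(1)[OF that(1)] gA(1)[OF that(2)]]
      unfolding gA(2)[OF that(1)] gA(2)[OF that(2)] .
    show "?g F \<subset> ?g G" if "F \<in> B" "G \<in> B" "F \<subset> G" for F G
      using iff[OF that(1,2)] iff[OF that(2,1)] that(3) by blast
  qed (use B(2) fB[OF F] in auto)
  then show "aff_dim (f F) \<le> aff_dim F" using gf[OF F] by simp
qed

text \<open>A nonempty face of a product of simplices is a product of nonempty sets of vertices; it is encoded
  by the set of all pairs (factor, vertex) that occur.\<close>

definition labels :: "nat list \<Rightarrow> (nat \<times> nat) set" where
  "labels ns = (SIGMA i:{..<length ns}. {..ns ! i})"

definition cells :: "nat list \<Rightarrow> (nat \<times> nat) set set" where
  "cells ns = {T. T \<subseteq> labels ns \<and> fst ` T = {..<length ns}}"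

lemma finite_labels: "finite (labels ns)"
  by (simp add: labels_def)

lemma finite_cells: "finite (cells ns)"
  by (rule finite_subset[of _ "Pow (labels ns)"]) (auto simp: cells_def finite_labels)

lemma cellD:
  assumes "T \<in> cells ns"
  shows "T \<subseteq> labels ns" "finite T" "fst ` T = {..<length ns}" "length ns \<le> card T"
proof -
  show *: "T \<subseteq> labels ns" "fst ` T = {..<length ns}" using assms by (auto simp: cells_def)
  then show f: "finite T" using finite_labels finite_subset by blast
  show "length ns \<le> card T" using card_image_le[OF f, of fst] *(2) by simp
qed

lemma labels_in_cells: "labels ns \<in> cells ns"
  by (force simp: cells_def labels_def)

lemma cell_superset:
  assumes "T \<in> cells ns" "T \<subseteq> U" "U \<subseteq> labels ns"
  shows "U \<in> cells ns"
proof -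
  have "fst ` U \<subseteq> {..<length ns}" using assms(3) by (auto simp: labels_def)
  moreover have "{..<length ns} \<subseteq> fst ` U" using cellD(3)[OF assms(1)] assms(2) by blast
  ultimately show ?thesis using assms(3) by (simp add: cells_def)
qed

lemma cell_contains_vertex:
  assumes "T \<in> cells ns"
  obtains S where "S \<in> cells ns" "S \<subseteq> T" "card S = length ns"
proof -
  have "\<forall>i<length ns. \<exists>p\<in>T. fst p = i" using cellD(3)[OF assms] by (metis imageE lessThan_iff)
  then obtain s where s: "\<And>i. i < length ns \<Longrightarrow> s i \<in> T \<and> fst (s i) = i" by metis
  let ?S = "s ` {..<length ns}"
  have "inj_on s {..<length ns}" by (rule inj_onI) (metis s lessThan_iff)
  then have "card ?S = length ns" by (simp add: card_image)
  moreover have sT: "?S \<subseteq> T" using s by auto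
  moreover have "fst ` ?S = {..<length ns}" using s by (force simp: image_iff)
  then have "?S \<in> cells ns" using sT cellD(1)[OF assms] by (simp add: cells_def)
  ultimately show ?thesis using that by blast
qed

lemma vertex_inj_fst:
  assumes "S \<in> cells ns" "card S = length ns"
  shows "inj_on fst S"
  using cellD[OF assms(1)] assms(2) by (intro eq_card_imp_inj_on) auto

text \<open>The label of \<open>S\<close> in the factor of \<open>p\<close> gives way to
  \<open>p\<close>.\<close>

lemma vertex_exchange:
  assumes S: "S \<in> cells ns" "card S = length ns" and p: "p \<in> labels ns" "p \<notin> S"
  obtains S' where "S' \<in> cells ns" "card S' = length ns" "p \<in> S'" "S' \<subseteq> insert p S"
proof -
  note SD = cellD[OF S(1)]
  have "fst p \<in> fst ` S" using p(1) SD(3) by (auto simp: labels_def)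
  then obtain q where q: "q \<in> S" "fst q = fst p" by (metis imageE)
  let ?S = "insert p (S - {q})"
  have "fst ` ?S = fst ` insert q (S - {q})"  unfolding image_insert q(2) ..
  also have "insert q (S - {q}) = S" using q by auto
  finally have "?S \<in> cells ns" using SD p by (auto simp: cells_def)
  moreover have "card ?S = length ns"
    using SD(2) p(2) q S(2) card_Suc_Diff1[OF SD(2) q(1)] by simp
  ultimately show ?thesis using that by blast
qed

lemma cell_remove:
  assumes T: "T \<in> cells ns" "length ns < card T"
  obtains p q where "p \<in> T" "q \<in> T" "p \<noteq> q" "fst p = fst q" "T - {p} \<in> cells ns" "T - {q} \<in> cells ns"
proof -
  note TD = cellD[OF T(1)]
  have "\<not> inj_on fst T" using card_image[of fst T] TD(3) T(2) by auto
  then obtain p q where pq: "p \<in> T" "q \<in> T" "p \<noteq> q" "fst p = fst q" by (auto simp: inj_on_def)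
  have *: "T - {x} \<in> cells ns" if "x \<in> T" "y \<in> T" "x \<noteq> y" "fst x = fst y" for x y
  proof -
    have "fst ` T = fst ` insert x (T - {x})" using that(1) by (simp add: insert_absorb)
    also have "\<dots> = fst ` (T - {x})" using that by auto
    finally show ?thesis using TD by (auto simp: cells_def)
  qed
  show ?thesis using that[OF pq] *[OF pq] *[OF pq(2,1)] pq(3,4) by metis
qed

text \<open>Some factor has two labels \<open>p\<close> and \<open>q\<close> in \<open>T\<close>. A
  vertex contains at most one of them, and by cardinality it is \<open>T\<close> without the
  other.\<close>

lemma edge_vertices:
  assumes T: "T \<in> cells ns" "card T = Suc (length ns)"
    and S: "\<And>S. S \<in> {S1, S2, S3} \<Longrightarrow> S \<in> cells ns \<and> card S = length ns \<and> S \<subseteq> T"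
  shows "S1 = S2 \<or> S1 = S3 \<or> S2 = S3"
proof -
  obtain p q where pq: "p \<in> T" "q \<in> T" "p \<noteq> q" "fst p = fst q"
    using cell_remove[OF T(1)] T(2) by (metis lessI)
  have "S = T - {p} \<or> S = T - {q}" if "S \<in> {S1, S2, S3}" for S
  proof -
    have SS: "S \<in> cells ns" "card S = length ns" "S \<subseteq> T" using S[OF that] by auto
    have "inj_on fst S" by (rule vertex_inj_fst[OF SS(1,2)])
    then have "p \<notin> S \<or> q \<notin> S" using pq by (auto simp: inj_on_def)
    then have "S \<subseteq> T - {p} \<or> S \<subseteq> T - {q}" using SS(3) by blast
    moreover have "card (T - {p}) = card S" "card (T - {q}) = card S"
      using pq T(2) SS(2) cellD(2)[OF T(1)] by simp_all
    ultimately show ?thesis using cellD(2)[OF T(1)] card_subset_eq by (metis finite_Diff)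
  qed
  then show ?thesis by (metis insertCI)
qed

text \<open>The dimension of a cell can be read off from its graph: the number of edges through a vertex.\<close>

lemma cell_embedding_card:
  assumes \<theta>: "\<And>T. T \<in> cells ns \<Longrightarrow> card T \<le> length ns + k \<Longrightarrow> \<theta> T \<in> cells ns \<and> card T \<le> card (\<theta> T)"
    and ord: "\<And>T U. T \<in> cells ns \<Longrightarrow> card T \<le> length ns + k \<Longrightarrow> U \<in> cells ns \<Longrightarrow>
      card U \<le> length ns + k \<Longrightarrow> \<theta> T \<subseteq> \<theta> U \<longleftrightarrow> T \<subseteq> U"
    and disj: "\<And>S S' U. S \<in> cells ns \<Longrightarrow> card S = length ns \<Longrightarrow> S' \<in> cells ns \<Longrightarrow> card S' = length ns \<Longrightarrow>
      U \<in> cells ns \<Longrightarrow> U \<subseteq> \<theta> S \<Longrightarrow> U \<subseteq> \<theta> S' \<Longrightarrow> S = S'"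
    and T: "T \<in> cells ns" "card T \<le> length ns + k"
  shows "card (\<theta> T) = card T"
proof -
  let ?r = "length ns"
  define \<V> where "\<V> = {S \<in> cells ns. card S = ?r}"
  have finV: "finite \<V>" using finite_cells by (simp add: \<V>_def)
  have \<theta>_inj: "T = U" if "T \<in> cells ns" "card T \<le> ?r + k" "U \<in> cells ns" "card U \<le> ?r + k" "\<theta> T = \<theta> U" for T U
    using ord[OF that(1-4)] ord[OF that(3,4,1,2)] that(5) by auto
  \<comment> \<open>Choose a vertex \<open>m S\<close> inside each \<open>\<theta> S\<close>. By
    \<open>disj\<close> the choices are distinct, and since there are finitely many vertices each
    one is chosen.\<close>
  have "\<forall>S\<in>\<V>. \<exists>U\<in>\<V>. U \<subseteq> \<theta> S"
  proof
    fix S assume "S \<in> \<V>"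
    then have "\<theta> S \<in> cells ns" using \<theta>[of S] by (simp add: \<V>_def)
    then show "\<exists>U\<in>\<V>. U \<subseteq> \<theta> S" using cell_contains_vertex[of "\<theta> S"] unfolding \<V>_def by blast
  qed
  then obtain m where m: "\<And>S. S \<in> \<V> \<Longrightarrow> m S \<in> \<V> \<and> m S \<subseteq> \<theta> S" by metis
  have m_eq: "S = S'" if "S \<in> \<V>" "S' \<in> \<V>" "m S' \<subseteq> \<theta> S" for S S'
    using disj[of S S' "m S'"] m[of S'] that by (auto simp: \<V>_def)
  have "inj_on m \<V>" by (rule inj_onI) (metis m m_eq)
  then have m_surj: "m ` \<V> = \<V>" using m by (intro endo_inj_surj finV) auto
  \<comment> \<open>A second vertex inside \<open>\<theta> S\<close> would be the one chosen for
    another cell, contradicting \<open>disj\<close>.\<close>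
  have vertex: "\<theta> S = m S" if S: "S \<in> \<V>" for S
  proof (rule ccontr)
    assume "\<theta> S \<noteq> m S"
    then obtain p where p: "p \<in> \<theta> S" "p \<notin> m S" using m[OF S] by blast
    have "\<theta> S \<in> cells ns" using \<theta>[of S] S by (simp add: \<V>_def)
    then have "p \<in> labels ns" using p(1) cellD(1) by blast
    moreover have "m S \<in> cells ns" "card (m S) = ?r" using m[OF S] by (auto simp: \<V>_def)
    ultimately obtain S' where S': "S' \<in> cells ns" "card S' = ?r" "p \<in> S'" "S' \<subseteq> insert p (m S)"
      using vertex_exchange[of "m S" ns p] p(2) by blast
    have "S' \<in> m ` \<V>" using S' m_surj by (simp add: \<V>_def)
    then obtain S'' where S'': "S'' \<in> \<V>" "S' = m S''" by blast
    have "m S'' \<subseteq> \<theta> S" using S' S'' p(1) m[OF S] by blast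
    then have "S = S''" using m_eq S S'' by blast
    then show False using S' S'' p by simp
  qed
  have \<V>_surj: "\<exists>S'\<in>\<V>. S = \<theta> S'" if "S \<in> \<V>" for S
  proof -
    have "S \<in> m ` \<V>" using m_surj that by simp
    then show ?thesis using vertex by auto
  qed
  have vertex_card: "card (\<theta> S) = ?r" if "S \<in> cells ns" "card S = ?r" for S
    using vertex[of S] m[of S] that by (simp add: \<V>_def)
  define \<E> where "\<E> = {E \<in> cells ns. card E = Suc ?r}"
  have finE: "finite \<E>" using finite_cells by (simp add: \<E>_def)
  \<comment> \<open>An image larger than an edge would contain three vertices, which come from three
    vertices of \<open>E\<close>.\<close>
  have edge: "\<theta> E \<in> \<E>" if E: "E \<in> \<E>" and k: "0 < k" for E
  proof (rule ccontr)
    assume no: "\<theta> E \<notin> \<E>"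
    have E': "E \<in> cells ns" "card E = Suc ?r" "card E \<le> ?r + k" using E k by (auto simp: \<E>_def)
    note \<theta>E = \<theta>[OF E'(1,3)]
    have big: "card (\<theta> E) > Suc ?r" using no \<theta>E E'(2) by (auto simp: \<E>_def)
    obtain S where S: "S \<in> cells ns" "S \<subseteq> E" "card S = ?r" using cell_contains_vertex[OF E'(1)] by blast
    have "card S \<le> ?r + k" using S by simp
    then have sub: "\<theta> S \<subseteq> \<theta> E" "\<theta> S \<in> cells ns" using ord[of S E] S E' \<theta>[of S] by auto
    have "card (\<theta> E - \<theta> S) = card (\<theta> E) - ?r"
      using card_Diff_subset[of "\<theta> S" "\<theta> E"] sub cellD(2)[OF sub(2)] vertex_card[OF S(1,3)] by simp
    then have "card (\<theta> E - \<theta> S) \<ge> 2" using big by simp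
    then obtain D where D: "D \<subseteq> \<theta> E - \<theta> S" "card D = 2"
      using obtain_subset_with_card_n by metis
    then obtain p q where pq: "p \<in> \<theta> E - \<theta> S" "q \<in> \<theta> E - \<theta> S" "p \<noteq> q"
      unfolding card_2_iff by blast
    have lab: "p \<in> labels ns" "q \<in> labels ns" using pq \<theta>E cellD(1) by blast+
    obtain Sp where Sp: "Sp \<in> cells ns" "card Sp = ?r" "p \<in> Sp" "Sp \<subseteq> insert p (\<theta> S)"
      using vertex_exchange[OF sub(2) vertex_card[OF S(1,3)] lab(1)] pq by blast
    obtain Sq where Sq: "Sq \<in> cells ns" "card Sq = ?r" "q \<in> Sq" "Sq \<subseteq> insert q (\<theta> S)"
      using vertex_exchange[OF sub(2) vertex_card[OF S(1,3)] lab(2)] pq by blast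
    obtain S1 S2 where S12: "S1 \<in> \<V>" "Sp = \<theta> S1" "S2 \<in> \<V>" "Sq = \<theta> S2"
      using \<V>_surj[of Sp] \<V>_surj[of Sq] Sp Sq by (auto simp: \<V>_def)
    have "\<theta> S1 \<subseteq> \<theta> E" "\<theta> S2 \<subseteq> \<theta> E" using S12 Sp Sq pq sub by blast+
    then have "S1 \<subseteq> E" "S2 \<subseteq> E" using ord[of S1 E] ord[of S2 E] S12 E' by (auto simp: \<V>_def)
    moreover have "S1 \<noteq> S" "S2 \<noteq> S" "S1 \<noteq> S2" using S12 Sp Sq pq by auto
    ultimately show False using edge_vertices[OF E'(1,2), of S S1 S2] S S12 by (auto simp: \<V>_def)
  qed
  show ?thesis
  proof (cases "card T = ?r")
    case True
    then show ?thesis using vertex_card T by simp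
  next
    case False
    then have k: "0 < k" using T cellD(4)[OF T(1)] by linarith
    have "inj_on \<theta> \<E>" by (rule inj_onI) (use \<theta>_inj k in \<open>auto simp: \<E>_def\<close>)
    then have \<E>_surj: "\<theta> ` \<E> = \<E>" using edge k by (intro endo_inj_surj finE) auto
    obtain S where S: "S \<in> cells ns" "S \<subseteq> T" "card S = ?r" using cell_contains_vertex[OF T(1)] by blast
    have Sk: "card S \<le> ?r + k" using S by simp
    have sub: "\<theta> S \<subseteq> \<theta> T" "\<theta> S \<in> cells ns" using ord[OF S(1) Sk T] S \<theta>[OF S(1) Sk] by auto
    have \<theta>T: "\<theta> T \<in> cells ns" using \<theta>[OF T] by simp
    \<comment> \<open>Edges are mapped onto edges, so every edge at \<open>\<theta> S\<close> inside
      \<open>\<theta> T\<close> comes from an edge at \<open>S\<close> inside \<open>T\<close>. The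
      labels these edges add give an injection of \<open>\<theta> T - \<theta> S\<close> into
      \<open>T - S\<close>.\<close>
    have "\<forall>q\<in>\<theta> T - \<theta> S. \<exists>p\<in>T - S. insert q (\<theta> S) = \<theta> (insert p S)"
    proof
      fix q assume q: "q \<in> \<theta> T - \<theta> S"
      have "insert q (\<theta> S) \<in> cells ns"
        by (rule cell_superset[OF sub(2)]) (use q cellD(1)[OF \<theta>T] sub in auto)
      moreover have "card (insert q (\<theta> S)) = Suc ?r"
        using q cellD(2)[OF sub(2)] vertex_card[OF S(1,3)] by simp
      ultimately have "insert q (\<theta> S) \<in> \<theta> ` \<E>" using \<E>_surj by (simp add: \<E>_def)
      then obtain E where E: "E \<in> \<E>" "insert q (\<theta> S) = \<theta> E" by blast
      have E': "E \<in> cells ns" "card E = Suc ?r" "card E \<le> ?r + k" using E k by (auto simp: \<E>_def)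
      have "\<theta> S \<subseteq> \<theta> E" "\<theta> E \<subseteq> \<theta> T" using E(2) q sub by auto
      then have SE: "S \<subseteq> E" "E \<subseteq> T" using ord[OF S(1) Sk E'(1,3)] ord[OF E'(1,3) T] by auto
      then obtain p where p: "p \<in> E" "p \<notin> S" using E'(2) S(3) by (metis n_not_Suc_n subsetI subset_antisym)
      have "insert p S = E"
        using SE p E'(2) S(3) cellD(2)[OF S(1)] cellD(2)[OF E'(1)] by (intro card_subset_eq) auto
      then show "\<exists>p\<in>T - S. insert q (\<theta> S) = \<theta> (insert p S)" using E(2) p SE by auto
    qed
    then obtain w where w: "\<And>q. q \<in> \<theta> T - \<theta> S \<Longrightarrow> w q \<in> T - S \<and> insert q (\<theta> S) = \<theta> (insert (w q) S)"
      by metis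
    have "inj_on w (\<theta> T - \<theta> S)"
    proof (rule inj_onI)
      fix x y assume xy: "x \<in> \<theta> T - \<theta> S" "y \<in> \<theta> T - \<theta> S" "w x = w y"
      then have "insert x (\<theta> S) = insert y (\<theta> S)" using w[of x] w[of y] by simp
      then show "x = y" using xy by blast
    qed
    then have "card (\<theta> T - \<theta> S) \<le> card (T - S)"
      using w cellD(2)[OF T(1)] by (intro card_inj_on_le[of w]) auto
    moreover have "card (\<theta> T - \<theta> S) = card (\<theta> T) - ?r" "card (T - S) = card T - ?r"
      using card_Diff_subset[of "\<theta> S" "\<theta> T"] card_Diff_subset[of S T] sub S
        cellD(2)[OF sub(2)] cellD(2)[OF S(1)] vertex_card[OF S(1,3)] by auto
    moreover have "card T \<ge> ?r" "card (\<theta> T) \<ge> card T" using cellD(4)[OF T(1)] \<theta>[OF T] by auto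
    ultimately show ?thesis by linarith
  qed
qed

section \<open>Polytopes with the face lattice of a product of simplices\<close>

locale product_faces =
  fixes ns :: "nat list" and Q :: "'b::euclidean_space set" and G :: "(nat \<times> nat) set \<Rightarrow> 'b set"
  assumes poly: "polytope Q"
    and face: "\<And>T. T \<in> cells ns \<Longrightarrow> G T face_of Q" "\<And>T. T \<in> cells ns \<Longrightarrow> G T \<noteq> {}"
    and order: "\<And>T U. T \<in> cells ns \<Longrightarrow> U \<in> cells ns \<Longrightarrow> G T \<subseteq> G U \<longleftrightarrow> T \<subseteq> U"
    and surj: "\<And>F. F face_of Q \<Longrightarrow> F \<noteq> {} \<Longrightarrow> \<exists>T\<in>cells ns. F = G T"
begin

lemma psubset: "T \<in> cells ns \<Longrightarrow> U \<in> cells ns \<Longrightarrow> G T \<subset> G U \<longleftrightarrow> T \<subset> U"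
  using order by (simp add: psubset_eq) blast

lemma G_labels: "G (labels ns) = Q"
proof -
  have "G (labels ns) \<subseteq> Q" using face(1)[OF labels_in_cells] face_of_imp_subset by blast
  moreover have "Q \<noteq> {}" using face[OF labels_in_cells] face_of_imp_subset by blast
  then obtain T where T: "T \<in> cells ns" "Q = G T"
    using surj[of Q] face_of_refl[OF polytope_imp_convex[OF poly]] by blast
  then have "Q \<subseteq> G (labels ns)" using order[OF T(1) labels_in_cells] cellD(1)[OF T(1)] by auto
  ultimately show ?thesis by auto
qed

text \<open>Removing a label lowers the dimension by at least one, which gives the lower bound; a
  face of codimension one in \<open>G T\<close> has fewer labels, which gives the upper
  bound.\<close>

lemma aff_dim_cell:
  assumes "T \<in> cells ns"
  shows "aff_dim (G T) = int (card T) - int (length ns)"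
proof (rule antisym)
  show "int (card T) - int (length ns) \<le> aff_dim (G T)"
    using assms
  proof (induction "card T" arbitrary: T rule: less_induct)
    case less
    have ge0: "aff_dim (G T) \<ge> 0"
      using face(2)[OF less.prems] aff_dim_geq[of "G T"] aff_dim_negative_iff[of "G T"] by linarith
    show ?case
    proof (cases "card T = length ns")
      case False
      then have "length ns < card T" using cellD(4)[OF less.prems] by simp
      then obtain p where p: "p \<in> T" "T - {p} \<in> cells ns" using cell_remove[OF less.prems] by blast
      have c: "card (T - {p}) < card T" "card T = Suc (card (T - {p}))"
        using p card_Suc_Diff1[OF cellD(2)[OF less.prems] p(1)] by auto
      have "T - {p} \<subset> T" using p by blast
      then have "G (T - {p}) \<subset> G T" using psubset[OF p(2) less.prems] by simp
      then have "aff_dim (G (T - {p})) < aff_dim (G T)"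
        using face_psubset_aff_dim face(1) p(2) less.prems by blast
      then show ?thesis using less.hyps[OF c(1) p(2)] c(2) by simp
    qed (use ge0 in simp)
  qed
  show "aff_dim (G T) \<le> int (card T) - int (length ns)"
    using assms
  proof (induction "card T" arbitrary: T rule: less_induct)
    case less
    obtain F where F: "F face_of G T" "F \<subset> G T" "aff_dim F = aff_dim (G T) - 1"
      using proper_subface[OF poly face[OF less.prems]] by blast
    show ?case
    proof (cases "F = {}")
      case True
      then show ?thesis using F(3) cellD(4)[OF less.prems] by simp
    next
      case False
      have "F face_of Q" using F(1) face(1)[OF less.prems] face_of_trans by blast
      then obtain U where U: "U \<in> cells ns" "F = G U" using surj False by blast
      then have "U \<subset> T" using F(2) psubset[OF U(1) less.prems] by simp
      then have "card U < card T" using cellD(2)[OF less.prems] by (rule psubset_card_mono[rotated])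
      then show ?thesis using less.hyps[OF _ U(1)] F(3) U(2) by simp
    qed
  qed
qed

end

section \<open>The Minkowski sum of simplices in barycentric coordinates\<close>

lemma polytope_set_sum_convex_hulls:
  fixes B :: "'i \<Rightarrow> 'a::euclidean_space set"
  assumes "finite I" "\<And>i. i \<in> I \<Longrightarrow> finite (B i)"
  shows "polytope {\<Sum>i\<in>I. y i | y. \<forall>i\<in>I. y i \<in> convex hull B i}"
proof -
  have "finite (\<Sum>i\<in>I. B i)"
    using assms by (induction I rule: finite_induct) (simp_all add: finite_set_plus)
  then have "polytope (convex hull (\<Sum>i\<in>I. B i))" by (rule polytope_convex_hull)
  moreover have "convex hull (\<Sum>i\<in>I. B i) = {\<Sum>i\<in>I. y i | y. \<forall>i\<in>I. y i \<in> convex hull B i}"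
    unfolding convex_hull_set_sum by (rule set_sum_alt[OF assms(1)])
  ultimately show ?thesis by simp
qed

lemma independent_family_zero:
  fixes e :: "'p \<Rightarrow> 'a::euclidean_space"
  assumes "independent (e ` E)" "inj_on e E" "finite E" "(\<Sum>p\<in>E. d p *\<^sub>R e p) = 0" "p \<in> E"
  shows "d p = 0"
proof -
  let ?u = "\<lambda>v. d (inv_into E e v)"
  have "(\<Sum>v\<in>e ` E. ?u v *\<^sub>R v) = (\<Sum>p\<in>E. d p *\<^sub>R e p)"
    using assms(2) by (subst sum.reindex) (auto intro!: sum.cong)
  then have "?u (e p) = 0"
    using assms by (intro independentD[OF assms(1), of "e ` E"]) auto
  then show ?thesis using assms(2,5) by simp
qed

locale simplex_product =
  fixes ns :: "nat list" and a :: "nat \<Rightarrow> nat \<Rightarrow> 'a::euclidean_space" and D :: "'a set"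
  assumes inj_e: "inj_on (\<lambda>(i,j). a i j - a i 0) {(i,j). i < length ns \<and> 1 \<le> j \<and> j \<le> ns!i}"
    and ind_e: "independent ((\<lambda>(i,j). a i j - a i 0) ` {(i,j). i < length ns \<and> 1 \<le> j \<and> j \<le> ns!i})"
    and D: "D = {(\<Sum>i<length ns. y i) | y. \<forall>i<length ns. y i \<in> convex hull (a i ` {0..ns!i})}"
begin

text \<open>Barycentric coordinates in all factors at once. They vanish outside
  \<open>labels ns\<close>, so that equality of points becomes equality of functions.\<close>

definition weights :: "(nat \<times> nat \<Rightarrow> real) set" where
  "weights = {l. (\<forall>p. 0 \<le> l p) \<and> (\<forall>p. p \<notin> labels ns \<longrightarrow> l p = 0) \<and>
     (\<forall>i<length ns. (\<Sum>j\<le>ns!i. l (i, j)) = 1)}"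

definition pt :: "(nat \<times> nat \<Rightarrow> real) \<Rightarrow> 'a" where
  "pt l = (\<Sum>i<length ns. \<Sum>j\<le>ns!i. l (i, j) *\<^sub>R a i j)"

definition cell :: "(nat \<times> nat) set \<Rightarrow> 'a set" where
  "cell T = pt ` {l \<in> weights. \<forall>p. l p \<noteq> 0 \<longrightarrow> p \<in> T}"

lemma weightsD:
  assumes "l \<in> weights"
  shows "0 \<le> l p" "p \<notin> labels ns \<Longrightarrow> l p = 0" "i < length ns \<Longrightarrow> (\<Sum>j\<le>ns!i. l (i, j)) = 1"
  using assms unfolding weights_def by blast+

lemma pt_combination: "pt (\<lambda>p. s * l p + t * m p) = s *\<^sub>R pt l + t *\<^sub>R pt m"
  by (simp add: pt_def scaleR_add_left sum.distrib scaleR_sum_right)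

lemma weights_combination:
  assumes "l \<in> weights" "m \<in> weights" "s + t = 1" "\<And>p. p \<in> labels ns \<Longrightarrow> 0 \<le> s * l p + t * m p"
  shows "(\<lambda>p. s * l p + t * m p) \<in> weights"
proof -
  have "0 \<le> s * l p + t * m p" for p
    using assms(4)[of p] weightsD(2)[OF assms(1), of p] weightsD(2)[OF assms(2), of p]
    by (cases "p \<in> labels ns") auto
  moreover have "(\<Sum>j\<le>ns!i. s * l (i, j) + t * m (i, j)) = 1" if "i < length ns" for i
    using weightsD(3)[OF assms(1) that] weightsD(3)[OF assms(2) that] assms(3)
    by (simp add: sum.distrib sum_distrib_left[symmetric])
  ultimately show ?thesis using weightsD(2)[OF assms(1)] weightsD(2)[OF assms(2)]
    by (simp add: weights_def)
qed

text \<open>In each factor the coordinate differences sum to zero. Eliminating the one at vertex 0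
  leaves a linear relation between the independent edge directions.\<close>

lemma pt_inj:
  assumes l: "l \<in> weights" and m: "m \<in> weights" and eq: "pt l = pt m"
  shows "l = m"
proof
  fix p
  define d where "d p = l p - m p" for p
  let ?E = "SIGMA i:{..<length ns}. {1..ns!i}"
  let ?e = "\<lambda>(i,j). a i j - a i 0"
  have E: "{(i,j). i < length ns \<and> 1 \<le> j \<and> j \<le> ns!i} = ?E" by auto
  have split: "(\<Sum>j\<le>n. f j) = f 0 + (\<Sum>j=1..n. f j)" for f :: "nat \<Rightarrow> 'z::comm_monoid_add" and n
    using sum.atLeast_Suc_atMost[of 0 n f] by (simp add: atMost_atLeast0)
  have d0: "d (i, 0) = - (\<Sum>j=1..ns!i. d (i, j))" if "i < length ns" for i
  proof -
    have "(\<Sum>j\<le>ns!i. d (i, j)) = 0"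
      using weightsD(3)[OF l that] weightsD(3)[OF m that] by (simp add: d_def sum_subtractf)
    then show ?thesis unfolding split by (simp add: eq_neg_iff_add_eq_0)
  qed
  have "(\<Sum>p\<in>?E. d p *\<^sub>R ?e p) = (\<Sum>i<length ns. \<Sum>j=1..ns!i. d (i, j) *\<^sub>R (a i j - a i 0))"
    by (subst sum.Sigma) (auto simp: case_prod_unfold)
  also have "\<dots> = (\<Sum>i<length ns. \<Sum>j\<le>ns!i. d (i, j) *\<^sub>R a i j)"
  proof (rule sum.cong[OF refl])
    fix i assume "i \<in> {..<length ns}"
    then show "(\<Sum>j=1..ns!i. d (i, j) *\<^sub>R (a i j - a i 0)) = (\<Sum>j\<le>ns!i. d (i, j) *\<^sub>R a i j)"
      unfolding split using d0[of i]
      by (simp add: scaleR_diff_right sum_subtractf scaleR_sum_left[symmetric])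
  qed
  also have "\<dots> = pt l - pt m" by (simp add: pt_def d_def scaleR_diff_left sum_subtractf)
  finally have sum0: "(\<Sum>p\<in>?E. d p *\<^sub>R ?e p) = 0" using eq by simp
  have dE: "d p = 0" if "p \<in> ?E" for p
    using independent_family_zero[OF ind_e[unfolded E] inj_e[unfolded E] _ sum0 that] by simp
  have "d p = 0"
  proof (cases "p \<in> labels ns")
    case False
    then show ?thesis using weightsD(2)[OF l] weightsD(2)[OF m] by (simp add: d_def)
  next
    case True
    obtain i j where p: "p = (i, j)" by (cases p)
    then have i: "i < length ns" "j \<le> ns!i" using True by (auto simp: labels_def)
    show ?thesis
    proof (cases "j = 0")
      case True
      have "(\<Sum>j=1..ns!i. d (i, j)) = 0" using dE i by (intro sum.neutral) auto
      then show ?thesis using d0[OF i(1)] p True by simp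
    next
      case False
      then show ?thesis using dE[of p] p i by auto
    qed
  qed
  then show "l p = m p" by (simp add: d_def)
qed

lemma D_eq: "D = pt ` weights"
proof
  show "pt ` weights \<subseteq> D"
  proof
    fix x assume "x \<in> pt ` weights"
    then obtain l where l: "l \<in> weights" "x = pt l" by blast
    have "(\<Sum>j\<le>ns!i. l (i, j) *\<^sub>R a i j) \<in> convex hull (a i ` {0..ns!i})" if "i < length ns" for i
      by (rule convex_sum[OF _ convex_convex_hull])
         (use weightsD[OF l(1)] that in \<open>auto intro!: hull_inc\<close>)
    then show "x \<in> D" unfolding D l(2) pt_def by blast
  qed
  show "D \<subseteq> pt ` weights"
  proof
    fix x assume "x \<in> D"
    then obtain y where y: "x = (\<Sum>i<length ns. y i)"
      "\<And>i. i < length ns \<Longrightarrow> y i \<in> convex hull (a i ` {0..ns!i})" unfolding D by blast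
    have "\<exists>w. (\<forall>j. 0 \<le> w j) \<and> (\<Sum>j\<le>ns!i. w j) = 1 \<and> y i = (\<Sum>j\<le>ns!i. w j *\<^sub>R a i j)"
      if "i < length ns" for i
    proof -
      let ?C = "{\<Sum>j\<le>ns!i. w j *\<^sub>R a i j | w. (\<forall>j. 0 \<le> w j) \<and> (\<Sum>j\<le>ns!i. w j) = (1::real)}"
      have "convex ?C"
      proof (rule convexI)
        fix x y and s t :: real assume "x \<in> ?C" "y \<in> ?C" and st: "0 \<le> s" "0 \<le> t" "s + t = 1"
        then obtain v w where vw: "\<forall>j. 0 \<le> v j" "(\<Sum>j\<le>ns!i. v j) = 1" "x = (\<Sum>j\<le>ns!i. v j *\<^sub>R a i j)"
          "\<forall>j. 0 \<le> w j" "(\<Sum>j\<le>ns!i. w j) = 1" "y = (\<Sum>j\<le>ns!i. w j *\<^sub>R a i j)" by auto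
        have "s *\<^sub>R x + t *\<^sub>R y = (\<Sum>j\<le>ns!i. (s * v j + t * w j) *\<^sub>R a i j)"
          using vw by (simp add: scaleR_add_left sum.distrib scaleR_sum_right)
        moreover have "(\<Sum>j\<le>ns!i. s * v j + t * w j) = 1"
          using vw st by (simp add: sum.distrib sum_distrib_left[symmetric])
        moreover have "\<forall>j. 0 \<le> s * v j + t * w j" using vw st by simp
        ultimately show "s *\<^sub>R x + t *\<^sub>R y \<in> ?C"
          by (intro CollectI exI[of _ "\<lambda>j. s * v j + t * w j"]) simp
      qed
      moreover have "a i ` {0..ns!i} \<subseteq> ?C"
      proof
        fix z assume "z \<in> a i ` {0..ns!i}"
        then obtain j where j: "j \<le> ns!i" "z = a i j" by auto
        have "z = (\<Sum>k\<le>ns!i. (if k = j then 1 else 0) *\<^sub>R a i k)"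
          using j by (simp add: if_distrib[of "\<lambda>c. c *\<^sub>R _"] cong: if_cong)
        moreover have "(\<Sum>k\<le>ns!i. if k = j then 1 else 0 :: real) = 1" using j by simp
        ultimately show "z \<in> ?C" by (intro CollectI exI[of _ "\<lambda>k. if k = j then 1 else 0"]) auto
      qed
      ultimately have "convex hull (a i ` {0..ns!i}) \<subseteq> ?C" by (rule hull_minimal[rotated])
      then show ?thesis using y(2)[OF that] by blast
    qed
    then obtain w where w: "\<And>i. i < length ns \<Longrightarrow> (\<forall>j. 0 \<le> w i j) \<and> (\<Sum>j\<le>ns!i. w i j) = 1 \<and>
        y i = (\<Sum>j\<le>ns!i. w i j *\<^sub>R a i j)" by metis
    define l where "l p = (if p \<in> labels ns then w (fst p) (snd p) else 0)" for p
    have lw: "l (i, j) = w i j" if "i < length ns" "j \<le> ns!i" for i j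
      using that by (simp add: l_def labels_def)
    have "l \<in> weights"
      unfolding weights_def
    proof (intro CollectI conjI allI impI)
      show "0 \<le> l p" for p using w by (auto simp: l_def labels_def)
      show "l p = 0" if "p \<notin> labels ns" for p using that by (simp add: l_def)
      show "(\<Sum>j\<le>ns!i. l (i, j)) = 1" if "i < length ns" for i
        using w[OF that] lw[OF that] by simp
    qed
    moreover have "x = pt l" unfolding y(1) pt_def using w lw by (intro sum.cong) auto
    ultimately show "x \<in> pt ` weights" by blast
  qed
qed

lemma polytope_D: "polytope D"
proof -
  have "D = {\<Sum>i\<in>{..<length ns}. y i | y. \<forall>i\<in>{..<length ns}. y i \<in> convex hull (a i ` {0..ns!i})}"
    unfolding D by (simp add: Ball_def)
  then show ?thesis using polytope_set_sum_convex_hulls[of "{..<length ns}" "\<lambda>i. a i ` {0..ns!i}"] by simp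
qed

lemma pt_in_cell_iff:
  assumes "l \<in> weights"
  shows "pt l \<in> cell T \<longleftrightarrow> (\<forall>p. l p \<noteq> 0 \<longrightarrow> p \<in> T)"
  using assms pt_inj unfolding cell_def by blast

text \<open>Coordinates are nonnegative, so those of an inner point of a segment vanish only where
  those of both endpoints do.\<close>

lemma cell_face_of: "cell T face_of D"
  unfolding face_of_def
proof (intro conjI ballI impI)
  show "cell T \<subseteq> D" unfolding cell_def D_eq by blast
  show "convex (cell T)"
  proof (rule convexI)
    fix x y and s t :: real assume xy: "x \<in> cell T" "y \<in> cell T" and st: "0 \<le> s" "0 \<le> t" "s + t = 1"
    then obtain l m where lm: "l \<in> weights" "\<forall>p. l p \<noteq> 0 \<longrightarrow> p \<in> T" "x = pt l"
      "m \<in> weights" "\<forall>p. m p \<noteq> 0 \<longrightarrow> p \<in> T" "y = pt m" by (auto simp: cell_def)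
    have k: "(\<lambda>p. s * l p + t * m p) \<in> weights"
      using lm st weightsD(1) by (intro weights_combination) auto
    have "s * l p + t * m p = 0" if "p \<notin> T" for p
    proof -
      have "l p = 0" "m p = 0" using lm(2,5) that by blast+
      then show ?thesis by simp
    qed
    then have "pt (\<lambda>p. s * l p + t * m p) \<in> cell T" unfolding pt_in_cell_iff[OF k] by blast
    then show "s *\<^sub>R x + t *\<^sub>R y \<in> cell T" unfolding pt_combination lm(3,6) .
  qed
next
  fix x y z assume "x \<in> D" "y \<in> D" and z: "z \<in> cell T" "z \<in> open_segment x y"
  then obtain l m where lm: "l \<in> weights" "x = pt l" "m \<in> weights" "y = pt m" by (auto simp: D_eq)
  obtain t where t: "0 < t" "t < 1" "z = (1 - t) *\<^sub>R x + t *\<^sub>R y" using z(2) by (auto simp: in_segment)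
  let ?k = "\<lambda>p. (1 - t) * l p + t * m p"
  have k: "?k \<in> weights" using lm t weightsD(1) by (intro weights_combination) auto
  have "z = pt ?k" using t lm by (simp add: pt_combination)
  then have supp: "\<And>p. ?k p \<noteq> 0 \<Longrightarrow> p \<in> T" using z(1) pt_in_cell_iff[OF k] by blast
  have "l p = 0 \<and> m p = 0" if "p \<notin> T" for p
  proof -
    have "(1 - t) * l p \<ge> 0" "t * m p \<ge> 0" using weightsD(1)[OF lm(1)] weightsD(1)[OF lm(3)] t by auto
    moreover have "(1 - t) * l p + t * m p = 0" using supp that by blast
    ultimately have "(1 - t) * l p = 0" "t * m p = 0" by linarith+
    then show ?thesis using t by simp
  qed
  then show "x \<in> cell T" "y \<in> cell T" using pt_in_cell_iff lm by blast+
qed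

text \<open>The labels are the support of a point \<open>x\<close> in the relative interior of
  \<open>F\<close>.\<close>

lemma face_is_cell:
  assumes F: "F face_of D" "F \<noteq> {}"
  shows "\<exists>T\<in>cells ns. F = cell T"
proof -
  have cF: "convex F" using F(1) by (rule face_of_imp_convex)
  have FD: "F \<subseteq> D" using F(1) by (rule face_of_imp_subset)
  obtain x where x: "x \<in> rel_interior F" using rel_interior_eq_empty[OF cF] F(2) by blast
  then have xF: "x \<in> F" using rel_interior_subset by blast
  then obtain m where m: "m \<in> weights" "x = pt m" using FD D_eq by blast
  let ?T = "{p. m p \<noteq> 0}"
  have "?T \<in> cells ns"
  proof -
    have sub: "?T \<subseteq> labels ns" using weightsD(2)[OF m(1)] by blast
    moreover have "fst ` ?T = {..<length ns}"
    proof
      show "fst ` ?T \<subseteq> {..<length ns}" using sub by (auto simp: labels_def)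
      show "{..<length ns} \<subseteq> fst ` ?T"
      proof
        fix i assume "i \<in> {..<length ns}"
        then have "(\<Sum>j\<le>ns!i. m (i, j)) \<noteq> 0" using weightsD(3)[OF m(1)] by simp
        then obtain j where "m (i, j) \<noteq> 0" by (meson sum.neutral)
        then show "i \<in> fst ` ?T" by force
      qed
    qed
    ultimately show ?thesis by (simp add: cells_def)
  qed
  moreover have "F = cell ?T"
  proof
    show "F \<subseteq> cell ?T"
    proof
      fix z assume z: "z \<in> F"
      then obtain l where l: "l \<in> weights" "z = pt l" using FD D_eq by blast
      \<comment> \<open>Prolonging the segment from \<open>z\<close> through \<open>x\<close> inside
        \<open>F\<close> exhibits \<open>x\<close> as a convex combination in which \<open>z\<close>
        has positive weight; hence the support of \<open>z\<close> is contained in that of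
        \<open>x\<close>.\<close>
      obtain e where e: "e > 1" "(1 - e) *\<^sub>R z + e *\<^sub>R x \<in> F"
        using x z convex_rel_interior_iff[OF cF F(2)] by blast
      then obtain w where w: "w \<in> weights" "(1 - e) *\<^sub>R z + e *\<^sub>R x = pt w" using FD D_eq by blast
      let ?k = "\<lambda>p. (1 / e) * w p + (1 - 1 / e) * l p"
      have k: "?k \<in> weights"
        using w l e weightsD(1) by (intro weights_combination) auto
      have "pt ?k = (1 / e) *\<^sub>R ((1 - e) *\<^sub>R z + e *\<^sub>R x) + (1 - 1 / e) *\<^sub>R z"
        by (simp only: pt_combination w(2) l(2)[symmetric])
      also have "\<dots> = ((1 - e) / e + (1 - 1 / e)) *\<^sub>R z + x"
        using e by (simp add: scaleR_add_right scaleR_add_left)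
      also have "(1 - e) / e + (1 - 1 / e) = 0" using e by (simp add: field_simps)
      finally have "?k = m" using pt_inj[OF k m(1)] m(2) by simp
      then have mk: "m p = (1 / e) * w p + (1 - 1 / e) * l p" for p by metis
      have "p \<in> ?T" if "l p \<noteq> 0" for p
      proof -
        have "(1 - 1 / e) * l p > 0" "(1 / e) * w p \<ge> 0"
          using that weightsD(1)[OF l(1), of p] weightsD(1)[OF w(1), of p] e by auto
        then show ?thesis using mk[of p] by simp
      qed
      then show "z \<in> cell ?T" using pt_in_cell_iff[OF l(1)] l(2) by simp
    qed
    show "cell ?T \<subseteq> F"
    proof
      fix z assume "z \<in> cell ?T"
      then obtain l where l: "l \<in> weights" "z = pt l" "\<And>p. l p \<noteq> 0 \<Longrightarrow> m p \<noteq> 0" by (auto simp: cell_def)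
      have "\<forall>\<^sub>F e in at_right (0::real). \<forall>p\<in>labels ns. 0 \<le> (1 + e) * m p + (- e) * l p"
      proof (rule eventually_ball_finite[OF finite_labels], rule ballI)
        fix p
        show "\<forall>\<^sub>F e in at_right (0::real). 0 \<le> (1 + e) * m p + (- e) * l p"
        proof (cases "m p = 0")
          case True
          then have "l p = 0" using l(3)[of p] by blast
          then show ?thesis using True by simp
        next
          case False
          then have "0 < (1 + 0) * m p + (- 0) * l p" using weightsD(1)[OF m(1), of p] by simp
          moreover have "((\<lambda>e. (1 + e) * m p + (- e) * l p) \<longlongrightarrow> (1 + 0) * m p + (- 0) * l p) (at_right 0)"
            by (intro tendsto_intros)
          ultimately have "\<forall>\<^sub>F e in at_right 0. 0 < (1 + e) * m p + (- e) * l p"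
            by (rule order_tendstoD(1)[rotated])
          then show ?thesis by (rule eventually_mono) simp
        qed
      qed
      then have "\<forall>\<^sub>F e in at_right (0::real). e > 0 \<and> (\<forall>p\<in>labels ns. 0 \<le> (1 + e) * m p + (- e) * l p)"
        using eventually_at_right_less by (rule eventually_conj[rotated])
      then obtain e where e: "e > 0" "\<forall>p\<in>labels ns. 0 \<le> (1 + e) * m p + (- e) * l p"
        using eventually_happens[of _ "at_right (0::real)"] trivial_limit_at_right_real by blast
      \<comment> \<open>Here the segment from \<open>z\<close> through \<open>x\<close> is prolonged
        inside \<open>D\<close>, which is possible because \<open>m\<close> is positive on the
        support of \<open>l\<close>. Then \<open>x\<close> lies between \<open>z\<close> and another
        point of \<open>D\<close>, and the face property puts \<open>z\<close> into
        \<open>F\<close>.\<close>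
      let ?k = "\<lambda>p. (1 + e) * m p + (- e) * l p"
      have "?k \<in> weights" using m l e by (intro weights_combination) auto
      then have kD: "pt ?k \<in> D" using D_eq by blast
      have zD: "z \<in> D" using l D_eq by blast
      have k: "pt ?k = (1 + e) *\<^sub>R x + (- e) *\<^sub>R z" unfolding pt_combination m(2) l(2) ..
      have x_eq: "x = (1 - 1 / (1 + e)) *\<^sub>R z + (1 / (1 + e)) *\<^sub>R pt ?k"
      proof -
        define \<alpha> where "\<alpha> = 1 / (1 + e)"
        have \<alpha>: "\<alpha> * (1 + e) = 1" using e(1) by (simp add: \<alpha>_def)
        have "(1 - \<alpha>) *\<^sub>R z + \<alpha> *\<^sub>R pt ?k = (1 - \<alpha> * (1 + e)) *\<^sub>R z + (\<alpha> * (1 + e)) *\<^sub>R x"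
          unfolding k by (simp add: algebra_simps)
        then show ?thesis using \<alpha> by (simp add: \<alpha>_def)
      qed
      show "z \<in> F"
      proof (cases "z = pt ?k")
        case True
        then have "x = z" using x_eq by (metis add_diff_cancel_right' diff_add_cancel scaleR_left_distrib scaleR_one)
        then show ?thesis using xF by simp
      next
        case False
        then have "x \<in> open_segment z (pt ?k)"
          using x_eq e by (auto simp: in_segment intro!: exI[of _ "1 / (1 + e)"])
        then show ?thesis using face_ofD[OF F(1) _ zD kD xF] by blast
      qed
    qed
  qed
  ultimately show ?thesis by blast
qed

text \<open>Equal weights within each factor. As the support is all of \<open>T\<close>, this one
  point tests whether \<open>cell T\<close> is contained in another cell.\<close>

lemma cell_barycenter:
  assumes T: "T \<in> cells ns"
  obtains l where "l \<in> weights" "\<And>p. l p \<noteq> 0 \<longleftrightarrow> p \<in> T"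
proof -
  define l :: "nat \<times> nat \<Rightarrow> real" where
    "l p = (if p \<in> T then 1 / card {j. (fst p, j) \<in> T} else 0)" for p
  have sub: "{j. (i, j) \<in> T} \<subseteq> {..ns!i}" for i using cellD(1)[OF T] by (auto simp: labels_def)
  then have fin: "finite {j. (i, j) \<in> T}" for i using finite_subset by blast
  have pos: "card {j. (i, j) \<in> T} > 0" if "i < length ns" for i
  proof -
    have "i \<in> fst ` T" using cellD(3)[OF T] that by simp
    then have "{j. (i, j) \<in> T} \<noteq> {}" by force
    then show ?thesis using fin by (simp add: card_gt_0_iff)
  qed
  have "l \<in> weights"
    unfolding weights_def
  proof (intro CollectI conjI allI impI)
    show "0 \<le> l p" for p by (simp add: l_def)
    show "l p = 0" if "p \<notin> labels ns" for p using that cellD(1)[OF T] by (auto simp: l_def)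
    fix i assume i: "i < length ns"
    have "(\<Sum>j\<le>ns!i. l (i, j)) = (\<Sum>j\<in>{j. (i, j) \<in> T}. l (i, j))"
      using sub by (intro sum.mono_neutral_right) (auto simp: l_def)
    also have "\<dots> = (\<Sum>j\<in>{j. (i, j) \<in> T}. 1 / card {j. (i, j) \<in> T})"
      by (intro sum.cong) (auto simp: l_def)
    also have "\<dots> = 1" using pos[OF i] by simp
    finally show "(\<Sum>j\<le>ns!i. l (i, j)) = 1" .
  qed
  moreover have "l p \<noteq> 0 \<longleftrightarrow> p \<in> T" for p
  proof -
    have "fst p < length ns" if "p \<in> T" using that cellD(1)[OF T] by (auto simp: labels_def)
    then show ?thesis using pos[of "fst p"] by (auto simp: l_def)
  qed
  ultimately show ?thesis using that by blast
qed

lemma product_faces_cell: "product_faces ns D cell"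
proof
  fix T assume T: "T \<in> cells ns"
  obtain l where l: "l \<in> weights" "\<And>p. l p \<noteq> 0 \<longleftrightarrow> p \<in> T" using cell_barycenter[OF T] by blast
  then have lT: "pt l \<in> cell T" using pt_in_cell_iff by blast
  then show "cell T \<noteq> {}" by blast
  fix U
  show "cell T \<subseteq> cell U \<longleftrightarrow> T \<subseteq> U"
  proof
    assume "cell T \<subseteq> cell U"
    then have "pt l \<in> cell U" using lT by blast
    then show "T \<subseteq> U" using pt_in_cell_iff[OF l(1)] l(2) by blast
  qed (auto simp: cell_def)
qed (use polytope_D cell_face_of face_is_cell in auto)

end

section \<open>Linear projections\<close>

text \<open>The direction \<open>y - x\<close> lies in the kernel, so its orthogonal complement in
  the direction space of \<open>S\<close> already has the full image.\<close>

lemma aff_dim_linear_image_less: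
  fixes g :: "'b::euclidean_space \<Rightarrow> 'a::euclidean_space"
  assumes g: "linear g" and xy: "x \<in> S" "y \<in> S" "x \<noteq> y" "g x = g y"
  shows "aff_dim (g ` S) < aff_dim S"
proof -
  let ?M = "(\<lambda>z. z - x) ` S" and ?v = "y - x"
  let ?C = "{w \<in> span ?M. \<forall>u\<in>span {?v}. orthogonal u w}"
  have v: "?v \<in> span ?M" using xy(2) by (intro span_base) auto
  have gv: "g ?v = 0" using xy(4) by (simp add: linear_diff[OF g])
  have "dim ?C + dim (span {?v}) = dim (span ?M)"
  proof (rule dim_subspace_orthogonal_to_vectors)
    show "span {?v} \<subseteq> span ?M" by (rule span_minimal) (use v in auto)
  qed auto
  moreover have "dim (span {?v}) = 1" using xy(3) by (simp add: dim_span)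
  ultimately have dC: "dim ?C + 1 = dim ?M" by (simp add: dim_span)
  have "g ` ?M \<subseteq> g ` ?C"
  proof
    fix u assume "u \<in> g ` ?M"
    then obtain m where m: "m \<in> span ?M" "u = g m" by (auto intro: span_base)
    define w where "w = m - ((?v \<bullet> m) / (?v \<bullet> ?v)) *\<^sub>R ?v"
    have vv: "?v \<bullet> ?v \<noteq> 0" using xy(3) by simp
    have "w \<in> span ?M" using m v by (auto simp: w_def intro: span_diff span_scale)
    moreover have "?v \<bullet> w = 0"
      unfolding w_def inner_diff_right[of ?v m] inner_scaleR_right using vv by (simp del: inner_eq_zero_iff)
    then have "\<forall>u\<in>span {?v}. orthogonal u w" by (auto simp: span_singleton orthogonal_def)
    moreover have "g w = u" using gv m by (simp add: w_def linear_diff[OF g] linear_scale[OF g])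
    ultimately show "u \<in> g ` ?C" by blast
  qed
  then have "dim (g ` ?M) \<le> dim (g ` ?C)" by (rule dim_subset)
  also have "\<dots> \<le> dim ?C" by (rule dim_image_le[OF g])
  finally have "dim (g ` ?M) < dim ?M" using dC by simp
  moreover have "g ` ?M = (\<lambda>z. z - g x) ` (g ` S)" by (simp add: image_image linear_diff[OF g])
  ultimately show ?thesis
    using aff_dim_eq_dim_subtract[of x S] aff_dim_eq_dim_subtract[of "g x" "g ` S"] xy(1)
    by (simp add: hull_inc)
qed

lemma face_of_linear_preimage:
  fixes g :: "'b::euclidean_space \<Rightarrow> 'a::euclidean_space"
  assumes "linear g" "g ` Q = P" "convex Q" "F face_of P"
  shows "{x \<in> Q. g x \<in> F} face_of Q"
  unfolding face_of_def
proof (intro conjI ballI impI)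
  have "{x \<in> Q. g x \<in> F} = Q \<inter> g -` F" by auto
  then show "convex {x \<in> Q. g x \<in> F}"
    using assms convex_linear_vimage[of g F] face_of_imp_convex[of F P] by (simp add: convex_Int)
  fix a b x assume ab: "a \<in> Q" "b \<in> Q" and x: "x \<in> {x \<in> Q. g x \<in> F}" "x \<in> open_segment a b"
  obtain t where t: "0 < t" "t < 1" "x = (1 - t) *\<^sub>R a + t *\<^sub>R b" using x(2) by (auto simp: in_segment)
  have gx: "g x = (1 - t) *\<^sub>R g a + t *\<^sub>R g b"
    using t(3) by (simp add: linear_add[OF assms(1)] linear_scale[OF assms(1)])
  have "g a \<in> F \<and> g b \<in> F"
  proof (cases "g a = g b")
    \<comment> \<open>The open segment between equal points is empty, so the face property of
      \<open>F\<close> says nothing here.\<close>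
    case True
    then have "g x = g a" using gx by (simp add: scaleR_left_distrib[symmetric])
    then show ?thesis using x(1) True by simp
  next
    case False
    then have "g x \<in> open_segment (g a) (g b)" using gx t by (auto simp: in_segment)
    then show ?thesis using face_ofD[OF assms(4)] ab x(1) assms(2) by blast
  qed
  then show "a \<in> {x \<in> Q. g x \<in> F}" "b \<in> {x \<in> Q. g x \<in> F}" using ab by auto
qed auto

lemma poset_iso_obtain_sym:
  assumes "poset_iso A B"
  obtains h where "bij_betw h B A" "\<And>F G. F \<in> B \<Longrightarrow> G \<in> B \<Longrightarrow> F \<subseteq> G \<longleftrightarrow> h F \<subseteq> h G"
proof -
  obtain f where f: "bij_betw f A B" "\<forall>F\<in>A. \<forall>G\<in>A. F \<subseteq> G \<longleftrightarrow> f F \<subseteq> f G"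
    using assms unfolding poset_iso_def by blast
  let ?h = "inv_into A f"
  have h: "?h F \<in> A" "f (?h F) = F" if "F \<in> B" for F
    using that f(1) by (auto simp: bij_betw_def inv_into_into f_inv_into_f)
  have "F \<subseteq> G \<longleftrightarrow> ?h F \<subseteq> ?h G" if "F \<in> B" "G \<in> B" for F G
    using f(2)[rule_format, OF h(1)[OF that(1)] h(1)[OF that(2)]]
    unfolding h(2)[OF that(1)] h(2)[OF that(2)] by simp
  then show ?thesis using that bij_betw_inv_into[OF f(1)] by blast
qed

text \<open>\<open>Q\<close> has no product coordinates of its own; all later arguments about it use
  only the cell labels carried over from \<open>D\<close>. The empty face, which has no label, is
  mapped to the empty face.\<close>

lemma product_faces_transfer:
  fixes D :: "'c::euclidean_space set" and Q :: "'b::euclidean_space set"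
  assumes D: "product_faces ns D G" and Q: "polytope Q" "comb_equiv Q D"
  obtains G' where "product_faces ns Q G'"
proof -
  interpret product_faces ns D G by (rule D)
  obtain h where h: "bij_betw h {F. F face_of D} {F. F face_of Q}"
    "\<And>F G. F \<in> {F. F face_of D} \<Longrightarrow> G \<in> {F. F face_of D} \<Longrightarrow> F \<subseteq> G \<longleftrightarrow> h F \<subseteq> h G"
    using poset_iso_obtain_sym Q(2) unfolding comb_equiv_def by blast
  have hf: "h F face_of Q" if "F face_of D" for F using h(1) that by (auto simp: bij_betw_def)
  have hsurj: "\<exists>F. F face_of D \<and> h F = E" if "E face_of Q" for E
  proof -
    have "E \<in> h ` {F. F face_of D}" using h(1) that by (simp add: bij_betw_def)
    then show ?thesis by blast
  qed
  have h0: "h {} = {}"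
  proof -
    obtain F where F: "F face_of D" "h F = {}" using hsurj[of "{}"] by auto
    then show ?thesis using h(2)[of "{}" F] by auto
  qed
  have hne: "h F \<noteq> {}" if "F face_of D" "F \<noteq> {}" for F
    using h(2)[of F "{}"] that h0 by auto
  have "product_faces ns Q (h \<circ> G)"
  proof
    show "polytope Q" by fact
    show "(h \<circ> G) T face_of Q" "(h \<circ> G) T \<noteq> {}" if "T \<in> cells ns" for T
      using hf hne face that by auto
    show "(h \<circ> G) T \<subseteq> (h \<circ> G) U \<longleftrightarrow> T \<subseteq> U" if "T \<in> cells ns" "U \<in> cells ns" for T U
      using h(2)[of "G T" "G U"] order face that by simp
    show "\<exists>T\<in>cells ns. F = (h \<circ> G) T" if F: "F face_of Q" "F \<noteq> {}" for F
    proof -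
      obtain E where E: "E face_of D" "h E = F" using hsurj F(1) by blast
      then have "E \<noteq> {}" using F(2) h0 by auto
      then show ?thesis using surj[OF E(1)] E(2) by auto
    qed
  qed
  then show ?thesis using that by blast
qed

section \<open>Faces strictly preserved by the projection\<close>

lemma skeleton_subset_faces: "skeleton k X \<subseteq> {F. F face_of X}"
  by (auto simp: skeleton_def)

lemma skeleton_downward_closed:
  assumes "F \<in> skeleton k X" "G face_of F"
  shows "G \<in> skeleton k X"
proof -
  have "aff_dim G \<le> aff_dim F" using assms(2) by (intro aff_dim_subset face_of_imp_subset)
  then show ?thesis using assms face_of_trans unfolding skeleton_def by fastforce
qed

text \<open>Every cell of dimension at most \<open>k\<close> of \<open>Q\<close> is the full preimage of a face of \<open>P\<close> of the same dimension.\<close>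

lemma strictly_preserved:
  fixes D :: "'c::euclidean_space set" and Q :: "'b::euclidean_space set" and P :: "'a::euclidean_space set"
  assumes D: "product_faces ns D C" and Q: "product_faces ns Q G"
    and P: "polytope P" "skel_equiv k P D" and g: "linear g" "g ` Q = P"
    and U: "U \<in> cells ns" "card U \<le> length ns + k"
    and xy: "x \<in> G U" "y \<in> Q" "g x = g y"
  shows "x = y"
proof -
  interpret D: product_faces ns D C by (rule D)
  interpret Q: product_faces ns Q G by (rule Q)
  let ?r = "length ns"
  let ?K = "\<lambda>T. T \<in> cells ns \<and> card T \<le> ?r + k"
  obtain h where h: "bij_betw h (skeleton (int k) D) (skeleton (int k) P)"
    "\<And>F G. F \<in> skeleton (int k) D \<Longrightarrow> G \<in> skeleton (int k) D \<Longrightarrow> F \<subseteq> G \<longleftrightarrow> h F \<subseteq> h G"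
    using poset_iso_obtain_sym P(2) unfolding skel_equiv_def by blast
  have CK: "C T \<in> skeleton (int k) D" if "?K T" for T
    using that D.face D.aff_dim_cell by (simp add: skeleton_def)
  define H where "H T = h (C T)" for T
  have HK: "H T \<in> skeleton (int k) P" if "?K T" for T
    using CK[OF that] h(1) by (auto simp: H_def bij_betw_def)
  then have Hf: "H T face_of P" if "?K T" for T using that skeleton_subset_faces by blast
  have Hdim: "aff_dim (H T) = int (card T) - int ?r" if "?K T" for T
  proof -
    have "aff_dim (H T) = aff_dim (C T)"
      unfolding H_def
      by (rule poset_iso_aff_dim[OF D.poly skeleton_subset_faces skeleton_downward_closed P(1)
            skeleton_subset_faces skeleton_downward_closed h CK[OF that]])
    then show ?thesis using D.aff_dim_cell that by simp
  qed
  have Hord: "H T \<subseteq> H T' \<longleftrightarrow> T \<subseteq> T'" if "?K T" "?K T'" for T T'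
    using h(2)[OF CK[OF that(1)] CK[OF that(2)]] D.order that by (simp add: H_def)
  have Hne: "H T \<noteq> {}" if "?K T" for T
    using Hdim[OF that] cellD(4)[of T ns] that by auto
  \<comment> \<open>The preimage of a face of \<open>P\<close> is a face of \<open>Q\<close>, hence
    a cell; \<open>\<theta> T\<close> will be its label set. Its dimension is at least that of the
    face, but equality is not clear yet.\<close>
  define hat where "hat F = {x \<in> Q. g x \<in> F}" for F
  have hat_face: "hat F face_of Q" if "F face_of P" for F
    unfolding hat_def by (rule face_of_linear_preimage[OF g polytope_imp_convex[OF Q.poly] that])
  have hat_image: "g ` hat F = F" if "F face_of P" for F
    using face_of_imp_subset[OF that] g(2) by (auto simp: hat_def)
  have hat_ord: "hat F \<subseteq> hat F' \<longleftrightarrow> F \<subseteq> F'" if "F face_of P" "F' face_of P" for F F'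
    using hat_image[OF that(1)] hat_image[OF that(2)] by (auto simp: hat_def)
  have "\<exists>V. V \<in> cells ns \<and> hat (H T) = G V" if "?K T" for T
  proof -
    have "hat (H T) \<noteq> {}" using hat_image[OF Hf[OF that]] Hne[OF that] by blast
    then show ?thesis using Q.surj[OF hat_face[OF Hf[OF that]]] by blast
  qed
  then obtain \<theta> where \<theta>: "\<And>T. ?K T \<Longrightarrow> \<theta> T \<in> cells ns \<and> hat (H T) = G (\<theta> T)" by metis
  have \<theta>_le: "card T \<le> card (\<theta> T)" if "?K T" for T
  proof -
    have "aff_dim (H T) \<le> aff_dim (hat (H T))"
      using aff_dim_linear_image_le[OF g(1), of "hat (H T)"] hat_image[OF Hf[OF that]] by simp
    then show ?thesis using Hdim[OF that] \<theta>[OF that] Q.aff_dim_cell[of "\<theta> T"] by simp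
  qed
  have \<theta>_ord: "\<theta> T \<subseteq> \<theta> T' \<longleftrightarrow> T \<subseteq> T'" if "?K T" "?K T'" for T T'
    using Q.order[of "\<theta> T" "\<theta> T'"] \<theta>[OF that(1)] \<theta>[OF that(2)] hat_ord[OF Hf[OF that(1)] Hf[OF that(2)]]
      Hord[OF that] by simp
  \<comment> \<open>Distinct vertices of \<open>P\<close> have disjoint preimages.\<close>
  have \<theta>_disj: "S = S'" if S: "S \<in> cells ns" "card S = ?r" "S' \<in> cells ns" "card S' = ?r"
    and V: "V \<in> cells ns" "V \<subseteq> \<theta> S" "V \<subseteq> \<theta> S'" for S S' V
  proof -
    have K: "?K S" "?K S'" using S by auto
    have "G V \<subseteq> hat (H S)" "G V \<subseteq> hat (H S')"
      using V Q.order \<theta>[OF K(1)] \<theta>[OF K(2)] by auto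
    then obtain z where "z \<in> H S" "z \<in> H S'" using Q.face(2)[OF V(1)] by (auto simp: hat_def)
    moreover obtain a where "H S = {a}" using Hdim[OF K(1)] S aff_dim_eq_0[of "H S"] by auto
    moreover obtain b where "H S' = {b}" using Hdim[OF K(2)] S aff_dim_eq_0[of "H S'"] by auto
    ultimately have "H S = H S'" by auto
    then show ?thesis using Hord[OF K] Hord[OF K(2,1)] by auto
  qed
  have \<theta>_card: "card (\<theta> T) = card T" if "?K T" for T
    by (rule cell_embedding_card[of ns k \<theta>]) (use \<theta> \<theta>_le \<theta>_ord \<theta>_disj that in auto)
  \<comment> \<open>As \<open>\<theta>\<close> preserves cardinalities and is injective, it permutes
    the finitely many cells of each size. So \<open>U\<close> itself is a value of
    \<open>\<theta>\<close>, and \<open>G U\<close> is a full preimage.\<close>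
  let ?L = "{T \<in> cells ns. card T = card U}"
  have L: "?K T" if "T \<in> ?L" for T using that U(2) by auto
  have "inj_on \<theta> ?L"
  proof (rule inj_onI)
    fix T T' assume T: "T \<in> ?L" "T' \<in> ?L" "\<theta> T = \<theta> T'"
    then show "T = T'" using \<theta>_ord[OF L[OF T(1)] L[OF T(2)]] \<theta>_ord[OF L[OF T(2)] L[OF T(1)]] by auto
  qed
  moreover have "\<theta> ` ?L \<subseteq> ?L" using \<theta> \<theta>_card U(2) by auto
  moreover have "finite ?L" using finite_cells by simp
  ultimately have "\<theta> ` ?L = ?L" by (intro endo_inj_surj)
  then have "U \<in> \<theta> ` ?L" using U(1) by simp
  then obtain T where T: "T \<in> ?L" "U = \<theta> T" by blast
  have GU: "G U = hat (H T)" using \<theta>[OF L[OF T(1)]] T(2) by simp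
  have "g ` G U = H T" using GU hat_image[OF Hf[OF L[OF T(1)]]] by simp
  then have dim: "aff_dim (g ` G U) = aff_dim (G U)"
    using Hdim[OF L[OF T(1)]] Q.aff_dim_cell[OF U(1)] T(1) by simp
  \<comment> \<open>A full preimage contains \<open>y\<close> along with \<open>x\<close>; two such
    points with equal image would make the dimension drop.\<close>
  have "y \<in> G U" using xy unfolding GU hat_def by auto
  then show ?thesis using aff_dim_linear_image_less[OF g(1) xy(1) _ _ xy(3)] dim by force
qed

section \<open>Kernel dimension and facet inequalities\<close>

lemma dim_le_kernel_image:
  fixes g :: "'b::euclidean_space \<Rightarrow> 'a::euclidean_space"
  assumes g: "linear g" and L: "subspace L"
  shows "dim L \<le> dim {y \<in> L. g y = 0} + dim (g ` L)"
proof -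
  let ?W = "{y \<in> L. g y = 0}"
  let ?C = "{y \<in> L. \<forall>x\<in>?W. orthogonal x y}"
  have W: "subspace ?W"
    using L by (auto simp: subspace_def linear_0[OF g] linear_add[OF g] linear_scale[OF g])
  have C: "subspace ?C"
    using L by (auto simp: subspace_def orthogonal_clauses)
  have "dim ?C + dim ?W = dim L" by (rule dim_subspace_orthogonal_to_vectors[OF W L]) auto
  moreover have "inj_on g ?C"
    unfolding linear_injective_on_subspace_0[OF g C] by (auto simp: orthogonal_self)
  then have "dim (g ` ?C) = dim ?C"
    using C by (intro dim_image_eq[OF g]) (simp add: span_eq_iff[THEN iffD2])
  moreover have "dim (g ` ?C) \<le> dim (g ` L)" by (intro dim_subset) auto
  ultimately show ?thesis by linarith
qed

text \<open>Injectivity comes from minimality of the halfspaces: without \<open>h'\<close> some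
  point \<open>z\<close> violates only \<open>h'\<close>, and the segment from a relative interior
  point to \<open>z\<close> leaves \<open>Q\<close> in a point that is tight for \<open>h'\<close>
  and for no other halfspace.\<close>

lemma polyhedron_facet_halfspaces:
  fixes Q :: "'b::euclidean_space set"
  assumes "polyhedron Q" "Q \<noteq> {}"
  obtains \<F> a b where "finite \<F>" "Q = affine hull Q \<inter> \<Inter>\<F>"
    "\<And>h. h \<in> \<F> \<Longrightarrow> h = {x. a h \<bullet> x \<le> b h}"
    "\<And>C. C facet_of Q \<longleftrightarrow> (\<exists>h. h \<in> \<F> \<and> C = Q \<inter> {x. a h \<bullet> x = b h})"
    "inj_on (\<lambda>h. Q \<inter> {x. a h \<bullet> x = b h}) \<F>"
proof -
  obtain \<F> where \<F>: "finite \<F>" "Q = affine hull Q \<inter> \<Inter>\<F>"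
    "\<forall>h\<in>\<F>. \<exists>a b. a \<noteq> 0 \<and> h = {x. a \<bullet> x \<le> b}"
    "\<forall>F'. F' \<subset> \<F> \<longrightarrow> Q \<subset> affine hull Q \<inter> \<Inter>F'"
    using assms(1) unfolding polyhedron_Int_affine_minimal by blast
  then obtain a b where ab: "\<And>h. h \<in> \<F> \<Longrightarrow> a h \<noteq> 0 \<and> h = {x. a h \<bullet> x \<le> b h}" by metis
  have facets: "C facet_of Q \<longleftrightarrow> (\<exists>h. h \<in> \<F> \<and> C = Q \<inter> {x. a h \<bullet> x = b h})" for C
    by (rule facet_of_polyhedron_explicit[OF \<F>(1,2) ab]) (use \<F>(4) in auto)
  have cQ: "convex Q" using assms(1) by (rule polyhedron_imp_convex)
  obtain w where w: "w \<in> rel_interior Q" using rel_interior_eq_empty[OF cQ] assms(2) by blast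
  have wQ: "w \<in> Q" using w rel_interior_subset by blast
  have mem: "x \<in> h \<longleftrightarrow> a h \<bullet> x \<le> b h" if "h \<in> \<F>" for h x using ab[OF that] by blast
  have strict: "a h \<bullet> w < b h" if "h \<in> \<F>" for h
  proof -
    let ?F = "Q \<inter> {x. a h \<bullet> x = b h}"
    have "?F facet_of Q" using facets that by blast
    then have "?F face_of Q" "?F \<noteq> Q" by (auto simp: facet_of_def)
    then have "w \<notin> ?F" using face_of_disjoint_rel_interior w by blast
    moreover have "a h \<bullet> w \<le> b h" using wQ \<F>(2) that mem by blast
    ultimately show ?thesis using wQ by auto
  qed
  have "inj_on (\<lambda>h. Q \<inter> {x. a h \<bullet> x = b h}) \<F>"
  proof (rule inj_onI, rule ccontr)
    fix h h' assume h: "h \<in> \<F>" "h' \<in> \<F>" "Q \<inter> {x. a h \<bullet> x = b h} = Q \<inter> {x. a h' \<bullet> x = b h'}" "h \<noteq> h'"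
    have "\<F> - {h'} \<subset> \<F>" using h(2) by blast
    then have "Q \<subset> affine hull Q \<inter> \<Inter>(\<F> - {h'})" using \<F>(4) by simp
    then obtain z where "z \<in> affine hull Q \<inter> \<Inter>(\<F> - {h'})" "z \<notin> Q" by (meson psubset_imp_ex_mem DiffE)
    then have z: "z \<in> affine hull Q" "\<And>f. f \<in> \<F> \<Longrightarrow> f \<noteq> h' \<Longrightarrow> z \<in> f" "z \<notin> Q" by auto
    have zh': "a h' \<bullet> z > b h'"
    proof (rule ccontr)
      assume "\<not> a h' \<bullet> z > b h'"
      then have "z \<in> h'" using mem[OF h(2)] by simp
      then have "z \<in> \<Inter>\<F>" using z(2) by blast
      then show False using z(1,3) \<F>(2) by blast
    qed
    \<comment> \<open>The parameter at which the segment from \<open>w\<close> to \<open>z\<close>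
      meets the bounding hyperplane of \<open>h'\<close>.\<close>
    define t where "t = (b h' - a h' \<bullet> w) / (a h' \<bullet> z - a h' \<bullet> w)"
    have t: "0 < t" "t < 1" using strict[OF h(2)] zh' by (auto simp: t_def divide_simps)
    define x where "x = (1 - t) *\<^sub>R w + t *\<^sub>R z"
    have ax: "a f \<bullet> x = (1 - t) * (a f \<bullet> w) + t * (a f \<bullet> z)" for f
      by (simp add: x_def inner_add_right)
    have xlt: "a f \<bullet> x < b f" if "f \<in> \<F>" "f \<noteq> h'" for f
    proof -
      have "(1 - t) * (a f \<bullet> w) < (1 - t) * b f" using strict[OF that(1)] t by simp
      moreover have "t * (a f \<bullet> z) \<le> t * b f" using z(2)[OF that] mem[OF that(1)] t by simp
      ultimately show ?thesis unfolding ax by (simp add: algebra_simps)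
    qed
    have "a h' \<bullet> x = a h' \<bullet> w + t * (a h' \<bullet> z - a h' \<bullet> w)" unfolding ax by (simp add: algebra_simps)
    also have "\<dots> = b h'" using strict[OF h(2)] zh' by (simp add: t_def)
    finally have xh': "a h' \<bullet> x = b h'" .
    have "x \<in> affine hull Q"
      unfolding x_def by (rule mem_affine) (use wQ z(1) in \<open>auto intro: hull_inc\<close>)
    moreover have "x \<in> f" if "f \<in> \<F>" for f
      using xlt[OF that] xh' mem[OF that] by (cases "f = h'") auto
    ultimately have "x \<in> Q" using \<F>(2) by blast
    then have "a h \<bullet> x = b h" using xh' h(3) by blast
    then show False using xlt[OF h(1,4)] by simp
  qed
  then show ?thesis using that[OF \<F>(1,2) _ facets] ab by blast
qed

lemma labels_remove_in_cells:
  assumes "\<forall>i<length ns. ns ! i \<ge> 1"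
  shows "labels ns - {p} \<in> cells ns"
proof -
  have "\<exists>j\<le>ns ! i. (i, j) \<noteq> p" if "i < length ns" for i
  proof (cases "p = (i, 0)")
    case True
    then show ?thesis using assms that by (intro exI[of _ 1]) auto
  qed (auto intro: exI[of _ 0])
  then have "{..<length ns} \<subseteq> fst ` (labels ns - {p})" by (force simp: labels_def image_iff)
  then show ?thesis by (auto simp: cells_def labels_def)
qed

text \<open>The facets are the cells that lack exactly one label, and an irredundant description has
  one inequality per facet. So the inequalities can be indexed by labels, where \<open>p\<close>
  names the facet that omits \<open>p\<close>.\<close>

lemma (in product_faces) facet_normals:
  assumes n: "\<forall>i<length ns. ns ! i \<ge> 1"
  obtains A \<beta> where "\<And>p. p \<in> labels ns \<Longrightarrow> Q \<subseteq> {x. A p \<bullet> x \<le> \<beta> p}"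
    "\<And>p. p \<in> labels ns \<Longrightarrow> G (labels ns - {p}) = Q \<inter> {x. A p \<bullet> x = \<beta> p}"
    "Q = affine hull Q \<inter> {x. \<forall>p\<in>labels ns. A p \<bullet> x \<le> \<beta> p}"
proof -
  let ?V = "labels ns"
  have Vp: "?V - {p} \<in> cells ns" for p
    by (rule labels_remove_in_cells[OF n])
  have dimQ: "aff_dim Q = int (card ?V) - int (length ns)"
    using aff_dim_cell[OF labels_in_cells] G_labels by simp
  have facet: "G (?V - {p}) facet_of Q" if "p \<in> ?V" for p
  proof -
    have "card ?V = Suc (card (?V - {p}))" using card_Suc_Diff1[OF finite_labels that] by simp
    then have "aff_dim (G (?V - {p})) = aff_dim Q - 1" using aff_dim_cell[OF Vp] dimQ by simp
    then show ?thesis using face[OF Vp] by (simp add: facet_of_def)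
  qed
  have facetE: "\<exists>p\<in>?V. F = G (?V - {p})" if F: "F facet_of Q" for F
  proof -
    obtain T where T: "T \<in> cells ns" "F = G T" using surj F by (auto simp: facet_of_def)
    note TD = cellD[OF T(1)]
    have c: "card T + 1 = card ?V" using F aff_dim_cell[OF T(1)] dimQ T(2) by (simp add: facet_of_def)
    then have "T \<noteq> ?V" by auto
    then obtain p where p: "p \<in> ?V" "p \<notin> T" using TD(1) by blast
    have "T = ?V - {p}"
      using p TD(1) c finite_labels[of ns] by (intro card_subset_eq) auto
    then show ?thesis using p T(2) by blast
  qed
  have "Q \<noteq> {}" using face[OF labels_in_cells] G_labels by simp
  then obtain \<F> a b where \<F>: "finite \<F>" "Q = affine hull Q \<inter> \<Inter>\<F>"
    "\<And>h. h \<in> \<F> \<Longrightarrow> h = {x. a h \<bullet> x \<le> b h}"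
    "\<And>C. C facet_of Q \<longleftrightarrow> (\<exists>h. h \<in> \<F> \<and> C = Q \<inter> {x. a h \<bullet> x = b h})"
    "inj_on (\<lambda>h. Q \<inter> {x. a h \<bullet> x = b h}) \<F>"
    by (rule polyhedron_facet_halfspaces[OF polytope_imp_polyhedron[OF poly]]) (rule that)
  have "\<exists>h. h \<in> \<F> \<and> G (?V - {p}) = Q \<inter> {x. a h \<bullet> x = b h}" if "p \<in> ?V" for p
    using facet[OF that] \<F>(4) by blast
  then obtain h where h: "\<And>p. p \<in> ?V \<Longrightarrow> h p \<in> \<F> \<and> G (?V - {p}) = Q \<inter> {x. a (h p) \<bullet> x = b (h p)}" by metis
  have h_surj: "\<exists>p\<in>?V. f = h p" if f: "f \<in> \<F>" for f
  proof -
    have "(Q \<inter> {x. a f \<bullet> x = b f}) facet_of Q" using \<F>(4) f by blast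
    from facetE[OF this] obtain p where p: "p \<in> ?V" "Q \<inter> {x. a f \<bullet> x = b f} = G (?V - {p})"
      by blast
    have "Q \<inter> {x. a f \<bullet> x = b f} = Q \<inter> {x. a (h p) \<bullet> x = b (h p)}" "h p \<in> \<F>"
      using p h[OF p(1)] by simp_all
    then have "f = h p" using inj_onD[OF \<F>(5) _ f] by blast
    then show ?thesis using p(1) by blast
  qed
  show ?thesis
  proof (rule that[of "\<lambda>p. a (h p)" "\<lambda>p. b (h p)"])
    show sub: "Q \<subseteq> {x. a (h p) \<bullet> x \<le> b (h p)}" if "p \<in> ?V" for p
      using h[OF that] \<F>(2) \<F>(3)[of "h p"] by blast
    show "G (?V - {p}) = Q \<inter> {x. a (h p) \<bullet> x = b (h p)}" if "p \<in> ?V" for p using h[OF that] by blast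
    show "Q = affine hull Q \<inter> {x. \<forall>p\<in>?V. a (h p) \<bullet> x \<le> b (h p)}"
    proof
      show "Q \<subseteq> affine hull Q \<inter> {x. \<forall>p\<in>?V. a (h p) \<bullet> x \<le> b (h p)}"
        using sub hull_subset[of Q affine] by blast
      show "affine hull Q \<inter> {x. \<forall>p\<in>?V. a (h p) \<bullet> x \<le> b (h p)} \<subseteq> Q"
      proof
        fix x assume x: "x \<in> affine hull Q \<inter> {x. \<forall>p\<in>?V. a (h p) \<bullet> x \<le> b (h p)}"
        have "x \<in> f" if f: "f \<in> \<F>" for f
        proof -
          obtain p where "p \<in> ?V" "f = h p" using h_surj[OF f] by blast
          then show ?thesis using x \<F>(3)[OF f] by blast
        qed
        then show "x \<in> Q" using x \<F>(2) by blast
      qed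
    qed
  qed
qed

section \<open>Directions with few positive facet normals\<close>

lemma split_bounded_sum:
  fixes h :: "'i \<Rightarrow> nat"
  assumes "finite R" "k \<le> (\<Sum>i\<in>R. h i)"
  obtains f where "\<And>i. i \<in> R \<Longrightarrow> f i \<le> h i" "\<And>i. i \<notin> R \<Longrightarrow> f i = 0" "(\<Sum>i\<in>R. f i) = k"
proof -
  have "\<exists>f. (\<forall>i\<in>R. f i \<le> h i) \<and> (\<forall>i. i \<notin> R \<longrightarrow> f i = 0) \<and> (\<Sum>i\<in>R. f i) = k"
    using assms
  proof (induction R arbitrary: k rule: finite_induct)
    case empty
    then show ?case by (intro exI[of _ "\<lambda>_. 0"]) auto
  next
    case (insert x R)
    let ?m = "min k (h x)"
    have "k - ?m \<le> (\<Sum>i\<in>R. h i)" using insert by auto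
    then obtain f where f: "\<forall>i\<in>R. f i \<le> h i" "\<forall>i. i \<notin> R \<longrightarrow> f i = 0" "(\<Sum>i\<in>R. f i) = k - ?m"
      using insert.IH by blast
    have "(\<Sum>i\<in>R. (f(x := ?m)) i) = (\<Sum>i\<in>R. f i)" using insert(2) by (intro sum.cong) auto
    then show ?case using f insert(1,2) by (intro exI[of _ "f(x := ?m)"]) auto
  qed
  then show ?thesis using that by blast
qed

text \<open>A relative interior point \<open>x\<close> of \<open>G U\<close> is strict in all
  inequalities labelled by \<open>U\<close>, so a short step preserves them. The remaining ones may
  be tight, but there \<open>y\<close> has nonpositive inner product with the normal.\<close>

lemma (in product_faces) direction_stays_in_polytope:
  assumes A: "\<And>p. p \<in> labels ns \<Longrightarrow> Q \<subseteq> {x. A p \<bullet> x \<le> \<beta> p}"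
    "\<And>p. p \<in> labels ns \<Longrightarrow> G (labels ns - {p}) = Q \<inter> {x. A p \<bullet> x = \<beta> p}"
    "Q = affine hull Q \<inter> {x. \<forall>p\<in>labels ns. A p \<bullet> x \<le> \<beta> p}"
    and n: "\<forall>i<length ns. ns ! i \<ge> 1"
    and q0: "q0 \<in> Q" and y: "y \<in> span ((\<lambda>x. x - q0) ` Q)"
    and U: "U \<in> cells ns" "{p \<in> labels ns. A p \<bullet> y > 0} \<subseteq> U"
  obtains x e where "x \<in> G U" "e > 0" "x + e *\<^sub>R y \<in> Q"
proof -
  let ?V = "labels ns"
  have cU: "convex (G U)" using face(1)[OF U(1)] by (rule face_of_imp_convex)
  obtain x where x: "x \<in> rel_interior (G U)" using rel_interior_eq_empty[OF cU] face(2)[OF U(1)] by blast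
  have xU: "x \<in> G U" using x rel_interior_subset by blast
  have xQ: "x \<in> Q" using xU face(1)[OF U(1)] face_of_imp_subset by blast
  have le: "A p \<bullet> x \<le> \<beta> p" if "p \<in> ?V" for p using A(1)[OF that] xQ by blast
  have lt: "A p \<bullet> x < \<beta> p" if p: "p \<in> ?V" "p \<in> U" for p
  proof (rule ccontr)
    assume "\<not> A p \<bullet> x < \<beta> p"
    then have "x \<in> G (?V - {p})" using le[OF p(1)] A(2)[OF p(1)] xQ by auto
    moreover have Vp: "?V - {p} \<in> cells ns"
      by (rule labels_remove_in_cells[OF n])
    moreover have "G U \<subseteq> Q" using face(1)[OF U(1)] by (rule face_of_imp_subset)
    ultimately have "G U \<subseteq> G (?V - {p})"
      using subset_of_face_of[OF face(1)[OF Vp], of "G U"] x by blast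
    then show False using order[OF U(1) Vp] p(2) by blast
  qed
  have "\<forall>\<^sub>F e in at_right (0::real). \<forall>p\<in>?V. A p \<bullet> (x + e *\<^sub>R y) \<le> \<beta> p"
  proof (rule eventually_ball_finite[OF finite_labels], rule ballI)
    fix p assume p: "p \<in> ?V"
    show "\<forall>\<^sub>F e in at_right (0::real). A p \<bullet> (x + e *\<^sub>R y) \<le> \<beta> p"
    proof (cases "p \<in> U")
      case True
      have "((\<lambda>e. A p \<bullet> (x + e *\<^sub>R y)) \<longlongrightarrow> A p \<bullet> (x + 0 *\<^sub>R y)) (at_right 0)" by (intro tendsto_intros)
      moreover have "A p \<bullet> (x + 0 *\<^sub>R y) < \<beta> p" using lt[OF p True] by simp
      ultimately have "\<forall>\<^sub>F e in at_right 0. A p \<bullet> (x + e *\<^sub>R y) < \<beta> p" by (rule order_tendstoD(2))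
      then show ?thesis by (rule eventually_mono) simp
    next
      case False
      then have "\<not> A p \<bullet> y > 0" using U(2) p by blast
      then have np: "A p \<bullet> y \<le> 0" by simp
      have "\<forall>\<^sub>F e in at_right (0::real). e > 0" by (rule eventually_at_right_less)
      then show ?thesis
      proof (rule eventually_mono)
        fix e :: real assume "e > 0"
        then have "e * (A p \<bullet> y) \<le> 0" using np by (simp add: mult_nonneg_nonpos)
        then show "A p \<bullet> (x + e *\<^sub>R y) \<le> \<beta> p" using le[OF p] by (simp add: inner_add_right)
      qed
    qed
  qed
  then have "\<forall>\<^sub>F e in at_right (0::real). e > 0 \<and> (\<forall>p\<in>?V. A p \<bullet> (x + e *\<^sub>R y) \<le> \<beta> p)"
    using eventually_at_right_less by (rule eventually_conj[rotated])
  then obtain e where e: "e > 0" "\<forall>p\<in>?V. A p \<bullet> (x + e *\<^sub>R y) \<le> \<beta> p"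
    using eventually_happens[of _ "at_right (0::real)"] trivial_limit_at_right_real by blast
  have "x + e *\<^sub>R y \<in> affine hull Q"
  proof -
    have hull: "affine hull Q = (\<lambda>x. q0 + x) ` span ((\<lambda>x. x - q0) ` Q)"
      using affine_hull_span_gen[of q0 Q] q0 by (simp add: hull_inc)
    have "x - q0 \<in> span ((\<lambda>x. x - q0) ` Q)" using xQ by (intro span_base) auto
    then have "x - q0 + e *\<^sub>R y \<in> span ((\<lambda>x. x - q0) ` Q)" using y by (intro span_add span_scale)
    then have "q0 + (x - q0 + e *\<^sub>R y) \<in> affine hull Q" unfolding hull by blast
    then show ?thesis by simp
  qed
  then have "x + e *\<^sub>R y \<in> Q" using e(2) A(3) by blast
  then show ?thesis using that xU e(1) by blast
qed

text \<open>Each factor of dimension at least 2 contributes one color of size \<open>2 f(i) + 3\<close>, all other chosen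
  facets form colors of size one; from a factor of dimension 1 only one facet is used.\<close>

lemma sparse_positive_direction:
  fixes A :: "nat \<times> nat \<Rightarrow> 'b::euclidean_space" and f :: "nat \<Rightarrow> nat"
  assumes n: "length ns \<ge> 1" "\<forall>i<length ns. ns ! i \<ge> 1"
    and f: "\<And>i. i < length ns \<Longrightarrow> ns ! i \<ge> 2 \<Longrightarrow> 2 * f i + 2 \<le> ns ! i"
    and W: "subspace W" "(\<Sum>i<length ns. ns ! i) \<le>
      dim W + (\<Sum>i<length ns. if ns ! i \<ge> 2 then 2 * f i + 1 else 0)"
  obtains \<phi> where "\<phi> \<in> W" "\<phi> \<noteq> 0"
    "\<And>i. i < length ns \<Longrightarrow> card {j. j \<le> ns ! i \<and> A (i, j) \<bullet> \<phi> > 0} \<le> f i + 1"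
proof -
  let ?r = "length ns"
  \<comment> \<open>Odd, and half of it rounded down is \<open>f i + 1\<close>.\<close>
  define s where "s i = 2 * f i + 3" for i
  \<comment> \<open>Colors of factor \<open>i\<close>: the entry 0 stands for the large class of the
    labels below \<open>s i\<close>, each \<open>j \<ge> s i\<close> for a class of its own.\<close>
  define J where "J i = insert 0 {j. ns ! i \<ge> 2 \<and> s i \<le> j \<and> j \<le> ns ! i}" for i
  define I where "I = (SIGMA i:{..<?r}. J i)"
  \<comment> \<open>In a factor of dimension 1 the label 1 is left out. It may become positive,
    which the bound \<open>f i + 1\<close> allows.\<close>
  define X where "X = {p \<in> labels ns. ns ! fst p \<ge> 2 \<or> snd p = 0}"
  define c where "c p = (if snd p < s (fst p) then (fst p, 0) else p)" for p :: "nat \<times> nat"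
  have finJ: "finite (J i)" for i by (simp add: J_def)
  have cardJ: "card (J i) + (if ns ! i \<ge> 2 then 2 * f i + 1 else 0) = ns ! i" if "i < ?r" for i
  proof (cases "ns ! i \<ge> 2")
    case True
    then have "J i = insert 0 {s i..ns ! i}" by (auto simp: J_def)
    moreover have "0 \<notin> {s i..ns ! i}" by (simp add: s_def)
    ultimately have "card (J i) = Suc (Suc (ns ! i) - s i)" by simp
    then show ?thesis using f[OF that True] True by (simp add: s_def)
  next
    case False
    then have "ns ! i = 1" "J i = {0}" using n(2) that by (auto simp: J_def le_Suc_eq)
    then show ?thesis by simp
  qed
  have "card I = (\<Sum>i<?r. card (J i))" unfolding I_def by (rule card_SigmaI) (use finJ in auto)
  then have "card I + (\<Sum>i<?r. if ns ! i \<ge> 2 then 2 * f i + 1 else 0) = (\<Sum>i<?r. ns ! i)"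
    using cardJ by (simp add: sum.distrib[symmetric])
  then have cI: "card I \<le> dim W" using W(2) by linarith
  have finI: "finite I" unfolding I_def using finJ by auto
  have "(0, 0) \<in> I" using n(1) by (auto simp: I_def J_def)
  then have "card I > 0" using finI by (auto simp: card_gt_0_iff)
  then have dW: "dim W \<noteq> 0" using cI by linarith
  have finX: "finite X" by (simp add: X_def finite_labels)
  have cX: "c ` X \<subseteq> I"
  proof
    fix q assume "q \<in> c ` X"
    then obtain p where p: "p \<in> X" "q = c p" by blast
    then have "fst p < ?r" "snd p \<le> ns ! fst p" "ns ! fst p \<ge> 2 \<or> snd p = 0" by (auto simp: X_def labels_def)
    then show "q \<in> I" using p(2) by (cases p) (auto simp: c_def I_def J_def s_def)
  qed
  have big: "{p \<in> X. c p = (i, 0)} = Pair i ` {..<s i}" if "i < ?r" "ns ! i \<ge> 2" for i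
    using f[OF that] that by (auto simp: X_def labels_def c_def s_def split: if_splits)
  have small: "{p \<in> X. c p = (i, 0)} = {(i, 0)}" if "i < ?r" "\<not> ns ! i \<ge> 2" for i
    using that by (auto simp: X_def labels_def c_def s_def split: if_splits)
  have single: "{p \<in> X. c p = (i, j)} = {(i, j)}" if "i < ?r" "ns ! i \<ge> 2" "s i \<le> j" "j \<le> ns ! i" for i j
    using that by (auto simp: X_def labels_def c_def s_def split: if_splits)
  have odd_class: "odd (card {p \<in> X. c p = q})" if "q \<in> I" for q
  proof -
    obtain i j where q: "q = (i, j)" by (cases q)
    then have ij: "i < ?r" "j \<in> J i" using that by (auto simp: I_def)
    show ?thesis
    proof (cases "j = 0")
      case True
      have "card (Pair i ` {..<s i}) = s i" by (simp add: card_image inj_on_def)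
      then show ?thesis using big[OF ij(1)] small[OF ij(1)] q True by (cases "ns ! i \<ge> 2") (simp_all add: s_def)
    next
      case False
      then show ?thesis using single[OF ij(1)] ij(2) q by (auto simp: J_def)
    qed
  qed
  obtain \<phi> where \<phi>: "\<phi> \<in> W" "\<phi> \<noteq> 0"
    "\<And>q. q \<in> I \<Longrightarrow> 2 * card {p \<in> X. c p = q \<and> \<phi> \<bullet> A p > 0} \<le> card {p \<in> X. c p = q}"
    using ham_sandwich_in_subspace[OF W(1) cI dW finX finI cX odd_class, of A] by blast
  \<comment> \<open>Half of a class of size one, rounded down, is zero.\<close>
  have alone: "\<not> A p \<bullet> \<phi> > 0" if "q \<in> I" "{p \<in> X. c p = q} = {p}" for p q
  proof
    assume "A p \<bullet> \<phi> > 0"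
    then have "{p \<in> X. c p = q \<and> \<phi> \<bullet> A p > 0} = {p}" using that(2) by (auto simp: inner_commute)
    then show False using \<phi>(3)[OF that(1)] that(2) by simp
  qed
  have "card {j. j \<le> ns ! i \<and> A (i, j) \<bullet> \<phi> > 0} \<le> f i + 1" if i: "i < ?r" for i
  proof (cases "ns ! i \<ge> 2")
    case True
    let ?S = "{j. j \<le> ns ! i \<and> A (i, j) \<bullet> \<phi> > 0}"
    have "j < s i" if "j \<in> ?S" for j
    proof (rule ccontr)
      assume "\<not> j < s i"
      then have "(i, j) \<in> I" "{p \<in> X. c p = (i, j)} = {(i, j)}"
        using that single[OF i True, of j] i True by (auto simp: I_def J_def)
      then show False using alone that by blast
    qed
    then have "Pair i ` ?S \<subseteq> {p \<in> X. c p = (i, 0) \<and> \<phi> \<bullet> A p > 0}"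
      using i True by (auto simp: X_def labels_def c_def inner_commute)
    then have "card (Pair i ` ?S) \<le> card {p \<in> X. c p = (i, 0) \<and> \<phi> \<bullet> A p > 0}"
      using finX by (intro card_mono) auto
    moreover have "card (Pair i ` ?S) = card ?S" by (simp add: card_image inj_on_def)
    moreover have "(i, 0) \<in> I" using i by (simp add: I_def J_def)
    moreover have "card {p \<in> X. c p = (i, 0)} = s i"
      unfolding big[OF i True] by (simp add: card_image inj_on_def)
    ultimately have "2 * card ?S \<le> s i" using \<phi>(3)[of "(i, 0)"] by simp
    then show ?thesis by (simp add: s_def)
  next
    case False
    then have ni: "ns ! i = 1" using n(2) i by (auto simp: le_Suc_eq)
    have "(i, 0) \<in> I" using i by (simp add: I_def J_def)
    then have "\<not> A (i, 0) \<bullet> \<phi> > 0" using alone small[OF i False] by blast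
    then have "{j. j \<le> ns ! i \<and> A (i, j) \<bullet> \<phi> > 0} \<subseteq> {1}" using ni by (auto simp: le_Suc_eq)
    then have "card {j. j \<le> ns ! i \<and> A (i, j) \<bullet> \<phi> > 0} \<le> card {1::nat}" by (intro card_mono) auto
    then show ?thesis by simp
  qed
  then show ?thesis using that \<phi>(1,2) by blast
qed

text \<open>The facet named \<open>p\<close> contains the cell \<open>U\<close> exactly if
  \<open>p \<notin> U\<close>, so all labels with positive normals must go into \<open>U\<close>;
  one label per factor is free, and the \<open>f i\<close> add up to the dimension.\<close>

lemma sparse_cell:
  assumes B: "B \<subseteq> labels ns" "\<And>i. i < length ns \<Longrightarrow> card {j. (i, j) \<in> B} \<le> f i + 1"
  obtains U where "U \<in> cells ns" "B \<subseteq> U" "card U \<le> length ns + (\<Sum>i<length ns. f i)"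
proof -
  \<comment> \<open>A cell needs a label in every factor; the default 0 costs one label, within the
    allowance \<open>f i + 1\<close>.\<close>
  define V where "V i = (if {j. (i, j) \<in> B} = {} then {0} else {j. (i, j) \<in> B})" for i
  let ?U = "SIGMA i:{..<length ns}. V i"
  have sub: "{j. (i, j) \<in> B} \<subseteq> {..ns ! i}" for i using B(1) by (auto simp: labels_def)
  have V: "V i \<noteq> {}" "V i \<subseteq> {..ns ! i}" for i using sub[of i] by (auto simp: V_def)
  then have fin: "finite (V i)" for i using finite_subset by blast
  have "fst ` ?U = {..<length ns}" using V(1) by (force simp: image_iff)
  then have "?U \<in> cells ns" using V(2) by (auto simp: cells_def labels_def)
  moreover have "B \<subseteq> ?U" using B(1) by (auto simp: V_def labels_def)
  moreover have "card ?U \<le> length ns + (\<Sum>i<length ns. f i)"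
  proof -
    have "card ?U = (\<Sum>i<length ns. card (V i))" using fin by (intro card_SigmaI) auto
    also have "\<dots> \<le> (\<Sum>i<length ns. f i + 1)" using B(2) by (intro sum_mono) (auto simp: V_def)
    also have "\<dots> = length ns + (\<Sum>i<length ns. f i)" by (simp only: sum.distrib) simp
    finally show ?thesis .
  qed
  ultimately show ?thesis using that by blast
qed

theorem theorem4p6:
  fixes ns :: "nat list" and k :: nat
    and D :: "'c::euclidean_space set"
    and Q :: "'b::euclidean_space set"
    and P :: "'a::euclidean_space set"
    and g :: "'b \<Rightarrow> 'a"
  assumes "length ns \<ge> 1"
    and "\<forall>i<length ns. ns!i \<ge> 1"
    and "k \<le> (\<Sum>i\<in>{i. i < length ns \<and> ns!i \<ge> 2}. (ns!i - 2) div 2)"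
    and "prod_simplices ns D"
    and "polytope P" and "skel_equiv k P D"
    and "polytope Q" and "comb_equiv Q D" and "linear g" and "g ` Q = P"
  shows "aff_dim P \<ge> 2 * int k + int (card {i. i < length ns \<and> ns!i \<ge> 2}) + 1"
proof (rule ccontr)
  let ?r = "length ns" and ?R = "{i. i < length ns \<and> ns!i \<ge> 2}"
  assume "\<not> ?thesis"
  then have small: "aff_dim P \<le> 2 * int k + int (card ?R)" by simp
  obtain a where "simplex_product ns a D"
    using assms(4) unfolding prod_simplices_def simplex_product_def by blast
  then have D: "product_faces ns D (simplex_product.cell ns a)"
    by (rule simplex_product.product_faces_cell)
  obtain G where G: "product_faces ns Q G" using product_faces_transfer[OF D assms(7,8)] .
  interpret product_faces ns Q G by (rule G)
  obtain f where f: "\<And>i. i \<in> ?R \<Longrightarrow> f i \<le> (ns!i - 2) div 2" "\<And>i. i \<notin> ?R \<Longrightarrow> f i = 0" "(\<Sum>i\<in>?R. f i) = k"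
    by (rule split_bounded_sum[OF _ assms(3)]) auto
  have f2: "2 * f i + 2 \<le> ns ! i" if "i < ?r" "ns ! i \<ge> 2" for i using f(1)[of i] that by auto
  have Rsub: "?R \<subseteq> {..<?r}" by auto
  have fk: "(\<Sum>i<?r. f i) = k"
    unfolding f(3)[symmetric] by (rule sum.mono_neutral_right) (use f(2) in auto)
  have "(\<Sum>i<?r. if ns ! i \<ge> 2 then 2 * f i + 1 else 0) = (\<Sum>i\<in>?R. 2 * f i + 1)"
    by (rule sum.mono_neutral_cong_right) auto
  also have "\<dots> = 2 * k + card ?R" by (simp only: sum.distrib sum_distrib_left[symmetric] f(3)) simp
  finally have fR: "(\<Sum>i<?r. if ns ! i \<ge> 2 then 2 * f i + 1 else 0) = 2 * k + card ?R" .
  have "card (labels ns) = (\<Sum>i<?r. ns ! i + 1)" by (simp add: labels_def)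
  also have "\<dots> = (\<Sum>i<?r. ns ! i) + ?r" by (simp only: sum.distrib) simp
  finally have dimQ: "aff_dim Q = int (\<Sum>i<?r. ns ! i)"
    using aff_dim_cell[OF labels_in_cells] G_labels by simp
  have "Q \<noteq> {}" using face[OF labels_in_cells] G_labels by simp
  then obtain q where q: "q \<in> Q" by blast
  define L where "L = span ((\<lambda>x. x - q) ` Q)"
  \<comment> \<open>Only kernel vectors in the direction space of \<open>Q\<close> qualify, as
    \<open>Q\<close> need not be full-dimensional.\<close>
  define W where "W = {y \<in> L. g y = 0}"
  have L: "subspace L" by (simp add: L_def)
  have W: "subspace W"
    using L by (auto simp: W_def subspace_def linear_0[OF assms(9)] linear_add[OF assms(9)] linear_scale[OF assms(9)])
  have "aff_dim Q = int (dim L)"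
    using aff_dim_eq_dim_subtract[of q Q] q by (simp add: L_def dim_span hull_inc)
  moreover have "aff_dim P = int (dim (g ` L))"
  proof -
    have "g ` L = span ((\<lambda>x. x - g q) ` P)"
      unfolding L_def linear_span_image[OF assms(9), symmetric] assms(10)[symmetric]
      by (simp add: image_image linear_diff[OF assms(9)])
    moreover have "g q \<in> P" using q assms(10) by blast
    ultimately show ?thesis using aff_dim_eq_dim_subtract[of "g q" P] by (simp add: dim_span hull_inc)
  qed
  moreover have "dim L \<le> dim W + dim (g ` L)" unfolding W_def by (rule dim_le_kernel_image[OF assms(9) L])
  \<comment> \<open>The kernel has dimension at least \<open>aff_dim Q - aff_dim P\<close>, which by
    \<open>small\<close> is at least the number of colors.\<close>
  ultimately have "(\<Sum>i<?r. ns ! i) \<le> dim W + (2 * k + card ?R)" using dimQ small by linarith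
  then have dW: "(\<Sum>i<?r. ns ! i) \<le> dim W + (\<Sum>i<?r. if ns ! i \<ge> 2 then 2 * f i + 1 else 0)"
    unfolding fR .
  obtain A \<beta> where A: "\<And>p. p \<in> labels ns \<Longrightarrow> Q \<subseteq> {x. A p \<bullet> x \<le> \<beta> p}"
    "\<And>p. p \<in> labels ns \<Longrightarrow> G (labels ns - {p}) = Q \<inter> {x. A p \<bullet> x = \<beta> p}"
    "Q = affine hull Q \<inter> {x. \<forall>p\<in>labels ns. A p \<bullet> x \<le> \<beta> p}"
    by (rule facet_normals[OF assms(2)]) (rule that)
  obtain y where y: "y \<in> W" "y \<noteq> 0"
    "\<And>i. i < ?r \<Longrightarrow> card {j. j \<le> ns ! i \<and> A (i, j) \<bullet> y > 0} \<le> f i + 1"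
    by (rule sparse_positive_direction[OF assms(1,2) f2 W dW, of A]; (assumption | (rule that; assumption)))
  let ?B = "{p \<in> labels ns. A p \<bullet> y > 0}"
  have "card {j. (i, j) \<in> ?B} \<le> f i + 1" if "i < ?r" for i
    using y(3)[OF that] that by (simp add: labels_def)
  then obtain U where U: "U \<in> cells ns" "?B \<subseteq> U" "card U \<le> ?r + k"
    using sparse_cell[of ?B ns f] fk by auto
  have yL: "y \<in> span ((\<lambda>x. x - q) ` Q)" and gy: "g y = 0" using y(1) by (auto simp: W_def L_def)
  obtain x e where x: "x \<in> G U" "e > 0" "x + e *\<^sub>R y \<in> Q"
    by (rule direction_stays_in_polytope[OF A assms(2) q yL U(1,2)]; (assumption | (rule that; assumption)))
  have "g (x + e *\<^sub>R y) = g x"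
    using gy by (simp add: linear_add[OF assms(9)] linear_scale[OF assms(9)])
  \<comment> \<open>A point of a strictly preserved face would share its image with a second point
    of \<open>Q\<close>.\<close>
  then have "x = x + e *\<^sub>R y"
    using strictly_preserved[OF D G assms(5,6,9,10) U(1,3) x(1,3)] by simp
  then show False using x(2) y(2) by simp
qed

end
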